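(* Let $(M,\mathcal B,\mu,\Phi_t)$ be an ergodic dynamical system with pure point spectrum and smooth Koopman eigenfunctions, observed through a smooth embedding $F:M\to\mathbb R^d$ with i.i.d. observational noise $\xi_i$, as described in the context. Let $f\in L^2(M,\mu)$ be an observable with values $\vec f=(f(a_{s-1}),\dots,f(a_{N-1}))$ on the sampled states $\{a_i\}_{i=s-1}^{N-1}$, let $\tilde P$ be the Markov matrix constructed from the noisy data with $s$ delays and $N=N(s)$ samples, and let $\mathcal P_\epsilon$ be the associated averaging operator on $L^2(M,\mu)$, both defined in the context for bandwidth $\epsilon>0$. Then, for a suitable scaling $N(s)$ with $N(s)/s\to\infty$ as $s\to\infty$, for $\mu$-a.e. starting state $a_0$, almost surely with respect to the noise, and uniformly with respect to $a_i\in M$, $$\lim_{\substack{s\to\infty\\ N(s)/s\to\infty}}(\tilde P\vec f)_i=\mathcal P_\epsilon f(a_i)+O(\epsilon^2),$$ that is, there is a constant $C$ independent of $i$ and of (small) $\epsilon$ such that $\limsup_{s\to\infty}\max_{s-1\le i\le N(s)-1}|(\tilde P\vec f)_i-\mathcal P_\epsilon f(a_i)|\le C\epsilon^2$.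
   Context: Setting. $M$ is a closed, connected, compact, orientable $C^\infty$ manifold of dimension $m$; $\Phi_t$, $t\in\mathbb R$, is a smooth flow; $\mu$ is a $\Phi_t$-invariant Borel probability measure with smooth positive density in local coordinates; for a fixed $T>0$ the discrete-time system $\hat\Phi_n=\Phi_{nT}$ is ergodic for $\mu$. Pure point spectrum with smooth eigenfunctions: there are rationally independent reals $\Omega_1,\dots,\Omega_m$ and $C^\infty$ functions $\zeta_i$, $|\zeta_i|=1$, with $\zeta_i\circ\Phi_t=e^{\mathrm i\Omega_it}\zeta_i$, such that the products $\prod_i\zeta_i^{k_i}$, $k\in\mathbb Z^m$, form an orthonormal basis of $L^2(M,\mu)$. Data. $a_i=\hat\Phi_i(a_0)$, $x_i=F(a_i)$, and the noisy observations are $\tilde x_i=x_i+\xi_i$, $i=0,\dots,N-1$, where the $\xi_i$ are i.i.d. random variables in $\mathbb R^d$ with $\mathbb E(\xi_i)=0$, $\mathbb E(\|\xi_i\|^2)=R^2<\infty$, and finite third and fourth moments. For $s$ delays and $i\ge s-1$: $\tilde X_i=(\tilde x_i,\tilde x_{i-1},\dots,\tilde x_{i-s+1})\in\mathbb R^{sd}$, and noise-free $X_i=F_s(a_i)$ with $F_s(a)=(F(a),F(\hat\Phi_{-1}(a)),\dots,F(\hat\Phi_{-s+1}(a)))$. $\mathbb R^{sd}$ carries the time-averaged norm $\|(y_0,\dots,y_{s-1})\|^2=\frac1s\sum_{k=0}^{s-1}\|y_k\|^2_{\mathbb R^d}$. Density estimate. Let $\bar K_\epsilon(X,Y)=e^{-\|X-Y\|^2/\epsilon}$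 and, with $n=N(s)-s+1$, $$\kappa_\epsilon(\tilde X_i,\tilde X_j)=\frac{\bar K_\epsilon(\tilde X_i,\tilde X_j)}{n^{-2}\sum_{k,l=s-1}^{N(s)-1}\bar K_\epsilon(\tilde X_k,\tilde X_l)},\qquad \tau_{s,\epsilon}(\tilde X_i)=\frac1n\sum_{j=s-1}^{N(s)-1}\kappa_\epsilon(\tilde X_i,\tilde X_j).$$ Kernel and Markov matrix. $$K_\epsilon(\tilde X_i,\tilde X_j)=\exp\left(-\frac{\|\tilde X_i-\tilde X_j\|^2}{\epsilon\,\tau_{s,\epsilon}^{-1/m}(\tilde X_i)\,\tau_{s,\epsilon}^{-1/m}(\tilde X_j)}\right),$$ $$\tilde H_{ij}=\frac{K_\epsilon(\tilde X_i,\tilde X_j)}{\sum_{k=s-1}^{N-1}K_\epsilon(\tilde X_j,\tilde X_k)},\qquad \tilde P_{ij}=\frac{\tilde H_{ij}}{\sum_{k=s-1}^{N-1}\tilde H_{ik}},\qquad s-1\le i,j\le N-1.$$ Averaging operator. $\mathcal P_\epsilon$ is built from the noise-free version of this kernel in the limit of infinitely many delays. For $a,b\in M$ let $$\bar\tau_\epsilon(a)=\lim_{s\to\infty}\frac{\int_M\bar K_\epsilon(F_s(a),F_s(b))\,d\mu(b)}{\int_M\int_M\bar K_\epsilon(F_s(b),F_s(c))\,d\mu(b)\,d\mu(c)},$$ $$k_\epsilon(a,b)=\lim_{s\to\infty}\exp\left(-\frac{\|F_s(a)-F_s(b)\|^2}{\epsilon\,\bar\tau_\epsilon^{-1/m}(a)\,\bar\tau_\epsilon^{-1/m}(b)}\right).$$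 Set $\mathcal G_\epsilon f=\epsilon^{-m/2}\int_Mk_\epsilon(\cdot,b)f(b)\,d\mu(b)$, $q_\epsilon=\mathcal G_\epsilon1$, $\mathcal H_\epsilon f=\mathcal G_\epsilon(f/q_\epsilon)$, $d_\epsilon=\mathcal H_\epsilon1$, and $\mathcal P_\epsilon f=\mathcal H_\epsilon f/d_\epsilon$. *)

theory Defs
  imports "HOL-Probability.Probability"
begin

section \<open>Smooth manifolds given by an atlas\<close>

text \<open>
  The relation \<open>C_on n S f\<close> says that \<open>f\<close> is of class \<open>C\<^sup>n\<close> on the open set \<open>S\<close>.
  Over finite-dimensional spaces it suffices to control all iterated directional derivatives.
\<close>

primrec C_on ::
  "nat \<Rightarrow> 'a::real_normed_vector set \<Rightarrow> ('a \<Rightarrow> 'b::real_normed_vector) \<Rightarrow> bool" where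
  "C_on 0 S f \<longleftrightarrow> continuous_on S f"
| "C_on (Suc n) S f \<longleftrightarrow>
     (\<forall>x\<in>S. f differentiable (at x)) \<and>
     (\<forall>v. C_on n S (\<lambda>x. frechet_derivative f (at x) v))"

definition smooth_on ::
  "'a::real_normed_vector set \<Rightarrow> ('a \<Rightarrow> 'b::real_normed_vector) \<Rightarrow> bool" where
  "smooth_on S f \<longleftrightarrow> (\<forall>n. C_on n S f)"

text \<open>
  A chart is a pair of its open domain and a coordinate map; the values of the coordinate map
  outside the domain are irrelevant.  The manifold is the whole type, so charts without boundary
  points make it a closed manifold as soon as it is compact.
\<close>

type_synonym ('a, 'm) chart = "'a set \<times> ('a \<Rightarrow> real ^ 'm)"

definition is_chart :: "('a::topological_space, 'm::finite) chart \<Rightarrow> bool" where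
  "is_chart = (\<lambda>(U, \<phi>). open U \<and> open (\<phi> ` U) \<and> homeomorphism U (\<phi> ` U) \<phi> (inv_into U \<phi>))"

definition smooth_atlas :: "('a::topological_space, 'm::finite) chart set \<Rightarrow> bool" where
  "smooth_atlas \<A> \<longleftrightarrow>
     (\<forall>c\<in>\<A>. is_chart c) \<and> (\<Union>(U, \<phi>)\<in>\<A>. U) = UNIV \<and>
     (\<forall>(U, \<phi>)\<in>\<A>. \<forall>(V, \<psi>)\<in>\<A>. smooth_on (\<phi> ` (U \<inter> V)) (\<psi> \<circ> inv_into U \<phi>))"

definition oriented_atlas :: "('a::topological_space, 'm::finite) chart set \<Rightarrow> bool" where
  "oriented_atlas \<A> \<longleftrightarrow> smooth_atlas \<A> \<and>
     (\<forall>(U, \<phi>)\<in>\<A>. \<forall>(V, \<psi>)\<in>\<A>. \<forall>x\<in>\<phi> ` (U \<inter> V).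
        det (matrix (frechet_derivative (\<psi> \<circ> inv_into U \<phi>) (at x))) > 0)"

definition orientable :: "('a::topological_space, 'm::finite) chart set \<Rightarrow> bool" where
  "orientable \<A> \<longleftrightarrow> (\<exists>\<B>. oriented_atlas \<B> \<and> smooth_atlas (\<A> \<union> \<B>))"

definition closed_connected_orientable_manifold ::
  "('a::{t2_space, second_countable_topology}, 'm::finite) chart set \<Rightarrow> bool" where
  "closed_connected_orientable_manifold \<A> \<longleftrightarrow>
     smooth_atlas \<A> \<and> compact (UNIV :: 'a set) \<and> connected (UNIV :: 'a set) \<and> orientable \<A>"

definition smooth_fun ::
  "('a::topological_space, 'm::finite) chart set \<Rightarrow> ('a \<Rightarrow> 'b::real_normed_vector) \<Rightarrow> bool" where
  "smooth_fun \<A> g \<longleftrightarrow> (\<forall>(U, \<phi>)\<in>\<A>. smooth_on (\<phi> ` U) (g \<circ> inv_into U \<phi>))"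

definition smooth_embedding ::
  "('a::topological_space, 'm::finite) chart set \<Rightarrow> ('a \<Rightarrow> 'b::real_normed_vector) \<Rightarrow> bool" where
  "smooth_embedding \<A> F \<longleftrightarrow> smooth_fun \<A> F \<and>
     (\<exists>G. homeomorphism UNIV (range F) F G) \<and>
     (\<forall>(U, \<phi>)\<in>\<A>. \<forall>x\<in>\<phi> ` U. inj (frechet_derivative (F \<circ> inv_into U \<phi>) (at x)))"

text \<open>
  The last conjunct is smoothness of the map \<open>(t, a) \<mapsto> \<Phi> t a\<close> on the product manifold, read in
  charts; by joint continuity the set on which it is tested is open.
\<close>

definition smooth_flow ::
  "('a::topological_space, 'm::finite) chart set \<Rightarrow> (real \<Rightarrow> 'a \<Rightarrow> 'a) \<Rightarrow> bool" where
  "smooth_flow \<A> \<Phi> \<longleftrightarrow>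
     (\<forall>a. \<Phi> 0 a = a) \<and> (\<forall>t u a. \<Phi> (t + u) a = \<Phi> t (\<Phi> u a)) \<and>
     continuous_on UNIV (\<lambda>(t, a). \<Phi> t a) \<and>
     (\<forall>(U, \<phi>)\<in>\<A>. \<forall>(V, \<psi>)\<in>\<A>.
        smooth_on {(t, x). x \<in> \<phi> ` U \<and> \<Phi> t (inv_into U \<phi> x) \<in> V}
                  (\<lambda>(t, x). \<psi> (\<Phi> t (inv_into U \<phi> x))))"

definition smooth_positive_density ::
  "('a::topological_space, 'm::finite) chart set \<Rightarrow> 'a measure \<Rightarrow> bool" where
  "smooth_positive_density \<A> \<mu> \<longleftrightarrow>
     (\<forall>(U, \<phi>)\<in>\<A>. \<exists>\<rho>::real ^ 'm \<Rightarrow> real.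
        smooth_on (\<phi> ` U) \<rho> \<and> (\<forall>x\<in>\<phi> ` U. \<rho> x > 0) \<and>
        (\<forall>B\<in>sets borel. B \<subseteq> U \<longrightarrow> emeasure \<mu> B = (\<integral>\<^sup>+x\<in>\<phi> ` B. ennreal (\<rho> x) \<partial>lborel)))"


section \<open>Ergodicity and pure point spectrum\<close>

definition invariant_under_flow :: "'a measure \<Rightarrow> (real \<Rightarrow> 'a \<Rightarrow> 'a) \<Rightarrow> bool" where
  "invariant_under_flow \<mu> \<Phi> \<longleftrightarrow> (\<forall>t. \<Phi> t \<in> measurable \<mu> \<mu> \<and> distr \<mu> \<mu> (\<Phi> t) = \<mu>)"

definition ergodic_map :: "'a measure \<Rightarrow> ('a \<Rightarrow> 'a) \<Rightarrow> bool" where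
  "ergodic_map \<mu> S \<longleftrightarrow>
     (\<forall>B\<in>sets \<mu>. S -` B \<inter> space \<mu> = B \<longrightarrow> measure \<mu> B = 0 \<or> measure \<mu> B = 1)"

definition rationally_independent :: "('m::finite \<Rightarrow> real) \<Rightarrow> bool" where
  "rationally_independent \<Omega> \<longleftrightarrow>
     (\<forall>k::'m \<Rightarrow> int. (\<Sum>i\<in>UNIV. of_int (k i) * \<Omega> i) = 0 \<longrightarrow> (\<forall>i. k i = 0))"

definition L2 :: "'a measure \<Rightarrow> ('a \<Rightarrow> complex) set" where
  "L2 \<mu> = {f \<in> borel_measurable \<mu>. integrable \<mu> (\<lambda>a. (norm (f a))\<^sup>2)}"

text \<open>An orthonormal family with dense linear span in \<open>L\<^sup>2\<close>.\<close>

definition orthonormal_basis_L2 :: "'a measure \<Rightarrow> ('k \<Rightarrow> 'a \<Rightarrow> complex) \<Rightarrow> bool" where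
  "orthonormal_basis_L2 \<mu> e \<longleftrightarrow>
     (\<forall>k. e k \<in> L2 \<mu>) \<and>
     (\<forall>k l. (\<integral>a. e k a * cnj (e l a) \<partial>\<mu>) = (if k = l then 1 else 0)) \<and>
     (\<forall>f\<in>L2 \<mu>. \<forall>\<delta>>0. \<exists>K c. finite K \<and>
        (\<integral>a. (norm (f a - (\<Sum>k\<in>K. c k * e k a)))\<^sup>2 \<partial>\<mu>) < \<delta>)"

definition smooth_pure_point_spectrum ::
  "('a::topological_space, 'm::finite) chart set \<Rightarrow> 'a measure \<Rightarrow> (real \<Rightarrow> 'a \<Rightarrow> 'a) \<Rightarrow> bool" where
  "smooth_pure_point_spectrum \<A> \<mu> \<Phi> \<longleftrightarrow>
     (\<exists>(\<Omega>::'m \<Rightarrow> real) (\<zeta>::'m \<Rightarrow> 'a \<Rightarrow> complex).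
        rationally_independent \<Omega> \<and>
        (\<forall>i. smooth_fun \<A> (\<zeta> i)) \<and>
        (\<forall>i a. norm (\<zeta> i a) = 1) \<and>
        (\<forall>i t a. \<zeta> i (\<Phi> t a) = exp (\<i> * of_real (\<Omega> i * t)) * \<zeta> i a) \<and>
        orthonormal_basis_L2 \<mu> (\<lambda>(k::'m \<Rightarrow> int) a. \<Prod>i\<in>UNIV. \<zeta> i a powi k i))"


section \<open>Delay vectors and the Gaussian kernel\<close>

text \<open>
  A vector \<open>(y\<^sub>0, \<dots>, y\<^sub>s\<^sub>-\<^sub>1)\<close> of \<open>s\<close> blocks is given by a sequence of which only the entries with
  index below \<open>s\<close> matter; so one sequence serves all \<open>s\<close> at once.
\<close>

definition avg_norm :: "nat \<Rightarrow> (nat \<Rightarrow> 'b::real_normed_vector) \<Rightarrow> real" where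
  "avg_norm s y = sqrt ((1 / real s) * (\<Sum>k<s. (norm (y k))\<^sup>2))"

definition gauss :: "nat \<Rightarrow> real \<Rightarrow> (nat \<Rightarrow> 'b::real_normed_vector) \<Rightarrow> (nat \<Rightarrow> 'b) \<Rightarrow> real" where
  "gauss s \<epsilon> X Y = exp (- (avg_norm s (\<lambda>k. X k - Y k))\<^sup>2 / \<epsilon>)"

definition delay_map ::
  "(real \<Rightarrow> 'a \<Rightarrow> 'a) \<Rightarrow> real \<Rightarrow> ('a \<Rightarrow> 'b) \<Rightarrow> 'a \<Rightarrow> nat \<Rightarrow> 'b" where
  "delay_map \<Phi> T F a = (\<lambda>k. F (\<Phi> (- (real k * T)) a))"

text \<open>Used for \<open>i \<ge> s - 1\<close> only, so that the truncated subtraction is harmless.\<close>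

definition delay_vec :: "(nat \<Rightarrow> 'b) \<Rightarrow> nat \<Rightarrow> nat \<Rightarrow> 'b" where
  "delay_vec x i = (\<lambda>k. x (i - k))"


section \<open>The Markov matrix of a finite data set\<close>

text \<open>
  Here \<open>x\<close> is the time series, \<open>s\<close> the number of delays, \<open>N\<close> the number of samples and \<open>m\<close> the
  dimension of the manifold.
\<close>

definition idx :: "nat \<Rightarrow> nat \<Rightarrow> nat set" where
  "idx s N = {s - 1..<N}"

definition kappa ::
  "nat \<Rightarrow> nat \<Rightarrow> real \<Rightarrow> (nat \<Rightarrow> 'b::real_normed_vector) \<Rightarrow> nat \<Rightarrow> nat \<Rightarrow> real" where
  "kappa s N \<epsilon> x i j =
     gauss s \<epsilon> (delay_vec x i) (delay_vec x j) /
     ((1 / (real (N - s + 1))\<^sup>2) *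
        (\<Sum>k\<in>idx s N. \<Sum>l\<in>idx s N. gauss s \<epsilon> (delay_vec x k) (delay_vec x l)))"

definition tau :: "nat \<Rightarrow> nat \<Rightarrow> real \<Rightarrow> (nat \<Rightarrow> 'b::real_normed_vector) \<Rightarrow> nat \<Rightarrow> real" where
  "tau s N \<epsilon> x i = (1 / real (N - s + 1)) * (\<Sum>j\<in>idx s N. kappa s N \<epsilon> x i j)"

definition Kmat ::
  "nat \<Rightarrow> nat \<Rightarrow> nat \<Rightarrow> real \<Rightarrow> (nat \<Rightarrow> 'b::real_normed_vector) \<Rightarrow> nat \<Rightarrow> nat \<Rightarrow> real" where
  "Kmat m s N \<epsilon> x i j =
     exp (- (avg_norm s (\<lambda>k. delay_vec x i k - delay_vec x j k))\<^sup>2 /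
          (\<epsilon> * tau s N \<epsilon> x i powr (- 1 / real m) * tau s N \<epsilon> x j powr (- 1 / real m)))"

definition Hmat ::
  "nat \<Rightarrow> nat \<Rightarrow> nat \<Rightarrow> real \<Rightarrow> (nat \<Rightarrow> 'b::real_normed_vector) \<Rightarrow> nat \<Rightarrow> nat \<Rightarrow> real" where
  "Hmat m s N \<epsilon> x i j = Kmat m s N \<epsilon> x i j / (\<Sum>k\<in>idx s N. Kmat m s N \<epsilon> x j k)"

definition Pmat ::
  "nat \<Rightarrow> nat \<Rightarrow> nat \<Rightarrow> real \<Rightarrow> (nat \<Rightarrow> 'b::real_normed_vector) \<Rightarrow> nat \<Rightarrow> nat \<Rightarrow> real" where
  "Pmat m s N \<epsilon> x i j = Hmat m s N \<epsilon> x i j / (\<Sum>k\<in>idx s N. Hmat m s N \<epsilon> x i k)"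

definition Pmat_apply ::
  "nat \<Rightarrow> nat \<Rightarrow> nat \<Rightarrow> real \<Rightarrow> (nat \<Rightarrow> 'b::real_normed_vector) \<Rightarrow> (nat \<Rightarrow> complex) \<Rightarrow> nat \<Rightarrow> complex"
  where
  "Pmat_apply m s N \<epsilon> x v i = (\<Sum>j\<in>idx s N. of_real (Pmat m s N \<epsilon> x i j) * v j)"


section \<open>The averaging operator\<close>

definition tau_bar ::
  "'a measure \<Rightarrow> (real \<Rightarrow> 'a \<Rightarrow> 'a) \<Rightarrow> real \<Rightarrow> ('a \<Rightarrow> 'b::real_normed_vector) \<Rightarrow> real \<Rightarrow> 'a \<Rightarrow> real" where
  "tau_bar \<mu> \<Phi> T F \<epsilon> a =
     lim (\<lambda>s. (\<integral>b. gauss s \<epsilon> (delay_map \<Phi> T F a) (delay_map \<Phi> T F b) \<partial>\<mu>) /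
              (\<integral>b. (\<integral>c. gauss s \<epsilon> (delay_map \<Phi> T F b) (delay_map \<Phi> T F c) \<partial>\<mu>) \<partial>\<mu>))"

definition k_inf ::
  "nat \<Rightarrow> 'a measure \<Rightarrow> (real \<Rightarrow> 'a \<Rightarrow> 'a) \<Rightarrow> real \<Rightarrow> ('a \<Rightarrow> 'b::real_normed_vector) \<Rightarrow> real
    \<Rightarrow> 'a \<Rightarrow> 'a \<Rightarrow> real" where
  "k_inf m \<mu> \<Phi> T F \<epsilon> a b =
     lim (\<lambda>s. exp (- (avg_norm s (\<lambda>k. delay_map \<Phi> T F a k - delay_map \<Phi> T F b k))\<^sup>2 /
        (\<epsilon> * tau_bar \<mu> \<Phi> T F \<epsilon> a powr (- 1 / real m) * tau_bar \<mu> \<Phi> T F \<epsilon> b powr (- 1 / real m))))"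

definition G_op ::
  "nat \<Rightarrow> 'a measure \<Rightarrow> (real \<Rightarrow> 'a \<Rightarrow> 'a) \<Rightarrow> real \<Rightarrow> ('a \<Rightarrow> 'b::real_normed_vector) \<Rightarrow> real
    \<Rightarrow> ('a \<Rightarrow> complex) \<Rightarrow> 'a \<Rightarrow> complex" where
  "G_op m \<mu> \<Phi> T F \<epsilon> f a =
     of_real (\<epsilon> powr (- real m / 2)) * (\<integral>b. of_real (k_inf m \<mu> \<Phi> T F \<epsilon> a b) * f b \<partial>\<mu>)"

definition H_op ::
  "nat \<Rightarrow> 'a measure \<Rightarrow> (real \<Rightarrow> 'a \<Rightarrow> 'a) \<Rightarrow> real \<Rightarrow> ('a \<Rightarrow> 'b::real_normed_vector) \<Rightarrow> real
    \<Rightarrow> ('a \<Rightarrow> complex) \<Rightarrow> 'a \<Rightarrow> complex" where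
  "H_op m \<mu> \<Phi> T F \<epsilon> f =
     G_op m \<mu> \<Phi> T F \<epsilon> (\<lambda>a. f a / G_op m \<mu> \<Phi> T F \<epsilon> (\<lambda>_. 1) a)"

definition P_op ::
  "nat \<Rightarrow> 'a measure \<Rightarrow> (real \<Rightarrow> 'a \<Rightarrow> 'a) \<Rightarrow> real \<Rightarrow> ('a \<Rightarrow> 'b::real_normed_vector) \<Rightarrow> real
    \<Rightarrow> ('a \<Rightarrow> complex) \<Rightarrow> 'a \<Rightarrow> complex" where
  "P_op m \<mu> \<Phi> T F \<epsilon> f a = H_op m \<mu> \<Phi> T F \<epsilon> f a / H_op m \<mu> \<Phi> T F \<epsilon> (\<lambda>_. 1) a"


section \<open>Observational noise\<close>

definition iid_noise :: "'w measure \<Rightarrow> (nat \<Rightarrow> 'w \<Rightarrow> 'b::euclidean_space) \<Rightarrow> real \<Rightarrow> bool" where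
  "iid_noise W \<xi> R \<longleftrightarrow>
     prob_space.indep_vars W (\<lambda>_. borel) \<xi> UNIV \<and>
     (\<forall>i. distr W borel (\<xi> i) = distr W borel (\<xi> 0)) \<and>
     (\<forall>i. integrable W (\<xi> i) \<and> (\<integral>\<omega>. \<xi> i \<omega> \<partial>W) = 0) \<and>
     (\<forall>i. integrable W (\<lambda>\<omega>. (norm (\<xi> i \<omega>))\<^sup>2) \<and> (\<integral>\<omega>. (norm (\<xi> i \<omega>))\<^sup>2 \<partial>W) = R\<^sup>2) \<and>
     (\<forall>i. integrable W (\<lambda>\<omega>. norm (\<xi> i \<omega>) ^ 3)) \<and>
     (\<forall>i. integrable W (\<lambda>\<omega>. norm (\<xi> i \<omega>) ^ 4))"

definition noisy_obs ::
  "(real \<Rightarrow> 'a \<Rightarrow> 'a) \<Rightarrow> real \<Rightarrow> ('a \<Rightarrow> 'b::real_normed_vector) \<Rightarrow> (nat \<Rightarrow> 'w \<Rightarrow> 'b) \<Rightarrow> 'a \<Rightarrow> 'w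
    \<Rightarrow> nat \<Rightarrow> 'b" where
  "noisy_obs \<Phi> T F \<xi> a0 \<omega> i = F (\<Phi> (real i * T) a0) + \<xi> i \<omega>"

end

theory Submission
  imports Defs "HOL-Real_Asymp.Real_Asymp"
begin

text \<open>
  The noise adds \<open>2 R\<^sup>2\<close> to all off-diagonal squared distances of delay vectors, up to errors that vanish in the
  limit. So it multiplies the kernel by a constant, which cancels in the Markov normalisation, and the
  diagonal does not count among \<open>N(s) - s + 1\<close> samples. The limiting squared distance is invariant under the
  flow, so the density estimates tend to \<open>1\<close>. Hence the error tends to \<open>0\<close> for every \<open>\<epsilon>\<close>, and \<open>C = 0\<close> will do.

  The noise-free limits rest on uniform convergence of time averages of continuous functions. The eigenfunctions
  form a map \<open>Z\<close> to the torus. It is injective off a null set, as the coordinates of \<open>F\<close> are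
  \<open>L\<^sup>2\<close>-limits of trigonometric polynomials in \<open>Z\<close>; it is smooth between manifolds of equal dimension, so it maps null
  sets to null sets; and it sends \<open>\<mu>\<close> to a rotation invariant measure. Therefore almost every fibre of \<open>Z\<close> is a
  single point. It follows that every continuous function lies below a trigonometric polynomial in \<open>Z\<close> with almost
  the same integral, and for trigonometric polynomials the convergence is that of geometric sums.

  For the noise, with \<open>N(s)\<close> about \<open>s\<^bsup>6/5\<^esup>\<close>, sums over windows of length \<open>s\<close> obey the law of large numbers uniformly. The
  scalar products of two noise windows are only controlled in mean square over one of the windows, which is a
  matter of empirical autocovariances and suffices, since the matrix entries enter through row averages.
  For \<open>f\<close> in \<open>L\<^sup>2\<close> the maximal ergodic inequality reduces the orbit averages to those of trigonometric polynomials.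
\<close>

section \<open>Orthogonal sums and the maximal ergodic inequality\<close>

text \<open>Two obstacles shape the argument. The eigenfunctions are only known to span
  \<open>L2\<close>, so \<open>Z\<close> may identify points: Stone-Weierstrass gives uniform
  approximation on the torus but not for functions on M, and \<open>F\<close> is reached in mean
  square only. Uniform statements on M are recovered by one-sided majorants and Cauchy-Schwarz.
  Moreover pairs of orbits do not form an ergodic system, as \<open>e k a * cnj (e k b)\<close> is
  invariant; so the limiting distance depends on the pair, and its existence comes from twisted
  averages. With four moments of the noise, Chebyshev bounds do not sum over all pairs of windows.
  The mean square bound is instead an inequality for a quadratic form, valid for every coefficient
  vector at once, so uniformity over the rows costs nothing more. Sums of n noise terms are bounded
  by a multiple of n^(4/5). This is o(s) for n up to N(s) if N(s) grows with an exponent below 5/4,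
  while summability of 1/N(s) asks for an exponent above 1; 6/5 lies between.\<close>

lemma AE_summable:
  fixes g :: "nat \<Rightarrow> 'w \<Rightarrow> real"
  assumes int: "\<And>k. integrable M (g k)" and nn: "\<And>k \<omega>. g k \<omega> \<ge> 0"
    and sm: "summable (\<lambda>k. \<integral>\<omega>. g k \<omega> \<partial>M)"
  shows "AE \<omega> in M. summable (\<lambda>k. g k \<omega>)"
proof -
  have [measurable]: "\<And>k. g k \<in> borel_measurable M" using int by auto
  have "(\<integral>\<^sup>+\<omega>. (\<Sum>k. ennreal (g k \<omega>)) \<partial>M) = (\<Sum>k. \<integral>\<^sup>+\<omega>. ennreal (g k \<omega>) \<partial>M)"
    by (rule nn_integral_suminf) auto
  also have "\<dots> = (\<Sum>k. ennreal (\<integral>\<omega>. g k \<omega> \<partial>M))"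
    using int nn by (simp add: nn_integral_eq_integral)
  also have "\<dots> \<noteq> \<infinity>"
    using sm nn by (simp add: suminf_ennreal_eq summable_sums_iff integral_nonneg_AE
      ennreal_suminf_neq_top)
  finally have "AE \<omega> in M. (\<Sum>k. ennreal (g k \<omega>)) \<noteq> \<infinity>"
    by (intro nn_integral_PInf_AE) auto
  then show ?thesis
    by eventually_elim (use nn in \<open>auto intro: summable_suminf_not_top\<close>)
qed

lemma integral_square_sum_orthogonal:
  fixes y :: "nat \<Rightarrow> 'w \<Rightarrow> real"
  assumes int: "\<And>i j. integrable M (\<lambda>\<omega>. y i \<omega> * y j \<omega>)"
    and orth: "\<And>i j. i \<noteq> j \<Longrightarrow> (\<integral>\<omega>. y i \<omega> * y j \<omega> \<partial>M) = 0"
    and V: "\<And>i. (\<integral>\<omega>. y i \<omega> * y i \<omega> \<partial>M) \<le> V"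
    and "finite A"
  shows "integrable M (\<lambda>\<omega>. (\<Sum>i\<in>A. y i \<omega>)\<^sup>2)"
    and "(\<integral>\<omega>. (\<Sum>i\<in>A. y i \<omega>)\<^sup>2 \<partial>M) \<le> V * card A"
proof -
  have eq: "(\<Sum>i\<in>A. y i \<omega>)\<^sup>2 = (\<Sum>i\<in>A. \<Sum>j\<in>A. y i \<omega> * y j \<omega>)" for \<omega>
    by (simp add: power2_eq_square sum_product)
  show "integrable M (\<lambda>\<omega>. (\<Sum>i\<in>A. y i \<omega>)\<^sup>2)"
    unfolding eq using int by (intro Bochner_Integration.integrable_sum)
  have "(\<integral>\<omega>. (\<Sum>i\<in>A. y i \<omega>)\<^sup>2 \<partial>M) = (\<Sum>i\<in>A. \<Sum>j\<in>A. \<integral>\<omega>. y i \<omega> * y j \<omega> \<partial>M)"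
    unfolding eq using int by (simp add: Bochner_Integration.integral_sum)
  also have "\<dots> = (\<Sum>i\<in>A. \<integral>\<omega>. y i \<omega> * y i \<omega> \<partial>M)"
  proof (rule sum.cong)
    fix i assume "i \<in> A"
    have "(\<Sum>j\<in>A. \<integral>\<omega>. y i \<omega> * y j \<omega> \<partial>M) = (\<Sum>j\<in>A. if j = i then \<integral>\<omega>. y i \<omega> * y i \<omega> \<partial>M else 0)"
      by (rule sum.cong) (auto simp: orth)
    then show "(\<Sum>j\<in>A. \<integral>\<omega>. y i \<omega> * y j \<omega> \<partial>M) = (\<integral>\<omega>. y i \<omega> * y i \<omega> \<partial>M)"
      using \<open>finite A\<close> \<open>i \<in> A\<close> by simp
  qed simp
  also have "\<dots> \<le> (\<Sum>i\<in>A. V)" by (rule sum_mono) (rule V)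
  finally show "(\<integral>\<omega>. (\<Sum>i\<in>A. y i \<omega>)\<^sup>2 \<partial>M) \<le> V * card A" by (simp add: mult.commute)
qed

lemma square_bracket: "\<exists>k r. n = k\<^sup>2 + r \<and> r \<le> 2 * k" for n :: nat
proof (induction n)
  case (Suc n)
  then obtain k r where kr: "n = k\<^sup>2 + r" "r \<le> 2 * k" by auto
  show ?case
  proof (cases "r = 2 * k")
    case True
    then have "Suc n = (Suc k)\<^sup>2 + 0" using kr by (simp add: power2_eq_square)
    then show ?thesis by blast
  next
    case False
    then have "Suc n = k\<^sup>2 + Suc r \<and> Suc r \<le> 2 * k" using kr by simp
    then show ?thesis by blast
  qed
qed auto

text \<open>Along the squares Chebyshev's bounds are summable, and the gaps between
  consecutive squares are short enough to be bounded by summing over all their points.\<close>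

lemma orthogonal_sum_growth:
  fixes y :: "nat \<Rightarrow> 'w \<Rightarrow> real"
  assumes int: "\<And>i j. integrable M (\<lambda>\<omega>. y i \<omega> * y j \<omega>)"
    and orth: "\<And>i j. i \<noteq> j \<Longrightarrow> (\<integral>\<omega>. y i \<omega> * y j \<omega> \<partial>M) = 0"
    and V: "\<And>i. (\<integral>\<omega>. y i \<omega> * y i \<omega> \<partial>M) \<le> V"
  shows "AE \<omega> in M. \<exists>C. \<forall>n. \<bar>\<Sum>i<n. y i \<omega>\<bar> \<le> C * (real n + 1) powr (4/5)"
proof -
  note sq = integral_square_sum_orthogonal[of M y V, OF int orth V]
  have V0: "V \<ge> 0"
  proof -
    have "0 \<le> (\<integral>\<omega>. y 0 \<omega> * y 0 \<omega> \<partial>M)" by (rule integral_nonneg_AE) auto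
    from order_trans[OF this V] show ?thesis .
  qed
  \<comment> \<open>The weight is the square of (k^2)^(4/5), with k + 1 for k. The prefix
    contributes order k^2 to the expectation of the numerator, and so do the 2k + 1 blocks of length
    at most 2k; hence the expectation of \<open>g k\<close> is of order k^(-6/5).\<close>
  define g where "g k \<omega> = ((\<Sum>i<k\<^sup>2. y i \<omega>)\<^sup>2 + (\<Sum>r<2*k+1. (\<Sum>i\<in>{k\<^sup>2..<k\<^sup>2+r}. y i \<omega>)\<^sup>2))
      / (real k + 1) powr (16/5)" for k \<omega>
  have gint: "integrable M (g k)" for k
    unfolding g_def by (intro integrable_divide Bochner_Integration.integrable_add
        Bochner_Integration.integrable_sum sq(1)) auto
  have gnn: "g k \<omega> \<ge> 0" for k \<omega>
    unfolding g_def by (intro divide_nonneg_nonneg add_nonneg_nonneg sum_nonneg) auto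
  have gle: "(\<integral>\<omega>. g k \<omega> \<partial>M) \<le> 5 * V * real (Suc k) powr (- (6/5))" for k
  proof -
    have "(\<integral>\<omega>. g k \<omega> \<partial>M) = ((\<integral>\<omega>. (\<Sum>i<k\<^sup>2. y i \<omega>)\<^sup>2 \<partial>M)
        + (\<Sum>r<2*k+1. (\<integral>\<omega>. (\<Sum>i\<in>{k\<^sup>2..<k\<^sup>2+r}. y i \<omega>)\<^sup>2 \<partial>M))) / (real k + 1) powr (16/5)"
      unfolding g_def
      by (subst integral_divide_zero, subst Bochner_Integration.integral_add)
        (auto intro!: sq(1) Bochner_Integration.integrable_sum simp: Bochner_Integration.integral_sum sq(1))
    also have "\<dots> \<le> (V * real (k\<^sup>2) + (\<Sum>r<2*k+1. V * real (2*k+1))) / (real k + 1) powr (16/5)"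
    proof (intro divide_right_mono add_mono sum_mono)
      show "(\<integral>\<omega>. (\<Sum>i<k\<^sup>2. y i \<omega>)\<^sup>2 \<partial>M) \<le> V * real (k\<^sup>2)"
        using sq(2)[of "{..<k\<^sup>2}"] by simp
      fix r assume "r \<in> {..<2*k+1}"
      then have "V * real r \<le> V * real (2*k+1)" using V0 by (intro mult_left_mono) auto
      then show "(\<integral>\<omega>. (\<Sum>i\<in>{k\<^sup>2..<k\<^sup>2+r}. y i \<omega>)\<^sup>2 \<partial>M) \<le> V * real (2*k+1)"
        using sq(2)[of "{k\<^sup>2..<k\<^sup>2+r}"] by simp
    qed simp
    also have "\<dots> \<le> 5 * V * (real k + 1)\<^sup>2 / (real k + 1) powr (16/5)"
    proof (intro divide_right_mono)
      have "V * real (k\<^sup>2) + (\<Sum>r<2*k+1. V * real (2*k+1)) = V * ((real k)\<^sup>2 + (2 * real k + 1)\<^sup>2)"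
        by (simp add: power2_eq_square algebra_simps)
      also have "\<dots> \<le> V * (5 * (real k + 1)\<^sup>2)"
        by (intro mult_left_mono V0) (simp add: power2_eq_square algebra_simps)
      finally show "V * real (k\<^sup>2) + (\<Sum>r<2*k+1. V * real (2*k+1)) \<le> 5 * V * (real k + 1)\<^sup>2"
        by simp
    qed simp
    also have "\<dots> = 5 * V * ((real k + 1) powr 2 / (real k + 1) powr (16/5))" by (simp add: powr_numeral)
    also have "\<dots> = 5 * V * real (Suc k) powr (- (6/5))"
      by (subst powr_diff[symmetric]) (simp add: add.commute)
    finally show ?thesis .
  qed
  have "summable (\<lambda>k. real (Suc k) powr (- (6/5)))"
    using summable_real_powr_iff[of "-(6/5)"] summable_Suc_iff[of "\<lambda>k. real k powr (- (6/5))"] by simp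
  from summable_mult[OF this, of "5 * V"] have sm: "summable (\<lambda>k. \<integral>\<omega>. g k \<omega> \<partial>M)"
  proof (rule summable_comparison_test'[where N = 0])
    show "norm (\<integral>\<omega>. g k \<omega> \<partial>M) \<le> 5 * V * real (Suc k) powr (- (6/5))" for k
      using gle[of k] integral_nonneg_AE[where f = "g k" and M = M] gnn by simp
  qed
  show ?thesis using AE_summable[OF gint gnn sm]
  proof eventually_elim
    case (elim \<omega>)
    define G where "G = (\<Sum>k. g k \<omega>)"
    have G: "g k \<omega> \<le> G" for k
      unfolding G_def using sum_le_suminf[OF elim, of "{k}"] gnn by simp
    have G0: "G \<ge> 0" using G[of 0] gnn[of 0 \<omega>] by simp
    show ?case
    proof (intro exI allI)
      fix n :: nat
      obtain k r where n: "n = k\<^sup>2 + r" and r: "r \<le> 2 * k" using square_bracket by blast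
      let ?A = "\<Sum>i<k\<^sup>2. y i \<omega>" and ?B = "\<Sum>i\<in>{k\<^sup>2..<k\<^sup>2+r}. y i \<omega>"
      have S: "(\<Sum>i<n. y i \<omega>) = ?A + ?B"
        unfolding n using sum.atLeastLessThan_concat[of 0 "k\<^sup>2" "k\<^sup>2+r" "\<lambda>i. y i \<omega>"]
        by (simp add: atLeast0LessThan)
      have l1: "(?A + ?B)\<^sup>2 \<le> 2 * (?A\<^sup>2 + ?B\<^sup>2)"
        using zero_le_power2[of "?A - ?B"] by (simp add: power2_eq_square algebra_simps)
      have l2: "?A\<^sup>2 + ?B\<^sup>2 \<le> G * (real k + 1) powr (16/5)"
      proof -
        have "?B\<^sup>2 \<le> (\<Sum>r<2*k+1. (\<Sum>i\<in>{k\<^sup>2..<k\<^sup>2+r}. y i \<omega>)\<^sup>2)"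
          using r by (intro member_le_sum) auto
        then have "?A\<^sup>2 + ?B\<^sup>2 \<le> g k \<omega> * (real k + 1) powr (16/5)"
          unfolding g_def by simp
        also have "\<dots> \<le> G * (real k + 1) powr (16/5)"
          by (intro mult_right_mono G) simp
        finally show ?thesis .
      qed
      have pk: "(real k + 1) powr (16/5) \<le> 4 * (real n + 1) powr (8/5)"
      proof -
        have "(real k + 1)\<^sup>2 \<le> 2 * (real n + 1)"
        proof -
          have "(real k + 1)\<^sup>2 \<le> 2 * ((real k)\<^sup>2 + 1)"
            using zero_le_power2[of "real k - 1"] by (simp add: power2_eq_square algebra_simps)
          also have "\<dots> \<le> 2 * (real n + 1)" by (simp add: n)
          finally show ?thesis .
        qed
        then have "((real k + 1)\<^sup>2) powr (8/5) \<le> (2 * (real n + 1)) powr (8/5)"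
          by (intro powr_mono2) auto
        also have "\<dots> = 2 powr (8/5) * (real n + 1) powr (8/5)" by (rule powr_mult)
        also have "\<dots> \<le> 2 powr 2 * (real n + 1) powr (8/5)"
          by (intro mult_right_mono powr_mono) auto
        finally have "((real k + 1)\<^sup>2) powr (8/5) \<le> 2 powr 2 * (real n + 1) powr (8/5)" .
        moreover have "((real k + 1)\<^sup>2) powr (8/5) = ((real k + 1) powr 2) powr (8/5)"
          by (subst powr_numeral) auto
        ultimately show ?thesis
          by (simp only: powr_powr) (simp add: powr_numeral)
      qed
      have "(\<Sum>i<n. y i \<omega>)\<^sup>2 \<le> 2 * (G * (4 * (real n + 1) powr (8/5)))"
        unfolding S using order_trans[OF l2 mult_left_mono[OF pk G0]]
        by (intro order_trans[OF l1]) simp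
      then have "\<bar>\<Sum>i<n. y i \<omega>\<bar> \<le> sqrt (2 * (G * (4 * (real n + 1) powr (8/5))))"
        by (metis real_le_rsqrt power2_abs)
      also have "\<dots> = sqrt (8 * G) * (real n + 1) powr (4/5)"
      proof -
        have "sqrt ((real n + 1) powr (8/5)) = (real n + 1) powr (4/5)"
          by (rule real_sqrt_unique) (auto simp: power2_eq_square powr_add[symmetric])
        then show ?thesis by (simp add: real_sqrt_mult)
      qed
      finally show "\<bar>\<Sum>i<n. y i \<omega>\<bar> \<le> sqrt (8 * G) * (real n + 1) powr (4/5)" .
    qed
  qed
qed

section \<open>Lagged products of independent variables\<close>

text \<open>Independence of the singleton \<open>{t}\<close> from the set \<open>{a, b, c}\<close>.
  The other three indices may coincide, which covers every pattern in which some index occurs just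
  once.\<close>

lemma (in prob_space) indep_mean_zero_product_eq_0:
  fixes x :: "nat \<Rightarrow> 'a \<Rightarrow> real"
  assumes ind: "indep_vars (\<lambda>_. borel) x UNIV"
    and int1: "integrable M (x t)" and zero: "expectation (x t) = 0"
    and int3: "integrable M (\<lambda>\<omega>. x a \<omega> * x b \<omega> * x c \<omega>)"
    and ne: "t \<noteq> a" "t \<noteq> b" "t \<noteq> c"
  shows "expectation (\<lambda>\<omega>. x t \<omega> * (x a \<omega> * x b \<omega> * x c \<omega>)) = 0"
proof -
  have "indep_var (Pi\<^sub>M {t} (\<lambda>_. borel)) (\<lambda>\<omega>. restrict (\<lambda>i. x i \<omega>) {t})
      (Pi\<^sub>M {a, b, c} (\<lambda>_. borel)) (\<lambda>\<omega>. restrict (\<lambda>i. x i \<omega>) {a, b, c})"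
    using ne by (intro indep_var_restrict[OF ind]) auto
  then have "indep_var borel ((\<lambda>f. f t) \<circ> (\<lambda>\<omega>. restrict (\<lambda>i. x i \<omega>) {t}))
      borel ((\<lambda>f. f a * f b * f c) \<circ> (\<lambda>\<omega>. restrict (\<lambda>i. x i \<omega>) {a, b, c}))"
    by (rule indep_var_compose) measurable
  then have "indep_var borel (x t) borel (\<lambda>\<omega>. x a \<omega> * x b \<omega> * x c \<omega>)"
    by (simp add: comp_def)
  from indep_var_lebesgue_integral[OF this int1 int3] show ?thesis
    using zero by simp
qed

lemma abs_mult3_le: "\<bar>a * b * c\<bar> \<le> \<bar>a\<bar> ^ 3 + \<bar>b\<bar> ^ 3 + \<bar>c\<bar> ^ 3" for a b c :: real
proof -
  define m where "m = max \<bar>a\<bar> (max \<bar>b\<bar> \<bar>c\<bar>)"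
  have "\<bar>a * b * c\<bar> \<le> m * m * m"
    unfolding abs_mult by (intro mult_mono) (auto simp: m_def)
  also have "\<dots> = m ^ 3" by (simp add: power3_eq_cube)
  also have "\<dots> \<le> \<bar>a\<bar> ^ 3 + \<bar>b\<bar> ^ 3 + \<bar>c\<bar> ^ 3"
    unfolding m_def max_def by auto
  finally show ?thesis .
qed

lemma abs_mult_le_squares: "\<bar>a * b\<bar> \<le> a\<^sup>2 + b\<^sup>2" for a b :: real
proof -
  have "0 \<le> (\<bar>a\<bar> - \<bar>b\<bar>)\<^sup>2" "0 \<le> \<bar>a\<bar> * \<bar>b\<bar>" by simp_all
  then show ?thesis unfolding power2_diff abs_mult power2_abs by linarith
qed

lemma abs_mult4_le: "\<bar>a * b * (c * d)\<bar> \<le> a ^ 4 + b ^ 4 + c ^ 4 + d ^ 4" for a b c d :: real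
proof -
  have fourth: "(u * v)\<^sup>2 \<le> (u ^ 4 + v ^ 4) / 2" for u v :: real
    using zero_le_power2[of "u\<^sup>2 - v\<^sup>2"] by (simp add: power2_eq_square algebra_simps power4_eq_xxxx)
  show ?thesis using abs_mult_le_squares[of "a * b" "c * d"] fourth[of a b] fourth[of c d]
    zero_le_power[of "a\<^sup>2" 2] zero_le_power[of "b\<^sup>2" 2] zero_le_power[of "c\<^sup>2" 2] zero_le_power[of "d\<^sup>2" 2]
    by (simp add: power_mult[symmetric])
qed

text \<open>For \<open>p \<noteq> q\<close> the products at different \<open>l\<close> are
  uncorrelated though not independent, so the second moment grows linearly in \<open>n\<close> and
  not quadratically. The constant 4 comes from bounding a product of four factors by the sum of
  their fourth powers; third moments make the triple products integrable, as factoring the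
  expectation requires.\<close>

lemma (in prob_space) lagged_product_sum_bound:
  fixes x :: "nat \<Rightarrow> 'a \<Rightarrow> real"
  assumes ind: "indep_vars (\<lambda>_. borel) x UNIV"
    and int1: "\<And>i. integrable M (x i)" and zero: "\<And>i. expectation (x i) = 0"
    and int3: "\<And>i. integrable M (\<lambda>\<omega>. \<bar>x i \<omega>\<bar> ^ 3)"
    and int4: "\<And>i. integrable M (\<lambda>\<omega>. x i \<omega> ^ 4)" and V: "\<And>i. expectation (\<lambda>\<omega>. x i \<omega> ^ 4) \<le> V"
    and pq: "p \<noteq> q"
  shows "integrable M (\<lambda>\<omega>. (\<Sum>l<n. x (l + p) \<omega> * x (l + q) \<omega>)\<^sup>2)"
    and "expectation (\<lambda>\<omega>. (\<Sum>l<n. x (l + p) \<omega> * x (l + q) \<omega>)\<^sup>2) \<le> 4 * V * real n"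
proof -
  have [measurable]: "x i \<in> borel_measurable M" for i using int1 by auto
  have i4: "integrable M (\<lambda>\<omega>. x a \<omega> * x b \<omega> * (x c \<omega> * x d \<omega>))" for a b c d
    by (rule Bochner_Integration.integrable_bound[of _ "\<lambda>\<omega>. x a \<omega> ^ 4 + x b \<omega> ^ 4 + x c \<omega> ^ 4 + x d \<omega> ^ 4"])
      (use abs_mult4_le in \<open>auto intro!: Bochner_Integration.integrable_add int4 AE_I2 intro: order_trans[OF _ abs_ge_self]\<close>)
  have i3: "integrable M (\<lambda>\<omega>. x a \<omega> * x b \<omega> * x c \<omega>)" for a b c
    by (rule Bochner_Integration.integrable_bound[of _ "\<lambda>\<omega>. \<bar>x a \<omega>\<bar> ^ 3 + \<bar>x b \<omega>\<bar> ^ 3 + \<bar>x c \<omega>\<bar> ^ 3"])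
      (use abs_mult3_le in \<open>auto intro!: Bochner_Integration.integrable_add int3 AE_I2 intro: order_trans[OF _ abs_ge_self]\<close>)
  have v4: "expectation (\<lambda>\<omega>. x a \<omega> * x b \<omega> * (x c \<omega> * x d \<omega>)) \<le> 4 * V" for a b c d
  proof -
    have "expectation (\<lambda>\<omega>. x a \<omega> * x b \<omega> * (x c \<omega> * x d \<omega>))
        \<le> expectation (\<lambda>\<omega>. x a \<omega> ^ 4 + x b \<omega> ^ 4 + x c \<omega> ^ 4 + x d \<omega> ^ 4)"
      by (rule integral_mono[OF i4]) (auto intro!: Bochner_Integration.integrable_add int4 abs_le_D1[OF abs_mult4_le])
    also have "\<dots> \<le> 4 * V" using V[of a] V[of b] V[of c] V[of d] int4 by simp
    finally show ?thesis .
  qed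
  have single: "expectation (\<lambda>\<omega>. x t \<omega> * (x a \<omega> * x b \<omega> * x c \<omega>)) = 0"
    if "t \<noteq> a" "t \<noteq> b" "t \<noteq> c" for t a b c
    using that by (intro indep_mean_zero_product_eq_0 ind int1 zero i3)
  \<comment> \<open>of the four indices, the smallest one occurs only once\<close>
  have orth: "expectation (\<lambda>\<omega>. (x (i + p) \<omega> * x (i + q) \<omega>) * (x (j + p) \<omega> * x (j + q) \<omega>)) = 0"
    if ij: "i \<noteq> j" for i j
  proof -
    consider "i < j" "p < q" | "i < j" "q < p" | "j < i" "p < q" | "j < i" "q < p"
      using ij pq by (meson linorder_neqE_nat)
    then show ?thesis
    proof cases
      case 1
      then show ?thesis using single[of "i+p" "i+q" "j+p" "j+q"] by (simp add: mult_ac)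
    next
      case 2
      then show ?thesis using single[of "i+q" "i+p" "j+p" "j+q"] by (simp add: mult_ac)
    next
      case 3
      then show ?thesis using single[of "j+p" "i+q" "i+p" "j+q"] by (simp add: mult_ac)
    next
      case 4
      then show ?thesis using single[of "j+q" "i+q" "j+p" "i+p"] by (simp add: mult_ac)
    qed
  qed
  show "integrable M (\<lambda>\<omega>. (\<Sum>l<n. x (l + p) \<omega> * x (l + q) \<omega>)\<^sup>2)"
    and "expectation (\<lambda>\<omega>. (\<Sum>l<n. x (l + p) \<omega> * x (l + q) \<omega>)\<^sup>2) \<le> 4 * V * real n"
    using integral_square_sum_orthogonal[of M "\<lambda>l \<omega>. x (l + p) \<omega> * x (l + q) \<omega>" "4 * V" "{..<n}", OF i4 orth v4]
    by auto
qed

section \<open>The maximal ergodic inequality\<close>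

text \<open>Garsia's argument. The recursion for \<open>m n\<close> computes the maximum of the
  partial sums of \<open>g\<close> along the orbit over all lengths up to \<open>n\<close>, the
  empty sum included. Where \<open>m (Suc n)\<close> is positive it equals \<open>g\<close> plus
  \<open>m n\<close> at the image point, and elsewhere it is 0; so
  \<open>m (Suc n) \<omega> - m (Suc n) (T \<omega>)\<close> is at most \<open>g\<close> times the
  indicator, and its integral is 0 by invariance.\<close>

lemma (in finite_measure) maximal_ergodic:
  fixes g :: "'a \<Rightarrow> real"
  assumes T [measurable]: "T \<in> measurable M M" and inv: "distr M M T = M"
    and g: "integrable M g"
  defines "m \<equiv> rec_nat (\<lambda>\<omega>. 0) (\<lambda>_ u \<omega>. max 0 (g \<omega> + u (T \<omega>)))"
  shows "integrable M (m n)" "\<omega> \<in> space M \<Longrightarrow> k \<le> n \<Longrightarrow> (\<Sum>j<k. g ((T ^^ j) \<omega>)) \<le> m n \<omega>"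
    "m n \<omega> \<le> m (Suc n) \<omega>" "(\<integral>\<omega>. g \<omega> * indicator {\<omega>\<in>space M. m (Suc n) \<omega> > 0} \<omega> \<partial>M) \<ge> 0"
proof -
  have m0: "m 0 \<omega> = 0" and mS: "m (Suc n) \<omega> = max 0 (g \<omega> + m n (T \<omega>))" for n \<omega>
    by (simp_all add: m_def)
  have [measurable]: "g \<in> borel_measurable M" using g by auto
  have intT: "integrable M (\<lambda>\<omega>. u (T \<omega>))" and eqT: "(\<integral>\<omega>. u (T \<omega>) \<partial>M) = integral\<^sup>L M u"
    if "integrable M u" for u :: "'a \<Rightarrow> real"
  proof -
    have u: "u \<in> borel_measurable M" using that by auto
    show "integrable M (\<lambda>\<omega>. u (T \<omega>))"
      using that integrable_distr_eq[OF T u] by (simp add: inv)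
    show "(\<integral>\<omega>. u (T \<omega>) \<partial>M) = integral\<^sup>L M u"
      using integral_distr[OF T u] by (simp add: inv)
  qed
  have mint: "integrable M (m n)" for n
  proof (induction n)
    case 0
    then show ?case by (simp add: m_def)
  next
    case (Suc n)
    have "integrable M (\<lambda>\<omega>. max 0 (g \<omega> + m n (T \<omega>)))"
      using intT[OF Suc] g by (intro integrable_max Bochner_Integration.integrable_add) auto
    then show ?case by (simp add: m_def)
  qed
  then show "integrable M (m n)" .
  have [measurable]: "m n \<in> borel_measurable M" for n using mint by auto
  have nn: "m n \<omega> \<ge> 0" for n \<omega>
    by (cases n) (auto simp: m0 mS)
  show mono: "m n \<omega> \<le> m (Suc n) \<omega>" for n \<omega>
  proof (induction n arbitrary: \<omega>)
    case (Suc n)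
    have "max 0 (g \<omega> + m n (T \<omega>)) \<le> max 0 (g \<omega> + m (Suc n) (T \<omega>))"
      using Suc[of "T \<omega>"] by (intro max.mono) auto
    then show ?case by (simp only: mS[symmetric])
  qed (simp add: m0 mS)
  show "(\<Sum>j<k. g ((T ^^ j) \<omega>)) \<le> m n \<omega>" if "k \<le> n"
    using that
  proof (induction k arbitrary: n \<omega>)
    case 0
    then show ?case using nn by simp
  next
    case (Suc k)
    then obtain n' where n: "n = Suc n'" "k \<le> n'" by (cases n) auto
    have "(\<Sum>j<Suc k. g ((T ^^ j) \<omega>)) = g \<omega> + (\<Sum>j<k. g ((T ^^ j) (T \<omega>)))"
      by (subst sum.lessThan_Suc_shift) (simp add: funpow_swap1)
    also have "\<dots> \<le> g \<omega> + m n' (T \<omega>)" using Suc.IH[OF n(2), of "T \<omega>"] by simp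
    finally show ?case by (simp add: n mS)
  qed
  let ?I = "indicator {\<omega>\<in>space M. m (Suc n) \<omega> > 0} :: 'a \<Rightarrow> real"
  have gI: "integrable M (\<lambda>\<omega>. g \<omega> * ?I \<omega>)"
    by (intro integrable_mult_indicator[of _ M g, simplified mult.commute[of "indicator _ _"] real_scaleR_def] g) measurable
  have "0 = (\<integral>\<omega>. m (Suc n) \<omega> \<partial>M) - (\<integral>\<omega>. m (Suc n) (T \<omega>) \<partial>M)"
    using eqT[OF mint] by simp
  also have "\<dots> = (\<integral>\<omega>. m (Suc n) \<omega> - m (Suc n) (T \<omega>) \<partial>M)"
    using mint intT[OF mint] by simp
  also have "\<dots> \<le> (\<integral>\<omega>. g \<omega> * ?I \<omega> \<partial>M)"
  proof (rule integral_mono)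
    show "integrable M (\<lambda>\<omega>. m (Suc n) \<omega> - m (Suc n) (T \<omega>))" using mint intT[OF mint] by simp
    fix \<omega> assume "\<omega> \<in> space M"
    then show "m (Suc n) \<omega> - m (Suc n) (T \<omega>) \<le> g \<omega> * ?I \<omega>"
      using nn[of "Suc n" "T \<omega>"] mono[of n "T \<omega>"] mS[of n \<omega>] by (auto simp: indicator_def max_def split: if_splits)
  qed (rule gI)
  finally show "(\<integral>\<omega>. g \<omega> * ?I \<omega> \<partial>M) \<ge> 0" .
qed

text \<open>The maximal ergodic lemma for \<open>h - c\<close>: its integral over each
  \<open>A n\<close> is nonnegative, which bounds \<open>c\<close> times the probability of
  \<open>A n\<close> by the mean of \<open>h\<close>. The sets \<open>A n\<close> increase, and
  their union contains the event.\<close>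

lemma (in prob_space) maximal_inequality:
  fixes h :: "'a \<Rightarrow> real"
  assumes T [measurable]: "T \<in> measurable M M" and inv: "distr M M T = M"
    and h: "integrable M h" and nn: "\<And>\<omega>. h \<omega> \<ge> 0" and c: "c > 0"
  shows "{\<omega>\<in>space M. \<exists>n. (\<Sum>j<n. h ((T ^^ j) \<omega>)) > c * real n} \<in> events" (is "?E \<in> _")
    and "prob {\<omega>\<in>space M. \<exists>n. (\<Sum>j<n. h ((T ^^ j) \<omega>)) > c * real n} \<le> expectation h / c"
proof -
  define g where "g \<omega> = h \<omega> - c" for \<omega>
  have g: "integrable M g" unfolding g_def using h by simp
  define m where "m = rec_nat (\<lambda>\<omega>. 0) (\<lambda>_ u \<omega>. max 0 (g \<omega> + u (T \<omega>)))"
  note me = maximal_ergodic[OF T inv g, folded m_def]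
  have [measurable]: "h \<in> borel_measurable M" using h by auto
  have [measurable]: "m n \<in> borel_measurable M" for n using me(1) by auto
  have [measurable]: "(T ^^ j) \<in> measurable M M" for j
    by (induction j) auto
  show "?E \<in> events" by measurable
  define A where "A n = {\<omega>\<in>space M. m (Suc n) \<omega> > 0}" for n
  have [measurable]: "A n \<in> events" for n unfolding A_def by measurable
  have inc: "incseq A"
    unfolding A_def using me(3) by (intro incseq_SucI) (force intro: less_le_trans)
  have bound: "prob (A n) \<le> expectation h / c" for n
  proof -
    have ind: "integrable M (indicat_real (A n))"
      by (intro integrable_real_indicator) (auto simp: emeasure_eq_measure)
    have "0 \<le> (\<integral>\<omega>. g \<omega> * indicator (A n) \<omega> \<partial>M)" using me(4)[of n] by (simp add: A_def)
    also have "\<dots> \<le> (\<integral>\<omega>. h \<omega> - c * indicator (A n) \<omega> \<partial>M)"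
    proof (rule integral_mono)
      show "integrable M (\<lambda>\<omega>. g \<omega> * indicator (A n) \<omega>)"
        using integrable_mult_indicator[of "A n" M g] g by (simp add: mult.commute)
      show "integrable M (\<lambda>\<omega>. h \<omega> - c * indicator (A n) \<omega>)"
        using h ind by (intro Bochner_Integration.integrable_diff integrable_mult_right)
    qed (use nn in \<open>auto simp: g_def indicator_def\<close>)
    also have "\<dots> = expectation h - c * prob (A n)"
      using h ind by (subst Bochner_Integration.integral_diff) auto
    finally show ?thesis using c by (simp add: field_simps)
  qed
  have "?E \<subseteq> (\<Union>n. A n)"
  proof
    fix \<omega> assume "\<omega> \<in> ?E"
    then obtain n where n: "\<omega> \<in> space M" "(\<Sum>j<n. h ((T ^^ j) \<omega>)) > c * real n" by auto
    have "(\<Sum>j<n. g ((T ^^ j) \<omega>)) > 0" using n by (simp add: g_def sum_subtractf mult.commute)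
    then have "m (Suc n) \<omega> > 0" using me(2)[of \<omega> n "Suc n"] n by simp
    then show "\<omega> \<in> (\<Union>n. A n)" using n by (auto simp: A_def)
  qed
  then have "prob ?E \<le> prob (\<Union>n. A n)" by (intro finite_measure_mono) auto
  also have "\<dots> \<le> expectation h / c"
    by (rule LIMSEQ_le_const2[OF finite_Lim_measure_incseq[OF _ inc]]) (use bound in auto)
  finally show "prob ?E \<le> expectation h / c" .
qed

text \<open>Borel-Cantelli with means 4^(-k) against levels 2^(-k), leaving probabilities 2^(-k).
  The bound holds for all \<open>n\<close> at once, so the lengths of the averages may later be tied
  to \<open>s\<close> freely.\<close>

lemma (in prob_space) AE_eventually_averages_small:
  fixes h :: "nat \<Rightarrow> 'a \<Rightarrow> real"
  assumes T: "T \<in> measurable M M" and inv: "distr M M T = M"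
    and h: "\<And>k. integrable M (h k)" and nn: "\<And>k \<omega>. h k \<omega> \<ge> 0"
    and le: "\<And>k. expectation (h k) \<le> (1/4) ^ k"
  shows "AE \<omega> in M. \<forall>\<^sub>F k in sequentially. \<forall>n. (\<Sum>j<n. h k ((T ^^ j) \<omega>)) \<le> (1/2) ^ k * real n"
proof -
  define E where "E k = {\<omega>\<in>space M. \<exists>n. (\<Sum>j<n. h k ((T ^^ j) \<omega>)) > (1/2) ^ k * real n}" for k
  have "E k \<in> events" for k
    unfolding E_def by (rule maximal_inequality(1)[OF T inv h nn]) simp
  moreover have "prob (E k) \<le> (1/2) ^ k" for k
  proof -
    have "prob (E k) \<le> expectation (h k) / (1/2) ^ k"
      unfolding E_def by (rule maximal_inequality(2)[OF T inv h nn]) simp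
    also have "\<dots> \<le> (1/4) ^ k / (1/2) ^ k" by (intro divide_right_mono le) simp
    also have "\<dots> = (1/2) ^ k" by (simp flip: power_divide)
    finally show ?thesis .
  qed
  then have "summable (\<lambda>k. prob (E k))"
    by (intro summable_comparison_test'[OF summable_geometric[of "1/2 :: real"], where N = 0]) auto
  ultimately have "AE \<omega> in M. \<forall>\<^sub>F k in sequentially. \<omega> \<in> space M - E k"
    by (intro borel_cantelli_AE1) (auto simp: emeasure_eq_measure)
  then show ?thesis
  proof (rule AE_mp, intro AE_I2 impI)
    fix \<omega> assume "\<omega> \<in> space M" "\<forall>\<^sub>F k in sequentially. \<omega> \<in> space M - E k"
    then show "\<forall>\<^sub>F k in sequentially. \<forall>n. (\<Sum>j<n. h k ((T ^^ j) \<omega>)) \<le> (1/2) ^ k * real n"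
      by (auto elim!: eventually_mono simp: E_def not_less)
  qed
qed

section \<open>Eigenfunctions and trigonometric polynomials\<close>

definition torus :: "(complex ^ 'm) set" where
  "torus = {z. \<forall>i. norm (z $ i) = 1}"

definition torus_char :: "('m::finite \<Rightarrow> int) \<Rightarrow> complex ^ 'm \<Rightarrow> complex" where
  "torus_char k z = (\<Prod>i\<in>UNIV. z $ i powi k i)"

lemma norm_torus_char: "z \<in> torus \<Longrightarrow> norm (torus_char k z) = 1"
  by (simp add: torus_char_def torus_def prod_norm[symmetric] norm_power_int)

lemma torus_char_0: "torus_char (\<lambda>_. 0) z = 1"
  by (simp add: torus_char_def)

lemma torus_char_add: "z \<in> torus \<Longrightarrow> torus_char k z * torus_char l z = torus_char (\<lambda>i. k i + l i) z"
  unfolding torus_char_def prod.distrib[symmetric]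
proof (rule prod.cong)
  fix i assume "z \<in> torus"
  then have "z $ i \<noteq> 0" by (auto simp: torus_def dest: spec[of _ i])
  then show "z $ i powi k i * z $ i powi l i = z $ i powi (k i + l i)" by (simp add: power_int_add)
qed simp

lemma torus_char_mult: "torus_char k (\<chi> i. w $ i * z $ i) = torus_char k w * torus_char k z"
  by (simp add: torus_char_def power_int_mult_distrib prod.distrib)

lemma torus_char_exp:
  "torus_char k (\<chi> i. exp (\<i> * of_real (\<theta> i))) = exp (\<i> * of_real (\<Sum>i\<in>UNIV. of_int (k i) * \<theta> i))"
  by (simp add: torus_char_def exp_power_int exp_sum[symmetric] sum_distrib_left mult_ac)

text \<open>Only the values on the torus matter.\<close>

definition trig_poly_on_torus :: "(complex ^ 'm::finite \<Rightarrow> complex) \<Rightarrow> bool" where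
  "trig_poly_on_torus g \<longleftrightarrow>
    (\<exists>K c. finite K \<and> (\<forall>z\<in>torus. g z = (\<Sum>k\<in>K. c k * torus_char k z)))"

lemma trig_poly_cong: "trig_poly_on_torus g \<Longrightarrow> (\<And>z. z \<in> torus \<Longrightarrow> h z = g z) \<Longrightarrow> trig_poly_on_torus h"
  unfolding trig_poly_on_torus_def by auto

lemma trig_poly_cmult_char: "trig_poly_on_torus (\<lambda>z. c * torus_char k z)"
  unfolding trig_poly_on_torus_def by (intro exI[of _ "{k}"] exI[of _ "\<lambda>_. c"]) simp

lemma trig_poly_const: "trig_poly_on_torus (\<lambda>z. c)"
  using trig_poly_cmult_char[of c "\<lambda>_. 0"] by (simp add: torus_char_0)

lemma trig_poly_add:
  assumes "trig_poly_on_torus g" "trig_poly_on_torus h"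
  shows "trig_poly_on_torus (\<lambda>z. g z + h z)"
proof -
  obtain K c where K: "finite K" "\<forall>z\<in>torus. g z = (\<Sum>k\<in>K. c k * torus_char k z)"
    using assms(1) unfolding trig_poly_on_torus_def by blast
  obtain L d where L: "finite L" "\<forall>z\<in>torus. h z = (\<Sum>k\<in>L. d k * torus_char k z)"
    using assms(2) unfolding trig_poly_on_torus_def by blast
  have "(\<Sum>k\<in>K. c k * torus_char k z) = (\<Sum>k\<in>K\<union>L. (if k \<in> K then c k else 0) * torus_char k z)" for z
    by (rule sum.mono_neutral_cong_left) (use K L in auto)
  moreover have "(\<Sum>k\<in>L. d k * torus_char k z) = (\<Sum>k\<in>K\<union>L. (if k \<in> L then d k else 0) * torus_char k z)" for z
    by (rule sum.mono_neutral_cong_left) (use K L in auto)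
  ultimately show ?thesis
    unfolding trig_poly_on_torus_def
    by (intro exI[of _ "K \<union> L"] exI[of _ "\<lambda>k. (if k \<in> K then c k else 0) + (if k \<in> L then d k else 0)"])
      (use K L in \<open>simp add: distrib_right sum.distrib\<close>)
qed

lemma trig_poly_sum:
  "finite I \<Longrightarrow> (\<And>i. i \<in> I \<Longrightarrow> trig_poly_on_torus (g i)) \<Longrightarrow> trig_poly_on_torus (\<lambda>z. \<Sum>i\<in>I. g i z)"
  by (induction I rule: finite_induct) (auto intro: trig_poly_const trig_poly_add)

lemma trig_poly_mult:
  fixes g h :: "complex ^ 'm::finite \<Rightarrow> complex"
  assumes "trig_poly_on_torus g" "trig_poly_on_torus h"
  shows "trig_poly_on_torus (\<lambda>z. g z * h z)"
proof -
  obtain K c where K: "finite K" "\<forall>z\<in>torus. g z = (\<Sum>k\<in>K. c k * torus_char k z)"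
    using assms(1) unfolding trig_poly_on_torus_def by blast
  obtain L d where L: "finite L" "\<forall>z\<in>torus. h z = (\<Sum>k\<in>L. d k * torus_char k z)"
    using assms(2) unfolding trig_poly_on_torus_def by blast
  have "trig_poly_on_torus (\<lambda>z. \<Sum>k\<in>K. \<Sum>l\<in>L. (c k * d l) * torus_char (\<lambda>i. k i + l i) z)"
    using K L by (intro trig_poly_sum trig_poly_cmult_char)
  then show ?thesis
  proof (rule trig_poly_cong)
    fix z :: "complex ^ 'm" assume z: "z \<in> torus"
    show "g z * h z = (\<Sum>k\<in>K. \<Sum>l\<in>L. (c k * d l) * torus_char (\<lambda>i. k i + l i) z)"
      using K L z by (simp add: sum_product torus_char_add[symmetric] mult_ac)
  qed
qed

lemma torus_char_coordinate:
  "torus_char (\<lambda>j. if j = i then n else 0) z = z $ i powi n"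
proof -
  have "torus_char (\<lambda>j. if j = i then n else 0) z = (\<Prod>j\<in>UNIV. if j = i then z $ i powi n else 1)"
    unfolding torus_char_def by (rule prod.cong) auto
  then show ?thesis by simp
qed

text \<open>On the torus conjugation is inversion, so the conjugate of a coordinate is again a
  character, and real and imaginary parts of coordinates are combinations of two characters.\<close>

lemma trig_poly_linear:
  fixes f :: "complex ^ 'm::finite \<Rightarrow> real"
  assumes "bounded_linear f"
  shows "trig_poly_on_torus (\<lambda>z. of_real (f z))"
proof -
  interpret f: bounded_linear f by fact
  have "trig_poly_on_torus (\<lambda>z. of_real (z \<bullet> b))" if b: "b \<in> Basis" for b :: "complex ^ 'm"
  proof -
    obtain i u where b: "b = axis i u" "u \<in> {1, \<i>}"
      using b by (auto simp: Basis_vec_def Basis_complex_def)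
    let ?k = "\<lambda>j. if j = i then 1 else (0::int)" and ?l = "\<lambda>j. if j = i then - 1 else (0::int)"
    have inv: "cnj w = inverse w" if "norm w = 1" for w
    proof -
      have "w * cnj w = 1" using that by (simp add: complex_norm_square[symmetric])
      then show ?thesis by (metis inverse_unique)
    qed
    show ?thesis
    proof (cases "u = 1")
      case True
      have "trig_poly_on_torus (\<lambda>z. 1/2 * torus_char ?k z + 1/2 * torus_char ?l z)"
        by (intro trig_poly_add trig_poly_cmult_char)
      then show ?thesis
      proof (rule trig_poly_cong)
        fix z :: "complex ^ 'm" assume "z \<in> torus"
        then have "torus_char ?l z = cnj (z $ i)"
          by (simp add: torus_char_coordinate inv torus_def power_int_minus)
        then show "of_real (z \<bullet> b) = 1/2 * torus_char ?k z + 1/2 * torus_char ?l z"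
          by (simp add: b True inner_axis torus_char_coordinate complex_eq_iff)
      qed
    next
      case False
      then have u: "u = \<i>" using b by simp
      have "trig_poly_on_torus (\<lambda>z. (-\<i>/2) * torus_char ?k z + (\<i>/2) * torus_char ?l z)"
        by (intro trig_poly_add trig_poly_cmult_char)
      then show ?thesis
      proof (rule trig_poly_cong)
        fix z :: "complex ^ 'm" assume "z \<in> torus"
        then have "torus_char ?l z = cnj (z $ i)"
          by (simp add: torus_char_coordinate inv torus_def power_int_minus)
        then show "of_real (z \<bullet> b) = (-\<i>/2) * torus_char ?k z + (\<i>/2) * torus_char ?l z"
          by (simp add: b u inner_axis torus_char_coordinate complex_eq_iff)
      qed
    qed
  qed
  then have "trig_poly_on_torus (\<lambda>z. \<Sum>b\<in>Basis. of_real (f b) * of_real (z \<bullet> b))"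
    by (intro trig_poly_sum trig_poly_mult trig_poly_const) auto
  then show ?thesis
  proof (rule trig_poly_cong)
    fix z :: "complex ^ 'm"
    have "f z = f (\<Sum>b\<in>Basis. (z \<bullet> b) *\<^sub>R b)" by (simp add: euclidean_representation)
    also have "\<dots> = (\<Sum>b\<in>Basis. f b * (z \<bullet> b))" by (simp add: f.sum f.scaleR mult.commute)
    finally show "of_real (f z) = (\<Sum>b\<in>Basis. of_real (f b) * complex_of_real (z \<bullet> b))" by simp
  qed
qed

text \<open>Turns Stone-Weierstrass for real polynomials in the coordinates into approximation by
  characters.\<close>

lemma trig_poly_real_polynomial:
  "real_polynomial_function r \<Longrightarrow> trig_poly_on_torus (\<lambda>z. of_real (r z))"
  by (induction rule: real_polynomial_function.induct)
    (auto intro: trig_poly_linear trig_poly_const trig_poly_add trig_poly_mult)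

lemma averages_of_powers:
  fixes z :: complex
  assumes "norm z = 1" "z \<noteq> 1"
  shows "(\<lambda>n. (1 / real n) *\<^sub>R (\<Sum>j<n. z ^ j)) \<longlonglongrightarrow> 0"
proof (rule Lim_null_comparison)
  show "\<forall>\<^sub>F n in sequentially. norm ((1 / real n) *\<^sub>R (\<Sum>j<n. z ^ j)) \<le> (2 / norm (1 - z)) * (1 / real n)"
  proof (intro always_eventually allI)
    fix n
    have "norm (1 - z ^ n) \<le> 2"
      using norm_triangle_ineq4[of 1 "z ^ n"] assms by (simp add: norm_power)
    then have "norm (\<Sum>j<n. z ^ j) \<le> 2 / norm (1 - z)"
      using assms by (simp add: sum_gp_strict norm_divide divide_right_mono)
    then have "norm (\<Sum>j<n. z ^ j) / real n \<le> (2 / norm (1 - z)) / real n"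
      by (rule divide_right_mono) simp
    then show "norm ((1 / real n) *\<^sub>R (\<Sum>j<n. z ^ j)) \<le> (2 / norm (1 - z)) * (1 / real n)"
      by simp
  qed
  show "(\<lambda>n. (2 / norm (1 - z)) * (1 / real n)) \<longlonglongrightarrow> 0"
    by (intro tendsto_mult_right_zero lim_1_over_n)
qed

lemma convergent_averages_of_powers:
  fixes z :: complex
  assumes "norm z = 1"
  shows "convergent (\<lambda>n. (1 / real n) *\<^sub>R (\<Sum>j<n. z ^ j))"
proof (cases "z = 1")
  case True
  have "(\<lambda>n. (1 / real n) *\<^sub>R (\<Sum>j<n. z ^ j)) \<longlonglongrightarrow> 1"
    by (rule tendsto_eventually) (use True in \<open>auto intro!: eventually_sequentiallyI[of 1] simp: scaleR_conv_of_real\<close>)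
  then show ?thesis by (auto simp: convergent_def)
qed (use averages_of_powers[OF assms] in \<open>auto simp: convergent_def\<close>)

section \<open>Characters along the flow and their time averages\<close>

text \<open>The topological and measure-theoretic side of the setting. The atlas appears in the
  lemmas on the fibres of \<open>Z\<close>, as a parameter.\<close>

locale kronecker_system =
  fixes \<mu> :: "'a::{t2_space, second_countable_topology} measure"
    and \<Phi> :: "real \<Rightarrow> 'a \<Rightarrow> 'a" and T :: real
    and \<Omega> :: "'m::finite \<Rightarrow> real" and \<zeta> :: "'m \<Rightarrow> 'a \<Rightarrow> complex"
  assumes compact_space: "compact (UNIV :: 'a set)"
    and prob_mu: "prob_space \<mu>" and sets_mu: "sets \<mu> = sets borel"
    and flow_0: "\<Phi> 0 a = a" and flow_add: "\<Phi> (t + u) a = \<Phi> t (\<Phi> u a)"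
    and flow_continuous: "continuous_on UNIV (\<lambda>(t, a). \<Phi> t a)"
    and invariant: "invariant_under_flow \<mu> \<Phi>"
    and ergodic: "ergodic_map \<mu> (\<Phi> T)"
    and zeta_continuous: "continuous_on UNIV (\<zeta> i)"
    and norm_zeta: "norm (\<zeta> i a) = 1"
    and zeta_flow: "\<zeta> i (\<Phi> t a) = exp (\<i> * of_real (\<Omega> i * t)) * \<zeta> i a"
    and basis: "orthonormal_basis_L2 \<mu> (\<lambda>(k::'m \<Rightarrow> int) a. \<Prod>i\<in>UNIV. \<zeta> i a powi k i)"
begin

sublocale prob_space \<mu> by (rule prob_mu)

lemma space_mu: "space \<mu> = UNIV"
  using sets_mu sets_eq_imp_space_eq[of \<mu> borel] by simp

definition Z :: "'a \<Rightarrow> complex ^ 'm" where "Z a = (\<chi> i. \<zeta> i a)"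

definition e :: "('m \<Rightarrow> int) \<Rightarrow> 'a \<Rightarrow> complex" where "e k a = torus_char k (Z a)"

text \<open>The eigenvalue of \<open>e k\<close> under one time step
  \<open>\<Phi> T\<close>.\<close>

definition lam :: "('m \<Rightarrow> int) \<Rightarrow> complex" where
  "lam k = exp (\<i> * of_real ((\<Sum>i\<in>UNIV. of_int (k i) * \<Omega> i) * T))"

lemma Z_torus: "Z a \<in> torus"
  by (simp add: Z_def torus_def norm_zeta)

lemma norm_e: "norm (e k a) = 1"
  by (simp add: e_def norm_torus_char Z_torus)

lemma norm_lam: "norm (lam k) = 1"
  by (simp add: lam_def)

lemma lam_cnj: "lam k * cnj (lam k) = 1" "cnj (lam k) * lam k = 1"
  using norm_lam[of k] by (simp_all add: complex_norm_square[symmetric] mult.commute)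

lemma e_0: "e (\<lambda>_. 0) a = 1"
  by (simp add: e_def torus_char_0)

lemma e_flow: "e k (\<Phi> t a) = exp (\<i> * of_real ((\<Sum>i\<in>UNIV. of_int (k i) * \<Omega> i) * t)) * e k a"
proof -
  have "Z (\<Phi> t a) = (\<chi> i. (\<chi> i. exp (\<i> * of_real (\<Omega> i * t))) $ i * Z a $ i)"
    by (simp add: Z_def zeta_flow)
  then have "e k (\<Phi> t a) = torus_char k (\<chi> i. exp (\<i> * of_real (\<Omega> i * t))) * e k a"
    unfolding e_def by (simp only: torus_char_mult)
  then show ?thesis by (simp only: torus_char_exp sum_distrib_right mult.assoc)
qed

lemma e_orbit: "e k (\<Phi> (real j * T) a) = lam k ^ j * e k a"
  unfolding e_flow lam_def exp_of_nat_mult[symmetric] by (simp add: mult_ac)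

lemma e_orbit_back: "e k (\<Phi> (- (real j * T)) a) = cnj (lam k) ^ j * e k a"
proof -
  have "cnj (lam k) ^ j = exp (of_nat j * cnj (\<i> * of_real ((\<Sum>i\<in>UNIV. of_int (k i) * \<Omega> i) * T)))"
    unfolding lam_def exp_of_nat_mult exp_cnj[symmetric] ..
  then show ?thesis by (simp add: e_flow mult_ac)
qed

lemma flow_continuous_at: "continuous_on UNIV (\<Phi> t)"
  using continuous_on_compose2[OF flow_continuous, of UNIV "\<lambda>a. (t, a)"]
  by (simp add: continuous_on_Pair)

lemma continuous_Z: "continuous_on UNIV Z"
  unfolding Z_def by (intro continuous_on_vec_lambda zeta_continuous)

lemma continuous_e: "continuous_on UNIV (e k)"
proof -
  have "\<zeta> i a \<noteq> 0" for i a using norm_zeta[of i a] by auto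
  then show ?thesis
    unfolding e_def torus_char_def Z_def vec_lambda_beta
    by (intro continuous_on_prod continuous_on_power_int zeta_continuous) auto
qed

lemma measurable_continuous:
  fixes u :: "'a \<Rightarrow> 'b::topological_space"
  assumes "continuous_on UNIV u" shows "u \<in> borel_measurable \<mu>"
  using borel_measurable_continuous_onI[OF assms] measurable_cong_sets[OF sets_mu refl] by blast

lemma continuous_bounded:
  fixes u :: "'a \<Rightarrow> 'b::real_normed_vector"
  assumes "continuous_on UNIV u"
  obtains B where "B > 0" "\<And>a. norm (u a) \<le> B"
  using compact_imp_bounded[OF compact_continuous_image[OF assms compact_space]]
  by (auto simp: bounded_pos)

lemma integrable_continuous:
  fixes u :: "'a \<Rightarrow> 'b::{banach, second_countable_topology}"
  assumes "continuous_on UNIV u" shows "integrable \<mu> u"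
proof -
  obtain B where "\<And>a. norm (u a) \<le> B" using continuous_bounded[OF assms] by blast
  then show ?thesis
    by (intro integrable_const_bound[where B = B] measurable_continuous assms) auto
qed

lemma basis_e: "orthonormal_basis_L2 \<mu> e"
proof -
  have "e = (\<lambda>k a. \<Prod>i\<in>UNIV. \<zeta> i a powi k i)"
    by (intro ext) (simp add: e_def torus_char_def Z_def)
  then show ?thesis using basis by simp
qed

lemma integral_e: "(\<integral>a. e k a \<partial>\<mu>) = (if k = (\<lambda>_. 0) then 1 else 0)"
proof -
  have "\<forall>k l. (\<integral>a. e k a * cnj (e l a) \<partial>\<mu>) = (if k = l then 1 else 0)"
    using basis_e unfolding orthonormal_basis_L2_def by blast
  from spec[OF spec[OF this, of k], of "\<lambda>_. 0"] show ?thesis by (simp only: e_0 complex_cnj_one mult_1_right)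
qed

lemma L2_approx:
  assumes "f \<in> L2 \<mu>" "\<delta> > 0"
  obtains K c where "finite K" "(\<integral>a. (norm (f a - (\<Sum>k\<in>K. c k * e k a)))\<^sup>2 \<partial>\<mu>) < \<delta>"
  using assms basis_e unfolding orthonormal_basis_L2_def by blast

lemma flow_measurable: "\<Phi> t \<in> measurable \<mu> \<mu>" and flow_distr: "distr \<mu> \<mu> (\<Phi> t) = \<mu>"
  using invariant unfolding invariant_under_flow_def by auto

lemma integral_flow:
  fixes u :: "'a \<Rightarrow> 'b::{banach, second_countable_topology}"
  assumes "u \<in> borel_measurable \<mu>"
  shows "(\<integral>a. u (\<Phi> t a) \<partial>\<mu>) = (\<integral>a. u a \<partial>\<mu>)"
  using integral_distr[OF flow_measurable assms, of t] by (simp add: flow_distr)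

text \<open>The set where \<open>u\<close> is positive is invariant, so it has measure 0 or 1.
  Either way \<open>u\<close> almost surely does not change sign, and its mean is zero.\<close>

lemma invariant_mean_zero_AE_eq_0:
  fixes u :: "'a \<Rightarrow> real"
  assumes u: "integrable \<mu> u" and inv: "\<And>a. u (\<Phi> T a) = u a" and zero: "(\<integral>a. u a \<partial>\<mu>) = 0"
  shows "AE a in \<mu>. u a = 0"
proof -
  have [measurable]: "u \<in> borel_measurable \<mu>" using u by auto
  define B where "B = {a\<in>space \<mu>. u a > 0}"
  have B: "B \<in> events" unfolding B_def by measurable
  have "\<Phi> T -` B \<inter> space \<mu> = B" by (auto simp: B_def inv space_mu)
  then consider "prob B = 0" | "prob B = 1" using ergodic B unfolding ergodic_map_def by blast
  then show ?thesis
  proof cases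
    case 1
    then have "AE a in \<mu>. a \<notin> B" using B by (simp add: prob_eq_0)
    then have le: "AE a in \<mu>. 0 \<le> - u a" by eventually_elim (auto simp: B_def space_mu)
    have "AE a in \<mu>. - u a = 0"
      using integral_nonneg_eq_0_iff_AE[of \<mu> "\<lambda>a. - u a"] u zero le by simp
    then show ?thesis by simp
  next
    case 2
    then have "AE a in \<mu>. a \<in> B" using B by (simp add: prob_eq_1)
    then have le: "AE a in \<mu>. 0 \<le> u a" by eventually_elim (auto simp: B_def)
    then show ?thesis
      using integral_nonneg_eq_0_iff_AE[of \<mu> u] u zero by simp
  qed
qed

text \<open>Otherwise \<open>e k\<close> would be invariant under the sampled dynamics with mean
  zero, hence zero almost everywhere, against its modulus 1. So ergodicity of the
  time-\<open>T\<close> map excludes resonances between the frequencies and the sampling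
  interval.\<close>

lemma lam_ne_1:
  assumes "k \<noteq> (\<lambda>_. 0)" shows "lam k \<noteq> 1"
proof
  assume "lam k = 1"
  then have inv: "e k (\<Phi> T a) = e k a" for a using e_orbit[of k 1 a] by simp
  have i: "integrable \<mu> (e k)" by (intro integrable_continuous continuous_e)
  have 0: "(\<integral>a. e k a \<partial>\<mu>) = 0" using assms by (simp add: integral_e)
  have "AE a in \<mu>. Re (e k a) = 0"
    by (rule invariant_mean_zero_AE_eq_0) (use i 0 inv in \<open>auto simp: integral_Re\<close>)
  moreover have "AE a in \<mu>. Im (e k a) = 0"
    by (rule invariant_mean_zero_AE_eq_0) (use i 0 inv in \<open>auto simp: integral_Im\<close>)
  ultimately have "AE a in \<mu>. False"
  proof eventually_elim
    case (elim a)
    then have "e k a = 0" by (simp add: complex_eq_iff)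
    then show ?case using norm_e[of k a] by simp
  qed
  then show False by simp
qed

definition avg :: "nat \<Rightarrow> ('a \<Rightarrow> 'b::real_vector) \<Rightarrow> 'a \<Rightarrow> 'b" where
  "avg n u a = (1 / real n) *\<^sub>R (\<Sum>j<n. u (\<Phi> (real j * T) a))"

text \<open>Uniform over all starting points, since later these move with \<open>s\<close> and with
  the row.\<close>

definition uniformly_ergodic :: "('a \<Rightarrow> 'b::{banach, second_countable_topology}) \<Rightarrow> bool" where
  "uniformly_ergodic u \<longleftrightarrow> uniform_limit UNIV (\<lambda>n. avg n u) (\<lambda>_. \<integral>a. u a \<partial>\<mu>) sequentially"

lemma uniformly_ergodic_e: "uniformly_ergodic (e k)"
proof (cases "k = (\<lambda>_. 0)")
  case True
  have "\<forall>\<^sub>F n in sequentially. \<forall>a. avg n (e k) a = 1"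
    by (rule eventually_sequentiallyI[of 1]) (simp add: True avg_def e_0 scaleR_conv_of_real)
  then have "uniform_limit UNIV (\<lambda>n. avg n (e k)) (\<lambda>_. 1) sequentially"
    unfolding uniform_limit_iff by (auto elim: eventually_mono)
  then show ?thesis using True by (simp add: uniformly_ergodic_def integral_e)
next
  case False
  have eq: "avg n (e k) a = (1 / real n) *\<^sub>R (\<Sum>j<n. lam k ^ j) * e k a" for n a
    by (simp add: avg_def e_orbit sum_distrib_right)
  have "uniform_limit UNIV (\<lambda>n. avg n (e k)) (\<lambda>_. 0) sequentially"
    unfolding uniform_limit_iff
  proof (intro allI impI)
    fix \<delta> :: real assume "\<delta> > 0"
    with averages_of_powers[OF norm_lam lam_ne_1[OF False]]
    have "\<forall>\<^sub>F n in sequentially. dist ((1 / real n) *\<^sub>R (\<Sum>j<n. lam k ^ j)) 0 < \<delta>"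
      by (rule tendstoD)
    then show "\<forall>\<^sub>F n in sequentially. \<forall>a\<in>UNIV. dist (avg n (e k) a) 0 < \<delta>"
      by eventually_elim (simp add: eq norm_mult norm_e)
  qed
  then show ?thesis using False by (simp add: uniformly_ergodic_def integral_e)
qed

lemma uniformly_ergodic_cmult:
  fixes u :: "'a \<Rightarrow> 'b::{real_normed_field, banach, second_countable_topology}"
  assumes "uniformly_ergodic u" shows "uniformly_ergodic (\<lambda>a. c * u a)"
proof -
  have eq: "avg n (\<lambda>a. c * u a) = (\<lambda>a. c * avg n u a)" for n
    by (simp add: avg_def sum_distrib_left fun_eq_iff)
  have "bounded_linear (\<lambda>x. c * x)" by (rule bounded_linear_mult_right)
  from bounded_linear.uniform_limit[OF this assms[unfolded uniformly_ergodic_def]]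
  show ?thesis by (simp add: uniformly_ergodic_def eq)
qed

lemma uniformly_ergodic_add:
  assumes "uniformly_ergodic u" "uniformly_ergodic v" "integrable \<mu> u" "integrable \<mu> v"
  shows "uniformly_ergodic (\<lambda>a. u a + v a)"
proof -
  have eq: "avg n (\<lambda>a. u a + v a) = (\<lambda>a. avg n u a + avg n v a)" for n
    by (simp add: avg_def sum.distrib scaleR_add_right fun_eq_iff)
  show ?thesis
    using uniform_limit_add[OF assms(1)[unfolded uniformly_ergodic_def] assms(2)[unfolded uniformly_ergodic_def]]
      assms(3,4) by (simp add: uniformly_ergodic_def eq)
qed

lemma continuous_trig: "continuous_on UNIV (\<lambda>a. \<Sum>k\<in>K. c k * e k a)"
  by (intro continuous_on_sum continuous_on_mult continuous_on_const continuous_e)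

lemma uniformly_ergodic_trig:
  "finite K \<Longrightarrow> uniformly_ergodic (\<lambda>a. \<Sum>k\<in>K. c k * e k a)"
proof (induction K rule: finite_induct)
  case empty
  then show ?case using uniformly_ergodic_cmult[OF uniformly_ergodic_e, of 0] by simp
next
  case (insert x K)
  have "uniformly_ergodic (\<lambda>a. c x * e x a + (\<Sum>k\<in>K. c k * e k a))"
    by (intro uniformly_ergodic_add uniformly_ergodic_cmult uniformly_ergodic_e insert.IH
        integrable_continuous continuous_trig continuous_on_mult continuous_on_const continuous_e)
  then show ?case using insert by simp
qed

lemma real_polynomial_trig:
  assumes "real_polynomial_function r"
  obtains K c where "finite K" "\<And>z. z \<in> torus \<Longrightarrow> of_real (r z) = (\<Sum>k\<in>K. c k * torus_char k z)"
  using trig_poly_real_polynomial[OF assms] unfolding trig_poly_on_torus_def by blast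

lemma avg_of_real: "avg n (\<lambda>a. complex_of_real (u a)) a = of_real (avg n u a)"
  by (simp add: avg_def scaleR_conv_of_real)

lemma uniformly_ergodic_of_real:
  "uniformly_ergodic (\<lambda>a. complex_of_real (u a)) \<longleftrightarrow> uniformly_ergodic u"
  unfolding uniformly_ergodic_def avg_of_real integral_complex_of_real uniform_limit_iff
  by (simp add: dist_of_real)

lemma uniformly_ergodic_polynomial:
  assumes "real_polynomial_function r" shows "uniformly_ergodic (\<lambda>a. r (Z a))"
proof -
  obtain K c where K: "finite K" "\<And>z. z \<in> torus \<Longrightarrow> of_real (r z) = (\<Sum>k\<in>K. c k * torus_char k z)"
    using real_polynomial_trig[OF assms] by blast
  have "(\<lambda>a. of_real (r (Z a))) = (\<lambda>a. \<Sum>k\<in>K. c k * e k a)"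
    using K(2) Z_torus by (simp add: e_def)
  then show ?thesis
    using uniformly_ergodic_trig[OF K(1), of c] uniformly_ergodic_of_real[of "\<lambda>a. r (Z a)"] by simp
qed

lemma continuous_poly_Z:
  "real_polynomial_function r \<Longrightarrow> continuous_on UNIV (\<lambda>a. r (Z a))"
  using continuous_on_compose2[OF continuous_on_polymonial_function[of r UNIV] continuous_Z]
  by (simp add: real_polynomial_function_eq)

end

section \<open>Fibres of the eigenfunction map\<close>

text \<open>Parametrised by angles in \<open>real ^ 'm\<close> and not by elements of the torus, so
  that exceptional sets of rotations can be measured by Lebesgue measure.\<close>

definition rot :: "real ^ 'm \<Rightarrow> complex ^ 'm \<Rightarrow> complex ^ 'm" where
  "rot \<theta> z = (\<chi> i. exp (\<i> * of_real (\<theta> $ i)) * z $ i)"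

lemma rot_torus: "z \<in> torus \<Longrightarrow> rot \<theta> z \<in> torus"
  by (simp add: rot_def torus_def norm_mult)

lemma rot_continuous: "continuous_on UNIV (\<lambda>(\<theta>, z). rot \<theta> z)"
  unfolding rot_def case_prod_unfold by (intro continuous_intros)

lemma torus_char_rot:
  "torus_char k (rot \<theta> z) = exp (\<i> * of_real (\<Sum>i\<in>UNIV. of_int (k i) * \<theta> $ i)) * torus_char k z"
proof -
  have "rot \<theta> z = (\<chi> i. (\<chi> i. exp (\<i> * of_real (\<theta> $ i))) $ i * z $ i)"
    by (simp add: rot_def)
  then show ?thesis by (simp only: torus_char_mult torus_char_exp)
qed

lemma compact_torus: "compact torus"
proof -
  have "closed (torus :: (complex ^ 'a) set)"
    unfolding torus_def by (intro closed_Collect_all closed_Collect_eq continuous_intros)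
  moreover have "bounded (torus :: (complex ^ 'a) set)"
    unfolding bounded_iff
  proof (intro exI ballI)
    fix z :: "complex ^ 'a" assume "z \<in> torus"
    then show "norm z \<le> (\<Sum>i\<in>(UNIV :: 'a set). 1)"
      using L2_set_le_sum[of UNIV "\<lambda>i. norm (z $ i)"] by (simp add: torus_def norm_vec_def)
  qed
  ultimately show ?thesis by (simp add: compact_eq_bounded_closed)
qed

context kronecker_system
begin

lemma injective_off_null_set:
  fixes F :: "'a \<Rightarrow> real ^ 'd"
  assumes F: "continuous_on UNIV F" "inj F"
  obtains N where "N \<in> null_sets \<mu>" "inj_on Z (- N)"
proof -
  \<comment> \<open>Mean square errors below 2^(-n) are summable, so the approximations converge
    almost everywhere along the full sequence. The approximants are kept as functions
    \<open>P\<close> of the torus variable, so that equal values of \<open>Z\<close> give equal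
    limits.\<close>
  define good where "good n c P \<longleftrightarrow> continuous_on UNIV (\<lambda>a. P (Z a)) \<and>
      (\<integral>a. (norm (complex_of_real (F a $ c) - P (Z a)))\<^sup>2 \<partial>\<mu>) < (1/2) ^ n"
    for n :: nat and c and P :: "complex ^ 'm \<Rightarrow> complex"
  have ex: "\<exists>P. good n c P" for n c
  proof -
    have FL2: "(\<lambda>a. complex_of_real (F a $ c)) \<in> L2 \<mu>"
      unfolding L2_def by (auto intro!: measurable_continuous integrable_continuous continuous_intros F)
    obtain K b where "finite K"
      "(\<integral>a. (norm (complex_of_real (F a $ c) - (\<Sum>k\<in>K. b k * e k a)))\<^sup>2 \<partial>\<mu>) < (1/2) ^ n"
      by (rule L2_approx[OF FL2, of "(1/2) ^ n"]) simp
    then have "good n c (\<lambda>z. \<Sum>k\<in>K. b k * torus_char k z)"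
      using continuous_trig[of b K] by (simp add: good_def e_def)
    then show ?thesis by blast
  qed
  define P where "P n c = (SOME P. good n c P)" for n c
  have "good n c (P n c)" for n c unfolding P_def by (rule someI_ex[OF ex])
  then have Pc: "\<And>n c. continuous_on UNIV (\<lambda>a. P n c (Z a))" and
    P: "\<And>n c. (\<integral>a. (norm (complex_of_real (F a $ c) - P n c (Z a)))\<^sup>2 \<partial>\<mu>) < (1/2) ^ n"
    by (simp_all add: good_def)
  have "AE a in \<mu>. (\<lambda>n. P n c (Z a)) \<longlonglongrightarrow> of_real (F a $ c)" for c
  proof -
    have "AE a in \<mu>. summable (\<lambda>n. (norm (complex_of_real (F a $ c) - P n c (Z a)))\<^sup>2)"
    proof (rule AE_summable)
      show "integrable \<mu> (\<lambda>a. (norm (complex_of_real (F a $ c) - P n c (Z a)))\<^sup>2)" for n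
        by (intro integrable_continuous continuous_intros F Pc)
      show "summable (\<lambda>n. \<integral>a. (norm (complex_of_real (F a $ c) - P n c (Z a)))\<^sup>2 \<partial>\<mu>)"
        by (rule summable_comparison_test'[OF summable_geometric[of "1/2 :: real"], where N = 0])
          (use P in \<open>auto intro: less_imp_le simp: abs_of_nonneg integral_nonneg_AE\<close>)
    qed simp
    then show ?thesis
    proof eventually_elim
      case (elim a)
      have "(\<lambda>n. sqrt ((norm (complex_of_real (F a $ c) - P n c (Z a)))\<^sup>2)) \<longlonglongrightarrow> sqrt 0"
        by (intro tendsto_real_sqrt summable_LIMSEQ_zero elim)
      then have "(\<lambda>n. norm (P n c (Z a) - complex_of_real (F a $ c))) \<longlonglongrightarrow> 0"
        by (simp add: norm_minus_commute)
      then show ?case by (simp only: LIM_zero_iff tendsto_norm_zero_iff)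
    qed
  qed
  then have "AE a in \<mu>. \<forall>c. (\<lambda>n. P n c (Z a)) \<longlonglongrightarrow> of_real (F a $ c)"
    by (simp add: AE_all_countable)
  then obtain N where N: "N \<in> null_sets \<mu>" "{a\<in>space \<mu>. \<not> (\<forall>c. (\<lambda>n. P n c (Z a)) \<longlonglongrightarrow> of_real (F a $ c))} \<subseteq> N"
    unfolding eventually_ae_filter by blast
  have "inj_on Z (- N)"
  proof (rule inj_onI)
    fix a b assume ab: "a \<in> - N" "b \<in> - N" "Z a = Z b"
    have lim: "(\<lambda>n. P n c (Z x)) \<longlonglongrightarrow> of_real (F x $ c)" if "x \<in> - N" for x c
      using N(2) that by (auto simp: space_mu)
    have "F a $ c = F b $ c" for c
    proof -
      have "(\<lambda>n. P n c (Z a)) \<longlonglongrightarrow> of_real (F a $ c)" "(\<lambda>n. P n c (Z a)) \<longlonglongrightarrow> of_real (F b $ c)"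
        using lim[OF ab(1), of c] lim[OF ab(2), of c] unfolding ab(3) .
      then show ?thesis using LIMSEQ_unique of_real_eq_iff by blast
    qed
    then have "F a = F b" by (simp add: vec_eq_iff)
    then show "a = b" using F(2) by (rule injD[rotated])
  qed
  then show ?thesis using that N(1) by blast
qed

text \<open>A positive density that integrates to zero over a set forces the set to be Lebesgue
  null. This moves null sets of \<mu> into coordinates.\<close>

lemma chart_image_negligible:
  fixes \<A> :: "('a, 'n::finite) chart set"
  assumes chart: "is_chart (U, \<phi>)" and dens: "smooth_positive_density \<A> \<mu>" and U: "(U, \<phi>) \<in> \<A>"
    and N: "N \<in> null_sets \<mu>"
  shows "negligible (\<phi> ` (N \<inter> U))"
proof -
  let ?\<psi> = "inv_into U \<phi>"
  have "open U" "open (\<phi> ` U)" and hom: "homeomorphism U (\<phi> ` U) \<phi> ?\<psi>"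
    using chart by (auto simp: is_chart_def)
  obtain \<rho> where \<rho>: "smooth_on (\<phi> ` U) \<rho>" "\<And>x. x \<in> \<phi> ` U \<Longrightarrow> \<rho> x > 0"
    "\<And>B. B \<in> sets borel \<Longrightarrow> B \<subseteq> U \<Longrightarrow> emeasure \<mu> B = (\<integral>\<^sup>+x\<in>\<phi> ` B. ennreal (\<rho> x) \<partial>lborel)"
    using bspec[OF dens[unfolded smooth_positive_density_def] U] by auto
  have \<rho>c: "continuous_on (\<phi> ` U) \<rho>" using \<rho>(1)[unfolded smooth_on_def, THEN spec, of 0] by simp
  define B where "B = N \<inter> U"
  have B: "B \<in> sets borel" "B \<subseteq> U" "emeasure \<mu> B = 0"
  proof -
    have Nb: "N \<in> sets borel" using N sets_mu by auto
    then show "B \<in> sets borel" using \<open>open U\<close> by (auto simp: B_def)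
    show "B \<subseteq> U" by (simp add: B_def)
    have "emeasure \<mu> B \<le> emeasure \<mu> N"
      using N by (intro emeasure_mono) (auto simp: B_def)
    then show "emeasure \<mu> B = 0" using N by (auto simp: null_sets_def)
  qed
  have img: "\<phi> ` B = ?\<psi> -` B \<inter> \<phi> ` U"
    using hom B(2) unfolding homeomorphism_def by force
  have "?\<psi> \<in> borel_measurable (restrict_space borel (\<phi> ` U))"
    using hom by (intro borel_measurable_continuous_on_restrict) (auto simp: homeomorphism_def)
  from measurable_sets[OF this B(1)] have meas: "\<phi> ` B \<in> sets borel"
    using \<open>open (\<phi> ` U)\<close> by (simp add: img space_restrict_space sets_restrict_space_iff)
  \<comment> \<open>The density is controlled on the chart image only; cut off by the indicator it
    becomes Borel measurable on the whole space.\<close>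
  have "(\<lambda>x. indicator (\<phi> ` U) x *\<^sub>R \<rho> x) \<in> borel_measurable borel"
    using \<open>open (\<phi> ` U)\<close> \<rho>c by (intro borel_measurable_continuous_on_indicator) auto
  then have m: "(\<lambda>x. ennreal (indicator (\<phi> ` U) x *\<^sub>R \<rho> x) * indicator (\<phi> ` B) x) \<in> borel_measurable lborel"
    using meas by measurable
  have "(\<lambda>x. ennreal (\<rho> x) * indicator (\<phi> ` B) x) = (\<lambda>x. ennreal (indicator (\<phi> ` U) x *\<^sub>R \<rho> x) * indicator (\<phi> ` B) x)"
    using B(2) by (auto simp: indicator_def fun_eq_iff)
  then have "(\<integral>\<^sup>+x. ennreal (indicator (\<phi> ` U) x *\<^sub>R \<rho> x) * indicator (\<phi> ` B) x \<partial>lborel) = 0"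
    using \<rho>(3)[OF B(1,2)] B(3) by simp
  then have "AE x in lborel. ennreal (indicator (\<phi> ` U) x *\<^sub>R \<rho> x) * indicator (\<phi> ` B) x = 0"
    by (simp only: nn_integral_0_iff_AE[OF m])
  then have "AE x in lborel. x \<notin> \<phi> ` B"
  proof eventually_elim
    case (elim x)
    show ?case
    proof
      assume x: "x \<in> \<phi> ` B"
      then have "x \<in> \<phi> ` U" using B(2) by auto
      then show False using elim x \<rho>(2)[of x] by (auto simp: indicator_def ennreal_eq_0_iff split: if_splits)
    qed
  qed
  then have "\<phi> ` B \<in> null_sets lborel"
    using meas by (simp add: AE_iff_null_sets)
  then show ?thesis
    unfolding B_def negligible_iff_null_sets by (rule null_sets_completionI)
qed

text \<open>In a chart and after a choice of arguments \<open>Z\<close> becomes a differentiable map between spaces of the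
  same dimension, so it maps null sets to null sets.\<close>

lemma rotations_into_null_image_negligible:
  fixes \<A> :: "('a, 'm) chart set"
  assumes atlas: "smooth_atlas \<A>" and smooth: "\<And>i. smooth_fun \<A> (\<zeta> i)"
    and dens: "smooth_positive_density \<A> \<mu>" and N: "N \<in> null_sets \<mu>" and z: "z \<in> torus"
  shows "negligible {\<theta>. rot \<theta> z \<in> Z ` N}"
proof -
  have chart: "is_chart c" if "c \<in> \<A>" for c using atlas that by (auto simp: smooth_atlas_def)
  have opn: "open (fst c)" if "c \<in> \<A>" for c using chart[OF that] by (auto simp: is_chart_def split: prod.splits)
  have cover: "UNIV \<subseteq> (\<Union>c\<in>\<A>. fst c)" using atlas by (simp add: smooth_atlas_def case_prod_unfold)
  obtain \<C> where \<C>: "\<C> \<subseteq> \<A>" "finite \<C>" "UNIV \<subseteq> (\<Union>c\<in>\<C>. fst c)"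
    by (rule compactE_image[OF compact_space opn cover])
  \<comment> \<open>\<open>lift c J n\<close> reads \<open>Z\<close> in the chart \<open>c\<close>
    as a vector of angles relative to \<open>z\<close>. The set \<open>J\<close> selects the branch
    of the logarithm: outside \<open>J\<close> the value is multiplied by -1 to leave the cut, and
    pi is added back; \<open>n\<close> counts full turns.\<close>
  define sg where "sg J i = (if i \<in> J then 1 else - 1 :: complex)" for J and i :: 'm
  define lift where "lift c J n x = (\<chi> i. Im (Ln (sg J i * \<zeta> i (inv_into (fst c) (snd c) x)))
      + (if i \<in> J then 0 else pi) - Im (Ln (z $ i)) + 2 * pi * of_int (n i))"
    for c :: "('a, 'm) chart" and J and n :: "'m \<Rightarrow> int" and x
  define S where "S c J = {a \<in> N \<inter> fst c. \<forall>i. sg J i * \<zeta> i a \<notin> \<real>\<^sub>\<le>\<^sub>0}" for c :: "('a, 'm) chart" and J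
  have neg: "negligible (lift c J n ` (snd c ` S c J))" if c: "c \<in> \<C>" for c J n
  proof (rule negligible_differentiable_image_negligible)
    obtain U \<phi> where c_eq: "c = (U, \<phi>)" by (cases c)
    have cA: "(U, \<phi>) \<in> \<A>" using c \<C>(1) c_eq by auto
    show "negligible (snd c ` S c J)"
      by (rule negligible_subset[OF chart_image_negligible[OF chart[OF cA] dens cA N]])
        (auto simp: S_def c_eq)
    have "(\<lambda>x. lift c J n x) differentiable (at x)" if x: "x \<in> snd c ` S c J" for x
    proof -
      obtain a where a: "a \<in> N" "a \<in> U" "x = \<phi> a" "\<And>i. sg J i * \<zeta> i a \<notin> \<real>\<^sub>\<le>\<^sub>0"
        using x by (auto simp: S_def c_eq)
      have inv: "inv_into U \<phi> x = a"
        using chart[OF cA] a by (auto simp: is_chart_def homeomorphism_def)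
      have "(\<lambda>x. lift c J n x $ i) differentiable (at x)" for i
      proof -
        have "smooth_on (\<phi> ` U) (\<zeta> i \<circ> inv_into U \<phi>)"
          using smooth[of i] cA by (auto simp: smooth_fun_def)
        then have "C_on (Suc 0) (\<phi> ` U) (\<zeta> i \<circ> inv_into U \<phi>)" unfolding smooth_on_def by blast
        then have "(\<zeta> i \<circ> inv_into U \<phi>) differentiable (at x)" using a by auto
        then have d1: "(\<lambda>x. sg J i * \<zeta> i (inv_into U \<phi> x)) differentiable (at x)"
          by (intro differentiable_mult differentiable_const) (simp add: comp_def)
        have "Ln differentiable (at (sg J i * \<zeta> i (inv_into U \<phi> x)))"
          using a(4)[of i] inv by (intro field_differentiable_imp_differentiable field_differentiable_at_Ln) simp
        from differentiable_chain_at[OF d1 this]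
        have "(\<lambda>x. Ln (sg J i * \<zeta> i (inv_into U \<phi> x))) differentiable (at x)" by (simp add: comp_def)
        then have "(\<lambda>x. Im (Ln (sg J i * \<zeta> i (inv_into U \<phi> x)))) differentiable (at x)"
          unfolding differentiable_def using has_derivative_Im by blast
        then show ?thesis unfolding lift_def c_eq by simp
      qed
      then show ?thesis
        unfolding differentiable_componentwise_within[of "lift c J n"]
        by (auto simp: Basis_vec_def inner_axis)
    qed
    then show "lift c J n differentiable_on snd c ` S c J"
      unfolding differentiable_on_def by (blast intro: differentiable_at_withinI)
  qed simp
  have "{\<theta>. rot \<theta> z \<in> Z ` N} \<subseteq> (\<Union>c\<in>\<C>. \<Union>J. \<Union>n. lift c J n ` (snd c ` S c J))"
  proof
    fix \<theta> assume "\<theta> \<in> {\<theta>. rot \<theta> z \<in> Z ` N}"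
    then obtain a where a: "a \<in> N" "rot \<theta> z = Z a" by auto
    obtain c where c: "c \<in> \<C>" "a \<in> fst c" using \<C>(3) by blast
    obtain U \<phi> where c_eq: "c = (U, \<phi>)" by (cases c)
    have aU: "a \<in> U" and cA: "(U, \<phi>) \<in> \<A>" using c \<C>(1) c_eq by auto
    have inv: "inv_into U \<phi> (\<phi> a) = a"
      using chart[OF cA] aU by (auto simp: is_chart_def homeomorphism_def)
    \<comment> \<open>An eigenfunction value on the cut is -1, having modulus 1, so its negative is
      1 and off the cut.\<close>
    define J where "J = {i. \<zeta> i a \<notin> \<real>\<^sub>\<le>\<^sub>0}"
    have notneg: "sg J i * \<zeta> i a \<notin> \<real>\<^sub>\<le>\<^sub>0" for i
    proof (cases "i \<in> J")
      case False
      then have "\<zeta> i a \<in> \<real>\<^sub>\<le>\<^sub>0" by (simp add: J_def)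
      then obtain r where r: "\<zeta> i a = of_real r" "r \<le> 0" by (auto elim: nonpos_Reals_cases)
      then have "r = - 1" using norm_zeta[of i a] by simp
      then show ?thesis using False r by (simp add: sg_def)
    qed (simp add: sg_def J_def)
    have "\<exists>n::int. \<theta> $ i = Im (Ln (sg J i * \<zeta> i a)) + (if i \<in> J then 0 else pi) - Im (Ln (z $ i)) + 2 * pi * of_int n" for i
    proof -
      have unit: "exp (\<i> * of_real (Im (Ln w))) = w" if "norm w = 1" for w
      proof -
        have "w \<noteq> 0" using that by auto
        then have "Ln w = \<i> * of_real (Im (Ln w))" using that by (simp add: complex_eq_iff)
        then show ?thesis using exp_Ln[OF \<open>w \<noteq> 0\<close>] by metis
      qed
      have zi: "norm (z $ i) = 1" using z by (simp add: torus_def)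
      have sgi: "norm (sg J i * \<zeta> i a) = 1" by (simp add: sg_def norm_mult norm_zeta)
      have "exp (\<i> * of_real (\<theta> $ i)) * z $ i = \<zeta> i a"
        using a(2) by (simp add: rot_def Z_def vec_eq_iff)
      then have "exp (\<i> * of_real (\<theta> $ i)) * exp (\<i> * of_real (Im (Ln (z $ i))))
          = exp (\<i> * of_real (Im (Ln (sg J i * \<zeta> i a)))) * exp (\<i> * of_real (if i \<in> J then 0 else pi))"
        unfolding unit[OF zi] unit[OF sgi] by (auto simp: sg_def exp_Euler)
      then have "exp (\<i> * of_real (\<theta> $ i) + \<i> * of_real (Im (Ln (z $ i))))
          = exp (\<i> * of_real (Im (Ln (sg J i * \<zeta> i a))) + \<i> * of_real (if i \<in> J then 0 else pi))"
        by (simp only: exp_add)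
      then obtain n :: int where "\<i> * of_real (\<theta> $ i) + \<i> * of_real (Im (Ln (z $ i)))
          = \<i> * of_real (Im (Ln (sg J i * \<zeta> i a))) + \<i> * of_real (if i \<in> J then 0 else pi) + (of_int (2 * n) * pi) * \<i>"
        unfolding exp_eq by blast
      then have "Im (\<i> * of_real (\<theta> $ i) + \<i> * of_real (Im (Ln (z $ i))))
          = Im (\<i> * of_real (Im (Ln (sg J i * \<zeta> i a))) + \<i> * of_real (if i \<in> J then 0 else pi) + (of_int (2 * n) * pi) * \<i>)"
        by (rule arg_cong)
      then have "\<theta> $ i + Im (Ln (z $ i)) = Im (Ln (sg J i * \<zeta> i a)) + (if i \<in> J then 0 else pi) + 2 * of_int n * pi"
        by (simp split: if_splits)
      then show ?thesis by (intro exI[of _ n]) (auto simp: algebra_simps)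
    qed
    then obtain n :: "'m \<Rightarrow> int" where n: "\<And>i. \<theta> $ i = Im (Ln (sg J i * \<zeta> i a)) + (if i \<in> J then 0 else pi) - Im (Ln (z $ i)) + 2 * pi * of_int (n i)"
      by metis
    have "\<theta> = lift c J n (\<phi> a)"
      by (simp add: vec_eq_iff lift_def c_eq inv n)
    moreover have "a \<in> S c J" using a aU notneg by (simp add: S_def c_eq)
    ultimately have "\<theta> \<in> lift c J n ` (snd c ` S c J)" by (auto simp: c_eq)
    then show "\<theta> \<in> (\<Union>c\<in>\<C>. \<Union>J. \<Union>n. lift c J n ` (snd c ` S c J))" using c(1) by blast
  qed
  \<comment> \<open>Compactness leaves finitely many charts; there are finitely many branches
    \<open>J\<close> and countably many turns \<open>n\<close>.\<close>
  moreover have "negligible (\<Union>c\<in>\<C>. \<Union>J. \<Union>n. lift c J n ` (snd c ` S c J))"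
  proof -
    have "countable (UNIV :: 'm set set)" "countable (UNIV :: ('m \<Rightarrow> int) set)"
      by (simp_all add: countable_finite)
    then show ?thesis
      using neg unfolding negligible_iff_null_sets
      by (intro null_sets_UN' countable_finite[OF \<C>(2)])
  qed
  ultimately show ?thesis by (rule negligible_subset[rotated])
qed

section \<open>Rotation invariance and almost surely unique fibres\<close>

text \<open>A rotation multiplies a character by a constant, and this constant is 1 for the only
  character of nonzero mean. In effect the image of \<mu> under \<open>Z\<close> is Haar measure on
  the torus, expressed without forming the image measure.\<close>

lemma integral_rot:
  fixes h :: "complex ^ 'm \<Rightarrow> real"
  assumes h: "continuous_on UNIV h"
  shows "(\<integral>a. h (rot \<theta> (Z a)) \<partial>\<mu>) = (\<integral>a. h (Z a) \<partial>\<mu>)"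
proof -
  have rc: "continuous_on UNIV (\<lambda>a. rot \<theta> (Z a))"
    using continuous_on_compose2[OF rot_continuous, of UNIV "\<lambda>a. (\<theta>, Z a)"]
    by (simp add: continuous_on_Pair continuous_Z)
  have hc: "continuous_on UNIV (\<lambda>a. h (rot \<theta> (Z a)))" "continuous_on UNIV (\<lambda>a. h (Z a))"
    by (auto intro!: continuous_on_compose2[OF h] rc continuous_Z)
  have "\<bar>(\<integral>a. h (rot \<theta> (Z a)) \<partial>\<mu>) - (\<integral>a. h (Z a) \<partial>\<mu>)\<bar> \<le> \<delta>" if \<delta>: "\<delta> > 0" for \<delta>
  proof -
    obtain r where r: "real_polynomial_function r" "\<And>z. z \<in> torus \<Longrightarrow> \<bar>h z - r z\<bar> < \<delta> / 2"
      using Stone_Weierstrass_real_polynomial_function[OF compact_torus continuous_on_subset[OF h], of "\<delta> / 2"] \<delta> by auto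
    obtain K c where K: "finite K" "\<And>z. z \<in> torus \<Longrightarrow> of_real (r z) = (\<Sum>k\<in>K. c k * torus_char k z)"
      using real_polynomial_trig[OF r(1)] by blast
    have int_e: "integrable \<mu> (e k)" for k by (intro integrable_continuous continuous_e)
    have "continuous_on UNIV r"
      using continuous_on_polymonial_function[of r UNIV] r(1) by (simp add: real_polynomial_function_eq)
    then have rcont: "continuous_on UNIV (\<lambda>a. r (Z a))" "continuous_on UNIV (\<lambda>a. r (rot \<theta> (Z a)))"
      by (auto intro: continuous_on_compose2[of UNIV r] rc continuous_Z)
    have "complex_of_real (\<integral>a. r (rot \<theta> (Z a)) \<partial>\<mu>) = (\<integral>a. (\<Sum>k\<in>K. c k * (exp (\<i> * of_real (\<Sum>i\<in>UNIV. of_int (k i) * \<theta> $ i)) * e k a)) \<partial>\<mu>)"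
      unfolding integral_complex_of_real[symmetric]
      by (rule Bochner_Integration.integral_cong) (simp_all add: K(2) rot_torus Z_torus torus_char_rot e_def)
    also have "\<dots> = (\<Sum>k\<in>K. c k * (exp (\<i> * of_real (\<Sum>i\<in>UNIV. of_int (k i) * \<theta> $ i)) * (\<integral>a. e k a \<partial>\<mu>)))"
      using int_e by (simp add: Bochner_Integration.integral_sum)
    also have "\<dots> = (\<Sum>k\<in>K. c k * (\<integral>a. e k a \<partial>\<mu>))"
      by (rule sum.cong) (auto simp: integral_e)
    also have "\<dots> = (\<integral>a. (\<Sum>k\<in>K. c k * e k a) \<partial>\<mu>)"
      using int_e by (simp add: Bochner_Integration.integral_sum)
    also have "\<dots> = complex_of_real (\<integral>a. r (Z a) \<partial>\<mu>)"
      unfolding integral_complex_of_real[symmetric]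
      by (rule Bochner_Integration.integral_cong) (simp_all add: K(2) Z_torus e_def)
    finally have eq: "(\<integral>a. r (rot \<theta> (Z a)) \<partial>\<mu>) = (\<integral>a. r (Z a) \<partial>\<mu>)" by simp
    have close: "\<bar>(\<integral>a. u a \<partial>\<mu>) - (\<integral>a. v a \<partial>\<mu>)\<bar> \<le> \<delta> / 2"
      if "continuous_on UNIV u" "continuous_on UNIV v" "\<And>a. \<bar>u a - v a\<bar> \<le> \<delta> / 2" for u v :: "'a \<Rightarrow> real"
    proof -
      have i: "integrable \<mu> u" "integrable \<mu> v" using that by (auto intro: integrable_continuous)
      have "\<bar>\<integral>a. u a - v a \<partial>\<mu>\<bar> \<le> (\<integral>a. \<bar>u a - v a\<bar> \<partial>\<mu>)" by (rule integral_abs_bound)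
      also have "\<dots> \<le> (\<integral>a. \<delta> / 2 \<partial>\<mu>)" by (rule integral_mono) (use i that(3) in auto)
      finally show ?thesis using i by (simp add: prob_space)
    qed
    have c1: "\<bar>(\<integral>a. h (rot \<theta> (Z a)) \<partial>\<mu>) - (\<integral>a. r (rot \<theta> (Z a)) \<partial>\<mu>)\<bar> \<le> \<delta> / 2"
      by (intro close hc rcont less_imp_le r(2) rot_torus Z_torus)
    have c2: "\<bar>(\<integral>a. h (Z a) \<partial>\<mu>) - (\<integral>a. r (Z a) \<partial>\<mu>)\<bar> \<le> \<delta> / 2"
      by (intro close hc rcont less_imp_le r(2) Z_torus)
    show ?thesis using c1 c2 eq by linarith
  qed
  then show ?thesis by (metis abs_le_zero_iff dense_le_bounded eq_iff_diff_eq_0 field_le_epsilon add_0 )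
qed

text \<open>The continuous functions \<open>h j\<close> decrease to the indicator of
  \<open>C\<close>, so the invariance of their integrals passes to \<open>C\<close> by dominated
  convergence.\<close>

lemma prob_rot_compact:
  assumes C: "compact C"
  shows "prob {a. rot \<theta> (Z a) \<in> C} = prob {a. Z a \<in> C}"
\<comment> \<open>By convention \<open>infdist z {}\<close> is 0, so the functions
  \<open>h j\<close> below would be constantly 1 for the empty set.\<close>
proof (cases "C = {}")
  case False
  define h where "h j z = max 0 (1 - real j * infdist z C)" for j z
  have hc: "continuous_on UNIV (h j)" for j unfolding h_def by (intro continuous_intros)
  have hlim: "(\<lambda>j. h j z) \<longlonglongrightarrow> indicator C z" for z
  proof (cases "z \<in> C")
    case False
    then have pos: "infdist z C > 0"
      using infdist_pos_not_in_closed[OF compact_imp_closed[OF C] \<open>C \<noteq> {}\<close>] by simp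
    obtain j0 where "1 / infdist z C \<le> real j0" using real_arch_simple by blast
    then have "h j z = 0" if "j \<ge> j0" for j
    proof -
      have "1 / infdist z C * infdist z C \<le> real j * infdist z C"
        using that \<open>1 / infdist z C \<le> real j0\<close> pos by (intro mult_right_mono) auto
      then show ?thesis using pos by (simp add: h_def)
    qed
    then show ?thesis using False
      by (intro tendsto_eventually eventually_sequentiallyI[of j0]) simp
  qed (simp add: h_def)
  have hle: "\<bar>h j z\<bar> \<le> 1" for j z
    using infdist_nonneg[of z C] by (simp add: h_def)
  have lim: "(\<lambda>j. \<integral>a. h j (g a) \<partial>\<mu>) \<longlonglongrightarrow> prob {a. g a \<in> C}" if g: "continuous_on UNIV g" for g
  proof -
    have "(\<lambda>j. \<integral>a. h j (g a) \<partial>\<mu>) \<longlonglongrightarrow> (\<integral>a. indicator C (g a) \<partial>\<mu>)"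
    proof (rule integral_dominated_convergence[where w = "\<lambda>_. 1"])
      have "{a\<in>space \<mu>. g a \<in> C} \<in> events"
        using measurable_sets[OF measurable_continuous[OF g], of C] compact_imp_closed[OF C]
        by (simp add: vimage_def Int_def conj_commute)
      then show "(\<lambda>a. indicat_real C (g a)) \<in> borel_measurable \<mu>"
        by (rule borel_measurable_indicator')
      show "(\<lambda>a. h j (g a)) \<in> borel_measurable \<mu>" for j
        by (intro measurable_continuous continuous_on_compose2[OF hc g]) simp
    qed (use hlim hle in auto)
    also have "(\<integral>a. indicator C (g a) \<partial>\<mu>) = (\<integral>a. indicator {a. g a \<in> C} a \<partial>\<mu>)"
      by (rule Bochner_Integration.integral_cong) (auto simp: indicator_def)
    also have "\<dots> = prob {a. g a \<in> C}" by (simp add: space_mu)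
    finally show ?thesis .
  qed
  have rc: "continuous_on UNIV (\<lambda>a. rot \<theta> (Z a))"
    using continuous_on_compose2[OF rot_continuous, of UNIV "\<lambda>a. (\<theta>, Z a)"]
    by (simp add: continuous_on_Pair continuous_Z)
  have "(\<lambda>j. \<integral>a. h j (Z a) \<partial>\<mu>) \<longlonglongrightarrow> prob {a. rot \<theta> (Z a) \<in> C}"
    using lim[OF rc] by (simp add: integral_rot[OF hc])
  then show ?thesis using lim[OF continuous_Z] LIMSEQ_unique by blast
qed simp

text \<open>Averaging the rotation invariance over a box of angles.\<close>

lemma prob_compact_eq_0:
  assumes C: "compact C" and neg: "\<And>z. z \<in> torus \<Longrightarrow> negligible {\<theta>. rot \<theta> z \<in> C}"
  shows "prob {a. Z a \<in> C} = 0"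
proof -
  define box :: "(real ^ 'm) set" where "box = cbox 0 1"
  \<comment> \<open>Fubini in both orders. For fixed \<open>a\<close> the section is negligible by
    hypothesis; for fixed \<open>\<theta>\<close> in the box, which has volume 1, the section has
    the measure of the preimage of \<open>C\<close> under \<open>Z\<close>.\<close>
  define A where "A = {(\<theta>, a). rot \<theta> (Z a) \<in> C} \<inter> box \<times> UNIV"
  have cont: "continuous_on UNIV (\<lambda>(\<theta>, a). rot \<theta> (Z a))"
    using continuous_on_compose2[OF rot_continuous, of UNIV "\<lambda>(\<theta>, a). (\<theta>, Z a)"]
    by (simp add: case_prod_unfold continuous_on_Pair continuous_on_fst continuous_on_snd
        continuous_on_compose2[OF continuous_Z] continuous_on_id)
  have "closed ((\<lambda>(\<theta>, a). rot \<theta> (Z a)) -` C)"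
    by (rule closed_vimage[OF compact_imp_closed[OF C] cont])
  moreover have "(\<lambda>(\<theta>, a). rot \<theta> (Z a)) -` C = {(\<theta>, a). rot \<theta> (Z a) \<in> C}" by auto
  ultimately have "closed {(\<theta>, a). rot \<theta> (Z a) \<in> C}" by simp
  then have "closed A"
    unfolding A_def box_def by (intro closed_Int closed_Times closed_cbox closed_UNIV)
  then have "A \<in> sets (borel :: ((real ^ 'm) \<times> 'a) measure)" by simp
  moreover have "sets (lborel \<Otimes>\<^sub>M \<mu>) = sets (borel :: ((real ^ 'm) \<times> 'a) measure)"
    unfolding borel_prod[symmetric] by (rule sets_pair_measure_cong) (simp_all add: sets_mu)
  ultimately have A: "A \<in> sets (lborel \<Otimes>\<^sub>M \<mu>)" by simp
  note fubini = emeasure_pair_measure_alt[OF A]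
  interpret pair_sigma_finite lborel \<mu> ..
  have "emeasure (lborel \<Otimes>\<^sub>M \<mu>) A = (\<integral>\<^sup>+a. emeasure lborel ((\<lambda>\<theta>. (\<theta>, a)) -` A) \<partial>\<mu>)"
    by (rule emeasure_pair_measure_alt2[OF A])
  also have "\<dots> = (\<integral>\<^sup>+a. 0 \<partial>\<mu>)"
  proof (rule nn_integral_cong)
    fix a
    have "(\<lambda>\<theta>. (\<theta>, a)) -` A \<in> null_sets lebesgue"
      unfolding negligible_iff_null_sets[symmetric]
      by (rule negligible_subset[OF neg[OF Z_torus[of a]]]) (auto simp: A_def)
    moreover have "(\<lambda>\<theta>. (\<theta>, a)) -` A \<in> sets lborel"
      using sets_Pair2[OF A, of a] by simp
    ultimately show "emeasure lborel ((\<lambda>\<theta>. (\<theta>, a)) -` A) = 0"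
      using null_sets_completion_iff by (metis null_setsD1)
  qed
  finally have zero: "emeasure (lborel \<Otimes>\<^sub>M \<mu>) A = 0" by simp
  have "emeasure (lborel \<Otimes>\<^sub>M \<mu>) A = (\<integral>\<^sup>+\<theta>. emeasure \<mu> (Pair \<theta> -` A) \<partial>lborel)"
    by (rule fubini)
  also have "\<dots> = (\<integral>\<^sup>+\<theta>. ennreal (prob {a. Z a \<in> C}) * indicator box \<theta> \<partial>lborel)"
  proof (rule nn_integral_cong)
    fix \<theta>
    have "Pair \<theta> -` A = (if \<theta> \<in> box then {a. rot \<theta> (Z a) \<in> C} else {})" by (auto simp: A_def)
    then show "emeasure \<mu> (Pair \<theta> -` A) = ennreal (prob {a. Z a \<in> C}) * indicator box \<theta>"
      by (simp add: emeasure_eq_measure prob_rot_compact[OF C])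
  qed
  also have "\<dots> = ennreal (prob {a. Z a \<in> C}) * emeasure lborel box"
    by (subst nn_integral_cmult_indicator) (simp_all add: box_def)
  also have "emeasure lborel box = 1"
    unfolding box_def by (subst emeasure_lborel_cbox) (auto simp: Basis_vec_def inner_axis intro!: prod.neutral)
  finally show ?thesis using zero by simp
qed

text \<open>Injectivity off \<open>N\<close> says nothing yet about the points whose fibre meets
  \<open>N\<close>; their values lie in the image of \<open>N\<close> under \<open>Z\<close>, a set
  with no evident measurability. Pairs in a common fibre are therefore sorted by their distance
  under \<open>F\<close>: each \<open>R n\<close> is compact, so each \<open>C n\<close> is a
  compact part of the image of \<open>N\<close>, and together the sets \<open>C n\<close> contain
  every value with several preimages.\<close>

theorem unique_fibre_AE:
  fixes \<A> :: "('a, 'm) chart set" and F :: "'a \<Rightarrow> real ^ 'd"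
  assumes atlas: "smooth_atlas \<A>" and smooth: "\<And>i. smooth_fun \<A> (\<zeta> i)"
    and dens: "smooth_positive_density \<A> \<mu>" and F: "continuous_on UNIV F" "inj F"
  shows "AE a in \<mu>. \<forall>b. Z b = Z a \<longrightarrow> b = a"
proof -
  obtain N where N: "N \<in> null_sets \<mu>" "inj_on Z (- N)" using injective_off_null_set[OF F] by blast
  define R where "R n = {p. Z (fst p) = Z (snd p) \<and> 1 / real (Suc n) \<le> norm (F (fst p) - F (snd p))}" for n
  have "closed (R n)" for n
    unfolding R_def
    by (intro closed_Collect_conj closed_Collect_eq closed_Collect_le continuous_intros
        continuous_on_compose2[OF continuous_Z] continuous_on_compose2[OF F(1)]) auto
  then have Rc: "compact (R n)" for n
    using compact_Int_closed[OF compact_Times[OF compact_space compact_space], of "R n"] by simp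
  define C where "C n = Z ` fst ` R n" for n
  have C: "compact (C n)" for n
    unfolding C_def
    by (intro compact_continuous_image Rc continuous_on_subset[OF continuous_Z] continuous_intros) auto
  have CN: "C n \<subseteq> Z ` N" for n
  proof
    fix z assume "z \<in> C n"
    then obtain a b where ab: "z = Z a" "Z a = Z b" "1 / real (Suc n) \<le> norm (F a - F b)"
      by (auto simp: C_def R_def)
    have "a \<noteq> b" using ab(3) by auto
    then have "a \<in> N \<or> b \<in> N" using N(2) ab(2) by (auto simp: inj_on_def)
    then show "z \<in> Z ` N" using ab(1,2) by (metis imageI)
  qed
  have "prob {a. Z a \<in> C n} = 0" for n
  proof (rule prob_compact_eq_0[OF C])
    fix z :: "complex ^ 'm" assume "z \<in> torus"
    from rotations_into_null_image_negligible[OF atlas smooth dens N(1) this]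
    show "negligible {\<theta>. rot \<theta> z \<in> C n}" by (rule negligible_subset) (use CN in auto)
  qed
  moreover have "{a. Z a \<in> C n} \<in> events" for n
    using measurable_sets[OF measurable_continuous[OF continuous_Z], of "C n"] compact_imp_closed[OF C[of n]]
    by (simp add: space_mu vimage_def)
  ultimately have "AE a in \<mu>. a \<notin> {a. Z a \<in> C n}" for n by (simp only: prob_eq_0)
  then have "AE a in \<mu>. \<forall>n. Z a \<notin> C n" by (simp add: AE_all_countable)
  then show ?thesis
  proof eventually_elim
    case (elim a)
    show ?case
    proof (intro allI impI)
      fix b assume b: "Z b = Z a"
      have "norm (F a - F b) < 1 / real (Suc n)" for n
      proof (rule ccontr)
        assume "\<not> norm (F a - F b) < 1 / real (Suc n)"
        then have "(a, b) \<in> R n" using b by (simp add: R_def)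
        then have "Z a \<in> C n" unfolding C_def by force
        then show False using elim by blast
      qed
      then have "norm (F a - F b) = 0"
        by (metis nat_approx_posE norm_ge_zero not_less_iff_gr_or_eq order_less_le_trans order.strict_iff_order less_asym)
      then show "b = a" using F(2) by (simp add: inj_eq)
    qed
  qed
qed

end

section \<open>Unique ergodicity\<close>

text \<open>A uniform Cauchy argument, for use where the limit has no explicit formula.\<close>

lemma uniformly_convergent_on_approx:
  fixes f :: "nat \<Rightarrow> 'x \<Rightarrow> 'b::banach"
  assumes "\<And>\<delta>. \<delta> > 0 \<Longrightarrow> \<exists>h. uniformly_convergent_on X h \<and>
    (\<forall>\<^sub>F s in sequentially. \<forall>x\<in>X. norm (f s x - h s x) \<le> \<delta>)"
  shows "uniformly_convergent_on X f"
proof (rule Cauchy_uniformly_convergent, rule uniformly_Cauchy_onI)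
  fix \<delta> :: real assume "\<delta> > 0"
  then obtain h where h: "uniformly_convergent_on X h"
    and close: "\<forall>\<^sub>F s in sequentially. \<forall>x\<in>X. norm (f s x - h s x) \<le> \<delta> / 4"
    using assms[of "\<delta> / 4"] by auto
  have "\<delta> / 4 > 0" using \<open>\<delta> > 0\<close> by simp
  with uniformly_convergent_Cauchy[OF h]
  have "\<exists>M. \<forall>x\<in>X. \<forall>m\<ge>M. \<forall>n\<ge>M. dist (h m x) (h n x) < \<delta> / 4"
    unfolding uniformly_Cauchy_on_def by blast
  then obtain M where M: "\<And>x m n. x \<in> X \<Longrightarrow> m \<ge> M \<Longrightarrow> n \<ge> M \<Longrightarrow> dist (h m x) (h n x) < \<delta> / 4"
    by blast
  obtain M' where M': "\<And>s x. s \<ge> M' \<Longrightarrow> x \<in> X \<Longrightarrow> norm (f s x - h s x) \<le> \<delta> / 4"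
    using close unfolding eventually_sequentially by blast
  show "\<exists>M. \<forall>x\<in>X. \<forall>m\<ge>M. \<forall>n\<ge>M. dist (f m x) (f n x) < \<delta>"
  proof (intro exI[of _ "max M M'"] ballI allI impI)
    fix x m n assume x: "x \<in> X" and mn: "max M M' \<le> m" "max M M' \<le> n"
    have "norm (f m x - h m x) \<le> \<delta> / 4" "norm (f n x - h n x) \<le> \<delta> / 4" "norm (h m x - h n x) < \<delta> / 4"
      using M[OF x, of m n] M'[OF _ x] mn by (auto simp: dist_norm)
    moreover have "norm (f m x - f n x) \<le> norm (f m x - h m x) + norm (h m x - h n x) + norm (f n x - h n x)"
    proof -
      show ?thesis
        using norm_triangle_ineq4[of "(f m x - h m x) + (h m x - h n x)" "f n x - h n x"]
          norm_triangle_ineq[of "f m x - h m x" "h m x - h n x"] by simp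
    qed
    ultimately show "dist (f m x) (f n x) < \<delta>" using \<open>\<delta> > 0\<close> by (simp add: dist_norm)
  qed
qed

lemma uniformly_convergent_on_bounded_mult:
  fixes b :: "'x \<Rightarrow> 'b::{banach, real_normed_algebra}"
  assumes b: "\<And>x. x \<in> X \<Longrightarrow> norm (b x) \<le> B" and g: "uniformly_convergent_on X g"
  shows "uniformly_convergent_on X (\<lambda>s x. b x * g s x)"
proof -
  obtain l where l: "uniform_limit X g l sequentially"
    using g unfolding uniformly_convergent_on_def by blast
  have "uniform_limit X (\<lambda>s x. b x * g s x) (\<lambda>x. b x * l x) sequentially"
    unfolding uniform_limit_iff
  proof (intro allI impI)
    fix \<delta> :: real assume "\<delta> > 0"
    then have "\<delta> / (\<bar>B\<bar> + 1) > 0" by simp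
    with l have "\<forall>\<^sub>F s in sequentially. \<forall>x\<in>X. dist (g s x) (l x) < \<delta> / (\<bar>B\<bar> + 1)"
      unfolding uniform_limit_iff by blast
    then show "\<forall>\<^sub>F s in sequentially. \<forall>x\<in>X. dist (b x * g s x) (b x * l x) < \<delta>"
    proof eventually_elim
      case (elim s)
      show ?case
      proof
        fix x assume x: "x \<in> X"
        have "norm (b x * (g s x - l x)) \<le> norm (b x) * norm (g s x - l x)" by (rule norm_mult_ineq)
        also have "\<dots> \<le> (\<bar>B\<bar> + 1) * norm (g s x - l x)"
          using b[OF x] by (intro mult_right_mono) auto
        also have "\<dots> < \<delta>" using elim x by (auto simp: dist_norm field_simps)
        finally show "dist (b x * g s x) (b x * l x) < \<delta>" by (simp add: dist_norm right_diff_distrib)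
      qed
    qed
  qed
  then show ?thesis by (rule uniformly_convergentI)
qed

lemma uniformly_convergent_on_finite_sum:
  fixes h :: "'q \<Rightarrow> nat \<Rightarrow> 'x \<Rightarrow> 'b::real_normed_algebra"
  shows "finite K \<Longrightarrow> (\<And>q. q \<in> K \<Longrightarrow> uniformly_convergent_on X (h q)) \<Longrightarrow>
    uniformly_convergent_on X (\<lambda>s x. \<Sum>q\<in>K. h q s x)"
  by (induction K rule: finite_induct)
    (auto intro: uniformly_convergent_add)

locale kronecker_unique = kronecker_system \<mu> \<Phi> T \<Omega> \<zeta>
  for \<mu> :: "'a::{t2_space, second_countable_topology} measure" and \<Phi> T
    and \<Omega> :: "'m::finite \<Rightarrow> real" and \<zeta> +
  assumes unique_fibre: "AE a in \<mu>. \<forall>b. Z b = Z a \<longrightarrow> b = a"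
begin

text \<open>The Lipschitz regularisations of \<open>u\<close>, as functions of \<open>Z a\<close>, decrease to the maximum of \<open>u\<close>
  over the fibre of \<open>a\<close>, which is \<open>u a\<close> almost surely.\<close>

lemma trig_majorant:
  fixes u :: "'a \<Rightarrow> real"
  assumes u: "continuous_on UNIV u" and \<delta>: "\<delta> > 0"
  obtains r where "real_polynomial_function r" "\<And>a. u a \<le> r (Z a)"
    "(\<integral>a. r (Z a) \<partial>\<mu>) \<le> (\<integral>a. u a \<partial>\<mu>) + \<delta>"
proof -
  obtain B where B: "B > 0" "\<And>a. \<bar>u a\<bar> \<le> B" using continuous_bounded[OF u] by auto
  define Q where "Q n z = (SUP b. u b - real n * dist z (Z b))" for n z
  have bdd: "bdd_above (range (\<lambda>b. u b - real n * dist z (Z b)))" for n z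
  proof (rule bdd_aboveI2)
    fix b
    have "0 \<le> real n * dist z (Z b)" by simp
    then show "u b - real n * dist z (Z b) \<le> B" using B(2)[of b] by linarith
  qed
  have Q_ge: "u b - real n * dist z (Z b) \<le> Q n z" for n z b
    unfolding Q_def by (rule cSUP_upper[OF _ bdd]) simp
  have Q_le: "Q n z \<le> c" if "\<And>b. u b - real n * dist z (Z b) \<le> c" for n z c
    unfolding Q_def by (rule cSUP_least) (use that in auto)
  have Q_B: "Q n z \<le> B" for n z
  proof (rule Q_le)
    fix b
    have "0 \<le> real n * dist z (Z b)" by simp
    then show "u b - real n * dist z (Z b) \<le> B" using B(2)[of b] by linarith
  qed
  have Q_u: "u a \<le> Q n (Z a)" for n a using Q_ge[of a n "Z a"] by simp
  have lip: "Q n z \<le> Q n w + real n * dist z w" for n z w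
  proof (rule Q_le)
    fix b
    have "real n * dist w (Z b) \<le> real n * (dist z w + dist z (Z b))"
      by (intro mult_left_mono) (use dist_triangle[of w "Z b" z] in \<open>simp_all add: dist_commute\<close>)
    then show "u b - real n * dist z (Z b) \<le> Q n w + real n * dist z w"
      using Q_ge[of b n w] by (simp add: algebra_simps)
  qed
  have "(real n)-lipschitz_on UNIV (Q n)" for n
  proof (rule lipschitz_onI)
    fix x y :: "complex ^ 'm"
    show "dist (Q n x) (Q n y) \<le> real n * dist x y"
      using lip[of n x y] lip[of n y x] by (simp add: dist_real_def dist_commute)
  qed simp
  then have Q_cont: "continuous_on A (Q n)" for A n
    using lipschitz_on_continuous_on lipschitz_on_subset by blast
  have QZ_cont: "continuous_on UNIV (\<lambda>a. Q n (Z a))" for n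
    by (rule continuous_on_compose2[OF Q_cont[of UNIV] continuous_Z]) simp
  have lim: "(\<lambda>n. Q n (Z a)) \<longlonglongrightarrow> u a" if a: "\<forall>b. Z b = Z a \<longrightarrow> b = a" for a
  proof (rule LIMSEQ_I)
    fix \<eta> :: real assume \<eta>: "\<eta> > 0"
    \<comment> \<open>This set is compact and disjoint from the fibre of \<open>Z a\<close>, which
      is \<open>{a}\<close>; so its image keeps a positive distance \<open>c\<close> from
      \<open>Z a\<close>. For large \<open>n\<close> the penalty on it is at least
      \<open>2 * B\<close>, which outweighs any gain in \<open>u\<close>.\<close>
    let ?K = "{b. u b \<ge> u a + \<eta> / 2}"
    have "closed ?K" by (intro closed_Collect_le continuous_on_const u)
    then have K: "compact ?K" using compact_Int_closed[OF compact_space] by simp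
    have "\<exists>c>0. \<forall>b\<in>?K. dist (Z a) (Z b) \<ge> c"
    proof (cases "?K = {}")
      case False
      have "continuous_on ?K (\<lambda>b. dist (Z a) (Z b))"
        by (intro continuous_on_dist continuous_on_const continuous_on_subset[OF continuous_Z]) simp
      from continuous_attains_inf[OF K False this]
      obtain b0 where b0: "b0 \<in> ?K" "\<forall>b\<in>?K. dist (Z a) (Z b0) \<le> dist (Z a) (Z b)" by blast
      have "b0 \<noteq> a" using b0(1) \<eta> by auto
      then have "dist (Z a) (Z b0) > 0" using a by auto
      then show ?thesis using b0 by blast
    qed (auto intro: exI[of _ 1])
    then obtain c where c: "c > 0" "\<And>b. u b \<ge> u a + \<eta> / 2 \<Longrightarrow> dist (Z a) (Z b) \<ge> c" by auto
    obtain n0 where n0: "2 * B / c \<le> real n0" using real_arch_simple by blast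
    show "\<exists>n0. \<forall>n\<ge>n0. norm (Q n (Z a) - u a) < \<eta>"
    proof (intro exI allI impI)
      fix n assume n: "n0 \<le> n"
      have "Q n (Z a) \<le> u a + \<eta> / 2"
      proof (rule Q_le)
        fix b
        show "u b - real n * dist (Z a) (Z b) \<le> u a + \<eta> / 2"
        proof (cases "u b \<ge> u a + \<eta> / 2")
          case True
          have "2 * B / c * c \<le> real n * dist (Z a) (Z b)"
            using n n0 c B True by (intro mult_mono) auto
          then have "2 * B \<le> real n * dist (Z a) (Z b)" using c by simp
          then show ?thesis using B(2)[of a] B(2)[of b] \<eta> by linarith
        next
          case False
          moreover have "0 \<le> real n * dist (Z a) (Z b)" by simp
          ultimately show ?thesis by linarith
        qed
      qed
      then show "norm (Q n (Z a) - u a) < \<eta>" using Q_u[of a n] \<eta> by simp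
    qed
  qed
  have "(\<lambda>n. \<integral>a. Q n (Z a) \<partial>\<mu>) \<longlonglongrightarrow> (\<integral>a. u a \<partial>\<mu>)"
  proof (rule integral_dominated_convergence[where w = "\<lambda>_. B"])
    show "AE a in \<mu>. (\<lambda>n. Q n (Z a)) \<longlonglongrightarrow> u a"
      using unique_fibre by eventually_elim (rule lim)
    show "AE a in \<mu>. norm (Q n (Z a)) \<le> B" for n
    proof (rule AE_I2)
      fix a
      show "norm (Q n (Z a)) \<le> B" using Q_B[of n "Z a"] Q_u[of a n] B(2)[of a] by auto
    qed
  qed (auto intro: measurable_continuous u QZ_cont)
  then have "\<forall>\<^sub>F n in sequentially. (\<integral>a. Q n (Z a) \<partial>\<mu>) < (\<integral>a. u a \<partial>\<mu>) + \<delta> / 3"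
    by (rule order_tendstoD) (use \<delta> in simp)
  then obtain n where n: "(\<integral>a. Q n (Z a) \<partial>\<mu>) < (\<integral>a. u a \<partial>\<mu>) + \<delta> / 3"
    by (auto simp: eventually_sequentially)
  obtain r where r: "real_polynomial_function r" "\<And>z. z \<in> range Z \<Longrightarrow> \<bar>Q n z - r z\<bar> < \<delta> / 3"
    using Stone_Weierstrass_real_polynomial_function[OF compact_continuous_image[OF continuous_Z compact_space] Q_cont, of "\<delta> / 3"] \<delta>
    by auto
  have rQ: "\<bar>Q n (Z a) - r (Z a)\<bar> < \<delta> / 3" for a by (rule r(2)) simp
  show ?thesis
  \<comment> \<open>The shift by \<delta>/3 turns the approximation of \<open>Q n\<close> into a
    majorant. The integral pays \<delta>/3 three times: for the shift, for the approximation, and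
    for passing from \<open>u\<close> to \<open>Q n\<close>.\<close>
  proof (rule that[of "\<lambda>z. r z + \<delta> / 3"])
    show "real_polynomial_function (\<lambda>z. r z + \<delta> / 3)" using r(1) by auto
    show "u a \<le> r (Z a) + \<delta> / 3" for a using Q_u[of a n] rQ[of a] by linarith
    have "(\<integral>a. r (Z a) + \<delta> / 3 \<partial>\<mu>) \<le> (\<integral>a. Q n (Z a) + 2 * \<delta> / 3 \<partial>\<mu>)"
    proof (rule integral_mono)
      show "r (Z a) + \<delta> / 3 \<le> Q n (Z a) + 2 * \<delta> / 3" for a using rQ[of a] by linarith
    qed (intro integrable_continuous continuous_on_add continuous_poly_Z r QZ_cont continuous_on_const)+
    also have "\<dots> = (\<integral>a. Q n (Z a) \<partial>\<mu>) + 2 * \<delta> / 3"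
      using integrable_continuous[OF QZ_cont] by (simp add: prob_space)
    finally show "(\<integral>a. r (Z a) + \<delta> / 3 \<partial>\<mu>) \<le> (\<integral>a. u a \<partial>\<mu>) + \<delta>" using n by simp
  qed
qed

lemma avg_mono: "(\<And>a. u a \<le> v a) \<Longrightarrow> avg n u a \<le> avg n v a" for u v :: "'a \<Rightarrow> real"
  by (simp add: avg_def divide_right_mono sum_mono)

lemma avg_uminus: "avg n (\<lambda>a. - u a) a = - avg n u a"
  by (simp add: avg_def sum_negf)

lemma avg_diff: "avg n (\<lambda>a. u a - v a) a = avg n u a - avg n v a"
  by (simp add: avg_def sum_subtractf scaleR_diff_right)

lemma norm_avg_le:
  fixes u :: "'a \<Rightarrow> 'c::real_normed_vector"
  assumes "\<And>a. norm (u a) \<le> B" "B \<ge> 0" shows "norm (avg n u a) \<le> B"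
proof -
  have "norm (\<Sum>j<n. u (\<Phi> (real j * T) a)) \<le> real n * B"
    using sum_norm_le[of "{..<n}" "\<lambda>j. u (\<Phi> (real j * T) a)" "\<lambda>_. B"] assms by simp
  then have "norm (\<Sum>j<n. u (\<Phi> (real j * T) a)) / real n \<le> real n * B / real n"
    by (rule divide_right_mono) simp
  moreover have "norm (avg n u a) = norm (\<Sum>j<n. u (\<Phi> (real j * T) a)) / real n"
    by (simp add: avg_def)
  ultimately have "norm (avg n u a) \<le> real n * B / real n" by simp
  also have "\<dots> \<le> B" using assms(2) by simp
  finally show ?thesis .
qed

text \<open>A majorant yields a one-sided bound that is uniform in the starting point. Convergence
  follows by applying it to \<open>u\<close> and \<open>- u\<close>; for squared approximation
  errors the one-sided form is used as such.\<close>

lemma eventually_avg_le: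
  fixes u :: "'a \<Rightarrow> real"
  assumes u: "continuous_on UNIV u" and \<delta>: "\<delta> > 0"
  shows "\<forall>\<^sub>F n in sequentially. \<forall>a. avg n u a \<le> (\<integral>a. u a \<partial>\<mu>) + \<delta>"
proof -
  obtain r where r: "real_polynomial_function r" "\<And>a. u a \<le> r (Z a)"
    "(\<integral>a. r (Z a) \<partial>\<mu>) \<le> (\<integral>a. u a \<partial>\<mu>) + \<delta> / 2"
    using trig_majorant[OF u, of "\<delta> / 2"] \<delta> by auto
  have "\<forall>\<^sub>F n in sequentially. \<forall>a\<in>UNIV. dist (avg n (\<lambda>a. r (Z a)) a) (\<integral>a. r (Z a) \<partial>\<mu>) < \<delta> / 2"
    by (rule uniform_limitD[OF uniformly_ergodic_polynomial[OF r(1), unfolded uniformly_ergodic_def]])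
      (use \<delta> in simp)
  then show ?thesis
  proof eventually_elim
    case (elim n)
    show ?case
    proof
      fix a
      have "avg n u a \<le> avg n (\<lambda>a. r (Z a)) a" by (rule avg_mono) (rule r)
      also have "\<dots> \<le> (\<integral>a. r (Z a) \<partial>\<mu>) + \<delta> / 2"
        using elim[rule_format, OF UNIV_I, of a] unfolding dist_real_def by linarith
      finally show "avg n u a \<le> (\<integral>a. u a \<partial>\<mu>) + \<delta>" using r(3) by simp
    qed
  qed
qed

theorem uniformly_ergodic_real:
  fixes u :: "'a \<Rightarrow> real"
  assumes u: "continuous_on UNIV u" shows "uniformly_ergodic u"
  unfolding uniformly_ergodic_def uniform_limit_iff
proof (intro allI impI)
  fix \<delta> :: real assume \<delta>: "\<delta> > 0"
  have "\<forall>\<^sub>F n in sequentially. \<forall>a. avg n u a \<le> (\<integral>a. u a \<partial>\<mu>) + \<delta> / 2"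
    "\<forall>\<^sub>F n in sequentially. \<forall>a. avg n (\<lambda>a. - u a) a \<le> (\<integral>a. - u a \<partial>\<mu>) + \<delta> / 2"
    by (intro eventually_avg_le continuous_on_minus u half_gt_zero \<delta>)+
  then show "\<forall>\<^sub>F n in sequentially. \<forall>a\<in>UNIV. dist (avg n u a) (\<integral>a. u a \<partial>\<mu>) < \<delta>"
  proof eventually_elim
    case (elim n)
    show ?case
    proof
      fix a
      show "dist (avg n u a) (\<integral>a. u a \<partial>\<mu>) < \<delta>"
        using elim(1)[rule_format, of a] elim(2)[rule_format, of a] \<delta> by (simp add: avg_uminus dist_real_def)
    qed
  qed
qed

theorem uniformly_ergodic_complex:
  fixes u :: "'a \<Rightarrow> complex"
  assumes u: "continuous_on UNIV u" shows "uniformly_ergodic u"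
proof -
  have Re: "continuous_on UNIV (\<lambda>a. Re (u a))" and Im: "continuous_on UNIV (\<lambda>a. Im (u a))"
    by (intro continuous_intros u)+
  have "uniformly_ergodic (\<lambda>a. of_real (Re (u a)) + \<i> * of_real (Im (u a)))"
    by (intro uniformly_ergodic_add uniformly_ergodic_cmult integrable_continuous)
      (auto simp: uniformly_ergodic_of_real intro!: uniformly_ergodic_real continuous_intros Re Im)
  then show ?thesis by (simp add: complex_eq[symmetric])
qed

section \<open>Continuous families over a compact parameter space\<close>

lemma family_equicontinuous:
  fixes v :: "'a \<times> 'a \<Rightarrow> 'c::metric_space"
  assumes "continuous_on UNIV v" "\<delta> > 0"
  obtains X where "a0 \<in> X" "open X" "\<And>a b. a \<in> X \<Longrightarrow> dist (v (a, b)) (v (a0, b)) \<le> \<delta>"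
proof -
  have c: "continuous_on (UNIV \<times> UNIV) v" using assms(1) by simp
  obtain X where "a0 \<in> X" "open X" "\<forall>x\<in>X \<inter> UNIV. \<forall>t\<in>UNIV. dist (v (x, t)) (v (a0, t)) \<le> \<delta>"
    by (rule continuous_on_prod_compactE[OF c compact_space UNIV_I assms(2)])
  then show ?thesis using that by simp
qed

lemma continuous_on_section: "continuous_on UNIV v \<Longrightarrow> continuous_on UNIV (\<lambda>b. v (a, b))"
  by (rule continuous_on_compose2[of UNIV v]) (auto intro!: continuous_intros)

lemma norm_integral_diff_le:
  fixes u v :: "'a \<Rightarrow> 'c::{banach, second_countable_topology}"
  assumes "integrable \<mu> u" "integrable \<mu> v" "\<And>b. norm (u b - v b) \<le> \<delta>"
  shows "norm ((\<integral>b. u b \<partial>\<mu>) - (\<integral>b. v b \<partial>\<mu>)) \<le> \<delta>"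
proof -
  have "norm (\<integral>b. u b - v b \<partial>\<mu>) \<le> (\<integral>b. norm (u b - v b) \<partial>\<mu>)" by (rule integral_norm_bound)
  also have "\<dots> \<le> (\<integral>b. \<delta> \<partial>\<mu>)" by (rule integral_mono) (use assms in auto)
  finally show ?thesis using assms by (simp add: prob_space)
qed

lemma continuous_parameter_integral:
  fixes v :: "'a \<times> 'a \<Rightarrow> 'c::{banach, second_countable_topology}"
  assumes v: "continuous_on UNIV v"
  shows "continuous_on UNIV (\<lambda>a. \<integral>b. v (a, b) \<partial>\<mu>)"
  unfolding continuous_on_eq_continuous_at[OF open_UNIV] continuous_at tendsto_iff
proof (intro ballI allI impI)
  fix a0 and \<delta> :: real assume \<delta>: "\<delta> > 0"
  obtain X where X: "a0 \<in> X" "open X" "\<And>a b. a \<in> X \<Longrightarrow> dist (v (a, b)) (v (a0, b)) \<le> \<delta> / 2"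
    using family_equicontinuous[OF v, of "\<delta> / 2"] \<delta> by auto
  have "\<forall>\<^sub>F a in at a0. a \<in> X" using X by (auto simp: eventually_at_topological)
  then show "\<forall>\<^sub>F a in at a0. dist (\<integral>b. v (a, b) \<partial>\<mu>) (\<integral>b. v (a0, b) \<partial>\<mu>) < \<delta>"
  proof eventually_elim
    case (elim a)
    have "norm ((\<integral>b. v (a, b) \<partial>\<mu>) - (\<integral>b. v (a0, b) \<partial>\<mu>)) \<le> \<delta> / 2"
      by (intro norm_integral_diff_le integrable_continuous continuous_on_section v)
        (use X(3)[OF elim] in \<open>simp add: dist_norm\<close>)
    then show ?case using \<delta> by (simp add: dist_norm)
  qed
qed

text \<open>Along a row the integrand depends on the row's own state, and the orbit segment starts
  at a point depending on \<open>s\<close>; hence the uniformity in both \<open>a\<close> and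
  \<open>b\<close>. By compactness finitely many parameters \<open>c\<close> represent all
  \<open>a\<close>.\<close>

theorem uniformly_ergodic_family:
  fixes v :: "'a \<times> 'a \<Rightarrow> complex"
  assumes v: "continuous_on UNIV v" and \<delta>: "\<delta> > 0"
  shows "\<forall>\<^sub>F n in sequentially. \<forall>a b. norm (avg n (\<lambda>b. v (a, b)) b - (\<integral>b. v (a, b) \<partial>\<mu>)) \<le> \<delta>"
proof -
  have "\<exists>X. a0 \<in> X \<and> open X \<and> (\<forall>a\<in>X. \<forall>b. dist (v (a, b)) (v (a0, b)) \<le> \<delta> / 3)" for a0
    using family_equicontinuous[OF v, of "\<delta> / 3" a0] \<delta> by (metis zero_less_divide_iff zero_less_numeral)
  then obtain X where X: "\<And>a0. a0 \<in> X a0" "\<And>a0. open (X a0)"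
    "\<And>a0 a b. a \<in> X a0 \<Longrightarrow> dist (v (a, b)) (v (a0, b)) \<le> \<delta> / 3" by metis
  have cover: "UNIV \<subseteq> (\<Union>c\<in>UNIV. X c)" using X(1) by blast
  obtain C where "C \<subseteq> UNIV" and C: "finite C" "UNIV \<subseteq> (\<Union>c\<in>C. X c)"
    by (rule compactE_image[OF compact_space X(2) cover])
  have "\<forall>\<^sub>F n in sequentially. \<forall>b\<in>UNIV. dist (avg n (\<lambda>b. v (c, b)) b) (\<integral>b. v (c, b) \<partial>\<mu>) < \<delta> / 3" for c
    by (rule uniform_limitD[OF uniformly_ergodic_complex[OF continuous_on_section[OF v],
          unfolded uniformly_ergodic_def]]) (use \<delta> in simp)
  then have "\<forall>\<^sub>F n in sequentially. \<forall>c\<in>C. \<forall>b\<in>UNIV. dist (avg n (\<lambda>b. v (c, b)) b) (\<integral>b. v (c, b) \<partial>\<mu>) < \<delta> / 3"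
    by (intro eventually_ball_finite C(1)) simp
  then show ?thesis
  proof eventually_elim
    case (elim n)
    show ?case
    proof (intro allI)
      fix a b
      obtain c where c: "c \<in> C" "a \<in> X c" using C by auto
      have close: "norm (v (a, x) - v (c, x)) \<le> \<delta> / 3" for x
        using X(3)[OF c(2), of x] by (simp add: dist_norm)
      have "norm (avg n (\<lambda>b. v (a, b)) b - avg n (\<lambda>b. v (c, b)) b) \<le> \<delta> / 3"
        unfolding avg_diff[symmetric] by (rule norm_avg_le) (use close \<delta> in auto)
      moreover have "norm ((\<integral>b. v (a, b) \<partial>\<mu>) - (\<integral>b. v (c, b) \<partial>\<mu>)) \<le> \<delta> / 3"
        by (intro norm_integral_diff_le integrable_continuous continuous_on_section v close)
      moreover have "norm (avg n (\<lambda>b. v (c, b)) b - (\<integral>b. v (c, b) \<partial>\<mu>)) \<le> \<delta> / 3"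
        using elim c(1) by (auto simp: dist_norm intro: less_imp_le)
      ultimately show "norm (avg n (\<lambda>b. v (a, b)) b - (\<integral>b. v (a, b) \<partial>\<mu>)) \<le> \<delta>"
        using norm_triangle_ineq4[of "avg n (\<lambda>b. v (a, b)) b - avg n (\<lambda>b. v (c, b)) b + (avg n (\<lambda>b. v (c, b)) b - (\<integral>b. v (c, b) \<partial>\<mu>))"
            "(\<integral>b. v (a, b) \<partial>\<mu>) - (\<integral>b. v (c, b) \<partial>\<mu>)"]
          norm_triangle_ineq[of "avg n (\<lambda>b. v (a, b)) b - avg n (\<lambda>b. v (c, b)) b" "avg n (\<lambda>b. v (c, b)) b - (\<integral>b. v (c, b) \<partial>\<mu>)"]
        by simp
    qed
  qed
qed

section \<open>Correlations along backward orbits\<close>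

definition bavg :: "nat \<Rightarrow> ('a \<Rightarrow> 'b::real_vector) \<Rightarrow> 'a \<Rightarrow> 'b" where
  "bavg n u a = (1 / real n) *\<^sub>R (\<Sum>k<n. u (\<Phi> (- (real k * T)) a))"

text \<open>A backward average is a forward average started at the last point visited. As the limits
  are uniform in the starting point, they carry over to delay windows.\<close>

lemma bavg_eq_avg: "bavg n u a = avg n u (\<Phi> (- (real (n - 1) * T)) a)"
proof -
  have "(\<Sum>j<n. u (\<Phi> (real j * T) (\<Phi> (- (real (n - 1) * T)) a)))
      = (\<Sum>i<n. u (\<Phi> (real (n - Suc i) * T) (\<Phi> (- (real (n - 1) * T)) a)))"
    by (rule sum.nat_diff_reindex[symmetric])
  also have "\<dots> = (\<Sum>i<n. u (\<Phi> (- (real i * T)) a))"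
  proof (rule sum.cong)
    fix i assume "i \<in> {..<n}"
    then have "real (n - Suc i) * T + - (real (n - 1) * T) = - (real i * T)"
      by (simp add: of_nat_diff algebra_simps)
    then show "u (\<Phi> (real (n - Suc i) * T) (\<Phi> (- (real (n - 1) * T)) a)) = u (\<Phi> (- (real i * T)) a)"
      by (simp only: flow_add[symmetric])
  qed simp
  finally show ?thesis by (simp add: avg_def bavg_def)
qed

text \<open>Replacing \<open>F\<close> by a trigonometric polynomial that is close in \<open>L\<^sup>2\<close> costs little by the
  Cauchy--Schwarz inequality, since the time averages of the squared difference are uniformly small.\<close>

lemma twisted_average_approx:
  fixes F :: "'a \<Rightarrow> real"
  assumes F: "continuous_on UNIV F" and \<delta>: "\<delta> > 0"
  obtains K c where "finite K" "\<forall>\<^sub>F s in sequentially. \<forall>a w.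
    norm ((1 / real s) *\<^sub>R (\<Sum>k<s. of_real (F (\<Phi> (- (real k * T)) a)) * w k)
        - (\<Sum>q\<in>K. c q * e q a * ((1 / real s) *\<^sub>R (\<Sum>k<s. cnj (lam q) ^ k * w k))))
      \<le> \<delta> * sqrt ((1 / real s) * (\<Sum>k<s. (norm (w k))\<^sup>2))"
proof -
  have cF: "continuous_on UNIV (\<lambda>a. complex_of_real (F a))" by (intro continuous_intros F)
  have FL2: "(\<lambda>a. complex_of_real (F a)) \<in> L2 \<mu>"
    unfolding L2_def by (auto intro!: measurable_continuous integrable_continuous continuous_intros F)
  obtain K c where K: "finite K"
    and close: "(\<integral>a. (norm (complex_of_real (F a) - (\<Sum>k\<in>K. c k * e k a)))\<^sup>2 \<partial>\<mu>) < \<delta>\<^sup>2"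
    by (rule L2_approx[OF FL2, of "\<delta>\<^sup>2"]) (use \<delta> in auto)
  define p where "p a = (\<Sum>k\<in>K. c k * e k a)" for a
  \<comment> \<open>The integral of \<open>u\<close> is below \<open>\<delta>\<^sup>2\<close>, and
    the gap is the tolerance granted to its time averages. The resulting bound is uniform in
    \<open>a\<close> and does not involve the weights \<open>w\<close>, so noise may be inserted for
    them.\<close>
  define u where "u a = (norm (complex_of_real (F a) - p a))\<^sup>2" for a
  have u: "continuous_on UNIV u"
    unfolding u_def p_def by (intro continuous_intros continuous_trig F)
  have "\<forall>\<^sub>F n in sequentially. \<forall>a. avg n u a \<le> (\<integral>a. u a \<partial>\<mu>) + (\<delta>\<^sup>2 - (\<integral>a. u a \<partial>\<mu>))"
    by (rule eventually_avg_le[OF u]) (use close in \<open>simp add: u_def p_def\<close>)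
  then have "\<forall>\<^sub>F s in sequentially. \<forall>a w.
    norm ((1 / real s) *\<^sub>R (\<Sum>k<s. of_real (F (\<Phi> (- (real k * T)) a)) * w k)
        - (\<Sum>q\<in>K. c q * e q a * ((1 / real s) *\<^sub>R (\<Sum>k<s. cnj (lam q) ^ k * w k))))
      \<le> \<delta> * sqrt ((1 / real s) * (\<Sum>k<s. (norm (w k))\<^sup>2))"
  proof eventually_elim
    case (elim s)
    show ?case
    proof (intro allI)
      fix a :: 'a and w :: "nat \<Rightarrow> complex"
      let ?x = "\<lambda>k. \<Phi> (- (real k * T)) a"
      \<comment> \<open>Along the backward orbit each character is a geometric sequence times its
        value at \<open>a\<close>, which separates the point from the weights.\<close>
      have "(\<Sum>q\<in>K. c q * e q a * (\<Sum>k<s. cnj (lam q) ^ k * w k)) = (\<Sum>k<s. p (?x k) * w k)"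
        unfolding p_def e_orbit_back sum_distrib_left sum_distrib_right
        by (subst sum.swap) (simp add: mult_ac)
      moreover have "(\<Sum>q\<in>K. c q * e q a * ((1 / real s) *\<^sub>R (\<Sum>k<s. cnj (lam q) ^ k * w k)))
          = (1 / real s) *\<^sub>R (\<Sum>q\<in>K. c q * e q a * (\<Sum>k<s. cnj (lam q) ^ k * w k))"
        unfolding mult_scaleR_right by (rule scaleR_sum_right[symmetric])
      ultimately have eq: "(1 / real s) *\<^sub>R (\<Sum>k<s. of_real (F (?x k)) * w k)
          - (\<Sum>q\<in>K. c q * e q a * ((1 / real s) *\<^sub>R (\<Sum>k<s. cnj (lam q) ^ k * w k)))
          = (1 / real s) *\<^sub>R (\<Sum>k<s. (of_real (F (?x k)) - p (?x k)) * w k)"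
        by (simp only: sum_subtractf left_diff_distrib scaleR_diff_right)
      have avgu: "(1 / real s) * (\<Sum>k<s. u (?x k)) \<le> \<delta>\<^sup>2"
        using elim bavg_eq_avg[of s u a] by (simp add: bavg_def)
      have "norm (\<Sum>k<s. (of_real (F (?x k)) - p (?x k)) * w k)
          \<le> (\<Sum>k<s. \<bar>norm (of_real (F (?x k)) - p (?x k))\<bar> * \<bar>norm (w k)\<bar>)"
        by (rule order_trans[OF norm_sum]) (simp add: norm_mult)
      also have "\<dots> \<le> sqrt (\<Sum>k<s. u (?x k)) * sqrt (\<Sum>k<s. (norm (w k))\<^sup>2)"
        using L2_set_mult_ineq[of "\<lambda>k. norm (of_real (F (?x k)) - p (?x k))" "\<lambda>k. norm (w k)" "{..<s}"]
        by (simp add: L2_set_def u_def)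
      finally have "norm ((1 / real s) *\<^sub>R (\<Sum>k<s. (of_real (F (?x k)) - p (?x k)) * w k))
          \<le> (1 / real s) * (sqrt (\<Sum>k<s. u (?x k)) * sqrt (\<Sum>k<s. (norm (w k))\<^sup>2))"
        by (simp add: divide_right_mono)
      also have "\<dots> = sqrt ((1 / real s) * (\<Sum>k<s. u (?x k))) * sqrt ((1 / real s) * (\<Sum>k<s. (norm (w k))\<^sup>2))"
        by (simp add: real_sqrt_mult real_sqrt_divide)
      also have "\<dots> \<le> \<delta> * sqrt ((1 / real s) * (\<Sum>k<s. (norm (w k))\<^sup>2))"
        using avgu \<delta> by (intro mult_right_mono real_le_lsqrt) (auto simp: u_def sum_nonneg)
      finally show "norm ((1 / real s) *\<^sub>R (\<Sum>k<s. of_real (F (?x k)) * w k)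
          - (\<Sum>q\<in>K. c q * e q a * ((1 / real s) *\<^sub>R (\<Sum>k<s. cnj (lam q) ^ k * w k))))
          \<le> \<delta> * sqrt ((1 / real s) * (\<Sum>k<s. (norm (w k))\<^sup>2))"
        unfolding eq .
    qed
  qed
  then show ?thesis using that K by blast
qed

text \<open>Expanding \<open>F\<close> in characters leaves twisted averages of the weights alone.
  The weights carry a parameter \<open>x\<close>, so that they may themselves be values along a
  second orbit.\<close>

lemma twisted_average_convergent:
  fixes F :: "'a \<Rightarrow> real" and w :: "'x \<Rightarrow> nat \<Rightarrow> complex"
  assumes F: "continuous_on UNIV F" and w: "\<And>x k. norm (w x k) \<le> B"
    and conv: "\<And>q. uniformly_convergent_on UNIV (\<lambda>s x. (1 / real s) *\<^sub>R (\<Sum>k<s. cnj (lam q) ^ k * w x k))"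
  shows "uniformly_convergent_on UNIV
    (\<lambda>s (a, x). (1 / real s) *\<^sub>R (\<Sum>k<s. of_real (F (\<Phi> (- (real k * T)) a)) * w x k))"
proof (rule uniformly_convergent_on_approx)
  fix \<delta> :: real assume \<delta>: "\<delta> > 0"
  have B: "B \<ge> 0" using w[of undefined undefined] norm_ge_zero order_trans by blast
  have \<delta>': "\<delta> / (B + 1) > 0" using \<delta> B by simp
  obtain K c where K: "finite K" and approx: "\<forall>\<^sub>F s in sequentially. \<forall>a w.
    norm ((1 / real s) *\<^sub>R (\<Sum>k<s. of_real (F (\<Phi> (- (real k * T)) a)) * w k)
        - (\<Sum>q\<in>K. c q * e q a * ((1 / real s) *\<^sub>R (\<Sum>k<s. cnj (lam q) ^ k * w k))))
      \<le> \<delta> / (B + 1) * sqrt ((1 / real s) * (\<Sum>k<s. (norm (w k))\<^sup>2))"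
    using twisted_average_approx[OF F \<delta>'] by blast
  let ?h = "\<lambda>s (a, x). \<Sum>q\<in>K. c q * e q a * ((1 / real s) *\<^sub>R (\<Sum>k<s. cnj (lam q) ^ k * w x k))"
  have "uniformly_convergent_on UNIV (\<lambda>s y. c q * e q (fst y) * ((1 / real s) *\<^sub>R (\<Sum>k<s. cnj (lam q) ^ k * w (snd y) k)))" for q
  proof (rule uniformly_convergent_on_bounded_mult[where B = "norm (c q)"])
    obtain l where "uniform_limit UNIV (\<lambda>s x. (1 / real s) *\<^sub>R (\<Sum>k<s. cnj (lam q) ^ k * w x k)) l sequentially"
      using conv unfolding uniformly_convergent_on_def by blast
    then have "uniform_limit UNIV (\<lambda>s y. (1 / real s) *\<^sub>R (\<Sum>k<s. cnj (lam q) ^ k * w (snd y) k)) (\<lambda>y. l (snd y)) sequentially"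
      unfolding uniform_limit_iff by simp
    then show "uniformly_convergent_on UNIV (\<lambda>s y. (1 / real s) *\<^sub>R (\<Sum>k<s. cnj (lam q) ^ k * w (snd y) k))"
      by (rule uniformly_convergentI)
  qed (simp add: norm_mult norm_e)
  then have "uniformly_convergent_on UNIV ?h"
    unfolding case_prod_beta by (intro uniformly_convergent_on_finite_sum K)
  moreover have "\<forall>\<^sub>F s in sequentially. \<forall>y\<in>UNIV.
    norm ((case y of (a, x) \<Rightarrow> (1 / real s) *\<^sub>R (\<Sum>k<s. of_real (F (\<Phi> (- (real k * T)) a)) * w x k)) - ?h s y) \<le> \<delta>"
    using approx
  proof eventually_elim
    case (elim s)
    show ?case
    proof
      fix y :: "'a \<times> 'x"
      obtain a x where y: "y = (a, x)" by (cases y)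
      have "(\<Sum>k<s. (norm (w x k))\<^sup>2) \<le> (\<Sum>k<s. B\<^sup>2)" by (intro sum_mono power_mono w) auto
      then have "(1 / real s) * (\<Sum>k<s. (norm (w x k))\<^sup>2) \<le> (1 / real s) * (real s * B\<^sup>2)"
        by (intro mult_left_mono) auto
      also have "\<dots> \<le> B\<^sup>2" by simp
      finally have "sqrt ((1 / real s) * (\<Sum>k<s. (norm (w x k))\<^sup>2)) \<le> B"
        using B by (intro real_le_lsqrt) auto
      then have "\<delta> / (B + 1) * sqrt ((1 / real s) * (\<Sum>k<s. (norm (w x k))\<^sup>2)) \<le> \<delta> / (B + 1) * (B + 1)"
        using \<delta>' by (intro mult_left_mono) auto
      also have "\<dots> = \<delta>" using B by simp
      finally have "\<delta> / (B + 1) * sqrt ((1 / real s) * (\<Sum>k<s. (norm (w x k))\<^sup>2)) \<le> \<delta>" .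
      with elim[rule_format, of a "w x"]
      show "norm ((case y of (a, x) \<Rightarrow> (1 / real s) *\<^sub>R (\<Sum>k<s. of_real (F (\<Phi> (- (real k * T)) a)) * w x k)) - ?h s y) \<le> \<delta>"
        unfolding y prod.case by (rule order_trans)
    qed
  qed
  ultimately show "\<exists>h. uniformly_convergent_on UNIV h \<and> (\<forall>\<^sub>F s in sequentially. \<forall>y\<in>UNIV.
    norm ((case y of (a, x) \<Rightarrow> (1 / real s) *\<^sub>R (\<Sum>k<s. of_real (F (\<Phi> (- (real k * T)) a)) * w x k)) - h s y) \<le> \<delta>)"
    by blast
qed

text \<open>The reduction is applied twice: to \<open>G\<close> with powers of an eigenvalue as
  weights, over a one-point parameter space, and then to \<open>F\<close> with values of
  \<open>G\<close> as weights. What remains are averages of powers of a product of two conjugated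
  eigenvalues, which converge whether or not the product is 1.\<close>

lemma correlation_convergent:
  fixes F G :: "'a \<Rightarrow> real"
  assumes F: "continuous_on UNIV F" and G: "continuous_on UNIV G"
  shows "uniformly_convergent_on UNIV
    (\<lambda>s (a, b). (1 / real s) * (\<Sum>k<s. F (\<Phi> (- (real k * T)) a) * G (\<Phi> (- (real k * T)) b)))"
proof -
  obtain B where B: "\<And>a. norm (G a) \<le> B" using continuous_bounded[OF G] by blast
  have "uniformly_convergent_on UNIV (\<lambda>s b. (1 / real s) *\<^sub>R
      (\<Sum>k<s. cnj (lam q) ^ k * complex_of_real (G (\<Phi> (- (real k * T)) b))))" for q
  proof -
    have c: "uniformly_convergent_on UNIV (\<lambda>s (x::unit). (1 / real s) *\<^sub>R (\<Sum>k<s. cnj (lam q') ^ k * cnj (lam q) ^ k))" for q'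
    proof -
      have "convergent (\<lambda>s. (1 / real s) *\<^sub>R (\<Sum>k<s. (cnj (lam q') * cnj (lam q)) ^ k))"
        by (rule convergent_averages_of_powers) (simp add: norm_mult norm_lam)
      then obtain l where "(\<lambda>s. (1 / real s) *\<^sub>R (\<Sum>k<s. (cnj (lam q') * cnj (lam q)) ^ k)) \<longlonglongrightarrow> l"
        by (auto simp: convergent_def)
      then have "uniform_limit UNIV (\<lambda>s (x::unit). (1 / real s) *\<^sub>R (\<Sum>k<s. cnj (lam q') ^ k * cnj (lam q) ^ k)) (\<lambda>_. l) sequentially"
        unfolding uniform_limit_iff tendsto_iff by (simp add: power_mult_distrib)
      then show ?thesis by (rule uniformly_convergentI)
    qed
    have "uniformly_convergent_on UNIV (\<lambda>s (a, x::unit). (1 / real s) *\<^sub>R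
        (\<Sum>k<s. of_real (G (\<Phi> (- (real k * T)) a)) * cnj (lam q) ^ k))"
      by (rule twisted_average_convergent[where B = 1, OF G _ c]) (simp add: norm_power norm_lam)
    then obtain l where l: "uniform_limit UNIV (\<lambda>s (a, x::unit). (1 / real s) *\<^sub>R
        (\<Sum>k<s. of_real (G (\<Phi> (- (real k * T)) a)) * cnj (lam q) ^ k)) l sequentially"
      unfolding uniformly_convergent_on_def by blast
    have "uniform_limit UNIV (\<lambda>s b. (1 / real s) *\<^sub>R
      (\<Sum>k<s. cnj (lam q) ^ k * complex_of_real (G (\<Phi> (- (real k * T)) b)))) (\<lambda>b. l (b, ())) sequentially"
      using l unfolding uniform_limit_iff by (simp add: mult.commute)
    then show ?thesis by (rule uniformly_convergentI)
  qed
  then have "uniformly_convergent_on UNIV (\<lambda>s (a, b). (1 / real s) *\<^sub>R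
      (\<Sum>k<s. of_real (F (\<Phi> (- (real k * T)) a)) * complex_of_real (G (\<Phi> (- (real k * T)) b))))"
    by (intro twisted_average_convergent[where B = B] F) (use B in auto)
  then obtain l where "uniform_limit UNIV (\<lambda>s (a, b). (1 / real s) *\<^sub>R
      (\<Sum>k<s. of_real (F (\<Phi> (- (real k * T)) a)) * complex_of_real (G (\<Phi> (- (real k * T)) b)))) l sequentially"
    unfolding uniformly_convergent_on_def by blast
  from bounded_linear.uniform_limit[OF bounded_linear_Re this]
  show ?thesis
    by (intro uniformly_convergentI[of _ _ "\<lambda>y. Re (l y)"]) (simp add: case_prod_unfold)
qed

end

section \<open>The limiting distance and the averaging operator\<close>

locale observed_system = kronecker_unique \<mu> \<Phi> T \<Omega> \<zeta>
  for \<mu> :: "'a::{t2_space, second_countable_topology} measure" and \<Phi> T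
    and \<Omega> :: "'m::finite \<Rightarrow> real" and \<zeta> +
  fixes F :: "'a \<Rightarrow> real ^ 'd"
  assumes F_continuous: "continuous_on UNIV F"
begin

definition dist_n :: "nat \<Rightarrow> 'a \<Rightarrow> 'a \<Rightarrow> real" where
  "dist_n s a b = (avg_norm s (\<lambda>k. delay_map \<Phi> T F a k - delay_map \<Phi> T F b k))\<^sup>2"

definition dist_lim :: "'a \<Rightarrow> 'a \<Rightarrow> real" where
  "dist_lim a b = lim (\<lambda>s. dist_n s a b)"

lemma dist_n_eq:
  "dist_n s a b = (1 / real s) * (\<Sum>k<s. (norm (F (\<Phi> (- (real k * T)) a) - F (\<Phi> (- (real k * T)) b)))\<^sup>2)"
  unfolding dist_n_def avg_norm_def delay_map_def by (simp add: sum_nonneg)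

lemma F_nth_continuous: "continuous_on UNIV (\<lambda>a. F a $ c)"
  by (intro continuous_intros F_continuous)

text \<open>Expanding the square gives three correlations per coordinate; the pure squares count as
  correlations with the constant 1.\<close>

lemma dist_uniform_convergent: "uniformly_convergent_on UNIV (\<lambda>s (a, b). dist_n s a b)"
proof -
  let ?C = "\<lambda>G H s (a, b). (1 / real s) * (\<Sum>k<s. G (\<Phi> (- (real k * T)) a) * H (\<Phi> (- (real k * T)) b))"
  have eq: "dist_n s a b = (\<Sum>c\<in>UNIV. ?C (\<lambda>a. (F a $ c)\<^sup>2) (\<lambda>_. 1) s (a, b)
      + ((-2) * ?C (\<lambda>a. F a $ c) (\<lambda>a. F a $ c) s (a, b) + ?C (\<lambda>_. 1) (\<lambda>a. (F a $ c)\<^sup>2) s (a, b)))" for s a b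
  proof -
    have norm_eq: "(norm (x - y))\<^sup>2 = (\<Sum>c\<in>UNIV. (x $ c)\<^sup>2 * 1 + ((-2) * (x $ c * y $ c) + 1 * (y $ c)\<^sup>2))" for x y :: "real ^ 'd"
      unfolding power2_norm_eq_inner inner_vec_def
      by (simp add: power2_eq_square algebra_simps)
    have "dist_n s a b = (\<Sum>c\<in>UNIV. (1 / real s) * (\<Sum>k<s. (F (\<Phi> (- (real k * T)) a) $ c)\<^sup>2 * 1
        + ((-2) * (F (\<Phi> (- (real k * T)) a) $ c * F (\<Phi> (- (real k * T)) b) $ c) + 1 * (F (\<Phi> (- (real k * T)) b) $ c)\<^sup>2)))"
      unfolding dist_n_eq norm_eq by (subst sum.swap) (simp only: sum_distrib_left)
    also have "\<dots> = (\<Sum>c\<in>UNIV. ?C (\<lambda>a. (F a $ c)\<^sup>2) (\<lambda>_. 1) s (a, b)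
      + ((-2) * ?C (\<lambda>a. F a $ c) (\<lambda>a. F a $ c) s (a, b) + ?C (\<lambda>_. 1) (\<lambda>a. (F a $ c)\<^sup>2) s (a, b)))"
    proof (rule sum.cong)
      have "r * (\<Sum>k\<in>A. f k + ((-2) * g k + h k)) = r * sum f A + ((-2) * (r * sum g A) + r * sum h A)"
        for r :: real and f g h :: "nat \<Rightarrow> real" and A
        by (simp add: sum.distrib sum_distrib_left sum_subtractf sum_negf algebra_simps)
      then show "(1 / real s) * (\<Sum>k<s. (F (\<Phi> (- (real k * T)) a) $ c)\<^sup>2 * 1
        + ((-2) * (F (\<Phi> (- (real k * T)) a) $ c * F (\<Phi> (- (real k * T)) b) $ c) + 1 * (F (\<Phi> (- (real k * T)) b) $ c)\<^sup>2))
        = ?C (\<lambda>a. (F a $ c)\<^sup>2) (\<lambda>_. 1) s (a, b)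
      + ((-2) * ?C (\<lambda>a. F a $ c) (\<lambda>a. F a $ c) s (a, b) + ?C (\<lambda>_. 1) (\<lambda>a. (F a $ c)\<^sup>2) s (a, b))" for c
        by (simp only: prod.case)
    qed simp
    finally show ?thesis .
  qed
  have "uniformly_convergent_on UNIV (\<lambda>s y. \<Sum>c\<in>UNIV. ?C (\<lambda>a. (F a $ c)\<^sup>2) (\<lambda>_. 1) s y
      + ((-2) * ?C (\<lambda>a. F a $ c) (\<lambda>a. F a $ c) s y + ?C (\<lambda>_. 1) (\<lambda>a. (F a $ c)\<^sup>2) s y))"
    by (intro uniformly_convergent_on_finite_sum finite uniformly_convergent_add uniformly_convergent_mult
        correlation_convergent continuous_on_power continuous_on_const F_nth_continuous)
  then show ?thesis by (simp add: eq case_prod_unfold)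
qed

lemma dist_uniform_limit: "uniform_limit UNIV (\<lambda>s (a, b). dist_n s a b) (\<lambda>(a, b). dist_lim a b) sequentially"
  using dist_uniform_convergent unfolding uniformly_convergent_uniform_limit_iff
  by (simp add: case_prod_unfold dist_lim_def)

lemma dist_tendsto: "(\<lambda>s. dist_n s a b) \<longlonglongrightarrow> dist_lim a b"
  using tendsto_uniform_limitI[OF dist_uniform_limit, of "(a, b)"] by simp

lemma dist_n_continuous: "continuous_on UNIV (\<lambda>(a, b). dist_n s a b)"
proof -
  have "continuous_on UNIV (\<lambda>x. F (\<Phi> t (g x)))" if "continuous_on UNIV g" for t and g :: "'a \<times> 'a \<Rightarrow> 'a"
    by (rule continuous_on_compose2[OF F_continuous], rule continuous_on_compose2[OF flow_continuous_at that]) auto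
  note continuous_on_flow = this
  then show ?thesis
    unfolding dist_n_eq case_prod_unfold
    by (intro continuous_on_mult continuous_on_const continuous_on_sum continuous_on_power continuous_on_norm
        continuous_on_diff continuous_on_flow continuous_on_fst continuous_on_snd continuous_on_id)
qed

lemma dist_lim_continuous: "continuous_on UNIV (\<lambda>(a, b). dist_lim a b)"
  by (rule uniform_limit_theorem[OF _ dist_uniform_limit]) (auto intro!: always_eventually dist_n_continuous)

lemma dist_n_nonneg: "0 \<le> dist_n s a b"
  by (simp add: dist_n_def)

lemma dist_lim_nonneg: "0 \<le> dist_lim a b"
  by (rule LIMSEQ_le_const[OF dist_tendsto]) (auto simp: dist_n_nonneg)

lemma F_diff_bounded:
  obtains B where "B > 0" "\<And>a b. (norm (F a - F b))\<^sup>2 \<le> B"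
proof -
  obtain c where c: "c > 0" "\<And>a. norm (F a) \<le> c" using continuous_bounded[OF F_continuous] by blast
  have "(norm (F a - F b))\<^sup>2 \<le> (2 * c)\<^sup>2" for a b
    by (intro power_mono order_trans[OF norm_triangle_ineq4]) (use c(2)[of a] c(2)[of b] in auto)
  then show ?thesis using that[of "(2 * c)\<^sup>2"] c(1) by simp
qed

lemma dist_bounded:
  obtains B where "B > 0" "\<And>a b. dist_lim a b \<le> B"
proof -
  obtain B where B: "B > 0" "\<And>a b. (norm (F a - F b))\<^sup>2 \<le> B" using F_diff_bounded by blast
  have le: "dist_n s a b \<le> B" for s a b
  proof -
    have "dist_n s a b \<le> (1 / real s) * (\<Sum>k<s. B)"
      unfolding dist_n_eq by (intro mult_left_mono sum_mono B(2)) auto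
    also have "\<dots> \<le> B" using B(1) by simp
    finally show ?thesis .
  qed
  show ?thesis
  proof (rule that)
    show "dist_lim a b \<le> B" for a b
      by (rule LIMSEQ_le_const2[OF dist_tendsto]) (intro exI[of _ 0] allI impI le)
  qed (rule B(1))
qed

text \<open>Moving both points one step changes the sum of \<open>Suc s\<close> terms only at its
  two ends, an effect of order 1/s on the average.\<close>

lemma dist_lim_flow: "dist_lim (\<Phi> T a) (\<Phi> T b) = dist_lim a b"
proof -
  obtain B where B: "B > 0" "\<And>a b. (norm (F a - F b))\<^sup>2 \<le> B" using F_diff_bounded by blast
  define h where "h a b = (norm (F a - F b))\<^sup>2" for a b
  have shift: "\<Phi> (- (real (Suc j) * T)) (\<Phi> T x) = \<Phi> (- (real j * T)) x" for j x
    by (simp add: flow_add[symmetric] algebra_simps)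
  have diff: "dist_n (Suc s) (\<Phi> T a) (\<Phi> T b) - dist_n (Suc s) a b
      = (1 / real (Suc s)) * (h (\<Phi> T a) (\<Phi> T b) - h (\<Phi> (- (real s * T)) a) (\<Phi> (- (real s * T)) b))" for s
  proof -
    have "(\<Sum>k<Suc s. h (\<Phi> (- (real k * T)) (\<Phi> T a)) (\<Phi> (- (real k * T)) (\<Phi> T b)))
        = h (\<Phi> T a) (\<Phi> T b) + (\<Sum>k<s. h (\<Phi> (- (real k * T)) a) (\<Phi> (- (real k * T)) b))"
      by (subst sum.lessThan_Suc_shift) (simp add: shift flow_0 del: of_nat_Suc)
    then show ?thesis
      unfolding dist_n_eq h_def[symmetric] right_diff_distrib[symmetric] by simp
  qed
  have "(\<lambda>s. dist_n (Suc s) (\<Phi> T a) (\<Phi> T b) - dist_n (Suc s) a b) \<longlonglongrightarrow> 0"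
  proof (rule Lim_null_comparison)
    show "\<forall>\<^sub>F s in sequentially. norm (dist_n (Suc s) (\<Phi> T a) (\<Phi> T b) - dist_n (Suc s) a b) \<le> B * (1 / real (Suc s))"
    proof (intro always_eventually allI)
      fix s
      have "\<bar>h (\<Phi> T a) (\<Phi> T b) - h (\<Phi> (- (real s * T)) a) (\<Phi> (- (real s * T)) b)\<bar> \<le> B"
        using B(2)[of "\<Phi> T a" "\<Phi> T b"]
          B(2)[of "\<Phi> (- (real s * T)) a" "\<Phi> (- (real s * T)) b"]
        unfolding h_def by (simp add: abs_le_iff order_trans[OF diff_left_mono[OF zero_le_power2]] add_increasing)
      then show "norm (dist_n (Suc s) (\<Phi> T a) (\<Phi> T b) - dist_n (Suc s) a b) \<le> B * (1 / real (Suc s))"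
        unfolding diff real_norm_def abs_mult by (simp add: divide_right_mono)
    qed
    show "(\<lambda>s. B * (1 / real (Suc s))) \<longlonglongrightarrow> 0"
      by (intro tendsto_mult_right_zero LIMSEQ_Suc lim_1_over_n)
  qed
  moreover have "(\<lambda>s. dist_n (Suc s) (\<Phi> T a) (\<Phi> T b) - dist_n (Suc s) a b) \<longlonglongrightarrow> dist_lim (\<Phi> T a) (\<Phi> T b) - dist_lim a b"
    by (intro tendsto_diff LIMSEQ_Suc dist_tendsto)
  ultimately have "dist_lim (\<Phi> T a) (\<Phi> T b) - dist_lim a b = 0" by (rule LIMSEQ_unique[rotated])
  then show ?thesis by simp
qed

section \<open>The limiting kernel and its normalisation\<close>

definition limit_kernel :: "real \<Rightarrow> 'a \<Rightarrow> 'a \<Rightarrow> real" where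
  "limit_kernel \<epsilon> a b = exp (- dist_lim a b / \<epsilon>)"

definition mass :: "real \<Rightarrow> real" where
  "mass \<epsilon> = (\<integral>a. (\<integral>b. limit_kernel \<epsilon> a b \<partial>\<mu>) \<partial>\<mu>)"

lemma kernel_continuous: "continuous_on UNIV (\<lambda>(a, b). limit_kernel \<epsilon> a b)"
  using continuous_on_exp[OF continuous_on_mult[OF dist_lim_continuous continuous_on_const[of _ "- 1 / \<epsilon>"]]]
  by (simp add: limit_kernel_def case_prod_unfold)

lemma kernel_integrable: "integrable \<mu> (limit_kernel \<epsilon> a)"
  using integrable_continuous[OF continuous_on_section[OF kernel_continuous[of \<epsilon>], of a]] by simp

lemma kernel_pos: "limit_kernel \<epsilon> a b > 0"
  by (simp add: limit_kernel_def)

lemma kernel_le_1: "\<epsilon> > 0 \<Longrightarrow> limit_kernel \<epsilon> a b \<le> 1"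
  by (simp add: limit_kernel_def divide_nonpos_pos dist_lim_nonneg)

text \<open>The mass of the limit kernel is an invariant continuous function, hence equal to its time averages.\<close>

lemma integral_kernel: "(\<integral>b. limit_kernel \<epsilon> a b \<partial>\<mu>) = mass \<epsilon>"
proof -
  define K where "K a = (\<integral>b. limit_kernel \<epsilon> a b \<partial>\<mu>)" for a
  have K_cont: "continuous_on UNIV K"
    using continuous_parameter_integral[OF kernel_continuous[of \<epsilon>]] by (simp add: K_def[abs_def])
  have "K (\<Phi> T a) = K a" for a
  proof -
    have "K (\<Phi> T a) = (\<integral>b. limit_kernel \<epsilon> (\<Phi> T a) (\<Phi> T b) \<partial>\<mu>)"
      unfolding K_def by (rule integral_flow[symmetric]) (use kernel_integrable in auto)
    then show ?thesis by (simp add: K_def limit_kernel_def dist_lim_flow)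
  qed
  then have "K (\<Phi> (real j * T) a) = K a" for j a
    by (induction j) (simp_all add: flow_0 flow_add distrib_right)
  then have "avg n K a = K a" if "n \<ge> 1" for n
    using that by (simp add: avg_def)
  then have "(\<lambda>n. avg n K a) \<longlonglongrightarrow> K a"
    by (intro tendsto_eventually eventually_sequentiallyI[of 1])
  moreover have "(\<lambda>n. avg n K a) \<longlonglongrightarrow> (\<integral>a. K a \<partial>\<mu>)"
    using tendsto_uniform_limitI[OF uniformly_ergodic_real[OF K_cont, unfolded uniformly_ergodic_def], of a] by simp
  ultimately have "K a = (\<integral>a. K a \<partial>\<mu>)" by (rule LIMSEQ_unique)
  then show ?thesis by (simp add: K_def mass_def)
qed

lemma mass_pos: "mass \<epsilon> > 0"
proof -
  have "(\<integral>b. limit_kernel \<epsilon> a b \<partial>\<mu>) \<noteq> 0" for a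
    using integral_nonneg_eq_0_iff_AE[of \<mu> "limit_kernel \<epsilon> a"] kernel_integrable kernel_pos[of \<epsilon> a]
    by (auto simp: less_imp_le AE_False less_le)
  moreover have "(\<integral>b. limit_kernel \<epsilon> a b \<partial>\<mu>) \<ge> 0" for a
    by (intro integral_nonneg_AE AE_I2 less_imp_le kernel_pos)
  ultimately show ?thesis unfolding integral_kernel by (simp add: less_le)
qed

lemma gauss_delay: "gauss s \<epsilon> (delay_map \<Phi> T F a) (delay_map \<Phi> T F b) = exp (- dist_n s a b / \<epsilon>)"
  by (simp add: gauss_def dist_n_def)

text \<open>By dominated convergence the numerator tends to the row mass at \<open>a\<close> and the
  denominator to the mean of the row masses; by \<open>integral_kernel\<close> both are
  \<open>mass \<epsilon>\<close>. The bandwidth of the averaging operator is therefore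
  constant.\<close>

theorem tau_bar_eq_1:
  assumes \<epsilon>: "\<epsilon> > 0" shows "tau_bar \<mu> \<Phi> T F \<epsilon> a = 1"
proof -
  define v where "v s y = exp (- dist_n s (fst y) (snd y) / \<epsilon>)" for s y
  have v_cont: "continuous_on UNIV (v s)" for s
    using continuous_on_exp[OF continuous_on_mult[OF dist_n_continuous[of s] continuous_on_const[of _ "- 1 / \<epsilon>"]]]
    by (simp add: v_def[abs_def] case_prod_unfold)
  have v_le: "\<bar>v s y\<bar> \<le> 1" for s y
    using \<epsilon> by (simp add: v_def divide_nonpos_pos dist_n_nonneg)
  have v_lim: "(\<lambda>s. v s (a, b)) \<longlonglongrightarrow> limit_kernel \<epsilon> a b" for a b
    unfolding v_def limit_kernel_def fst_conv snd_conv by (intro tendsto_intros dist_tendsto) (use \<epsilon> in auto)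
  have inner: "(\<lambda>s. \<integral>b. v s (a, b) \<partial>\<mu>) \<longlonglongrightarrow> mass \<epsilon>" for a
    unfolding integral_kernel[of \<epsilon> a, symmetric]
    by (rule integral_dominated_convergence[where w = "\<lambda>_. 1"])
      (use v_lim v_le kernel_integrable in \<open>auto intro!: measurable_continuous continuous_on_section v_cont\<close>)
  have inner_le: "\<bar>\<integral>b. v s (a, b) \<partial>\<mu>\<bar> \<le> 1" for s a
    using norm_integral_diff_le[of "\<lambda>b. v s (a, b)" "\<lambda>_. 0" 1] v_le
    by (simp add: integrable_continuous continuous_on_section v_cont)
  have outer: "(\<lambda>s. \<integral>a. (\<integral>b. v s (a, b) \<partial>\<mu>) \<partial>\<mu>) \<longlonglongrightarrow> (\<integral>a. mass \<epsilon> \<partial>\<mu>)"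
    by (rule integral_dominated_convergence[where w = "\<lambda>_. 1"])
      (use inner inner_le in \<open>auto intro!: measurable_continuous continuous_parameter_integral v_cont\<close>)
  have "(\<lambda>s. (\<integral>b. v s (a, b) \<partial>\<mu>) / (\<integral>a. (\<integral>b. v s (a, b) \<partial>\<mu>) \<partial>\<mu>)) \<longlonglongrightarrow> mass \<epsilon> / mass \<epsilon>"
    using tendsto_divide[OF inner outer] mass_pos[of \<epsilon>] by (simp add: prob_space)
  then show ?thesis
    using mass_pos[of \<epsilon>] unfolding tau_bar_def gauss_delay by (intro limI) (simp add: v_def)
qed

lemma k_inf_eq: "\<epsilon> > 0 \<Longrightarrow> k_inf m \<mu> \<Phi> T F \<epsilon> a b = limit_kernel \<epsilon> a b"
  unfolding k_inf_def tau_bar_eq_1 dist_n_def[symmetric] limit_kernel_def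
  by (intro limI tendsto_intros) (auto intro!: dist_tendsto)

text \<open>Constant row masses make the first normalisation a division by a constant. The prefactor
  \<open>c\<close> cancels already in \<open>H_op\<close>, and \<open>H_op\<close> of the constant 1
  is 1.\<close>

theorem P_op_eq:
  assumes \<epsilon>: "\<epsilon> > 0"
  shows "P_op m \<mu> \<Phi> T F \<epsilon> f a = (\<integral>b. of_real (limit_kernel \<epsilon> a b) * f b \<partial>\<mu>) / of_real (mass \<epsilon>)"
proof -
  define c where "c = complex_of_real (\<epsilon> powr (- real m / 2))"
  have c: "c \<noteq> 0" using \<epsilon> by (simp add: c_def)
  have G: "G_op m \<mu> \<Phi> T F \<epsilon> g a = c * (\<integral>b. of_real (limit_kernel \<epsilon> a b) * g b \<partial>\<mu>)" for g a
    unfolding G_op_def c_def by (simp add: k_inf_eq \<epsilon>)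
  have one: "(\<integral>b. complex_of_real (limit_kernel \<epsilon> a b) * 1 \<partial>\<mu>) = of_real (mass \<epsilon>)" for a
    by (simp add: integral_kernel)
  have H: "H_op m \<mu> \<Phi> T F \<epsilon> g a = c * ((\<integral>b. of_real (limit_kernel \<epsilon> a b) * g b \<partial>\<mu>) / (c * of_real (mass \<epsilon>)))" for g a
    unfolding H_op_def G one times_divide_eq_right by (subst integral_divide_zero) simp
  show ?thesis
    unfolding P_op_def H one using c mass_pos[of \<epsilon>] by (simp add: field_simps)
qed

end

section \<open>Rows of the Markov matrix\<close>

text \<open>Convergence along this filter is convergence as \<open>s \<rightarrow> \<infinity>\<close>, uniformly in the row index.\<close>

definition row_filter :: "(nat \<Rightarrow> nat) \<Rightarrow> (nat \<times> nat) filter" where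
  "row_filter N = inf (filtercomap fst sequentially) (principal {(s, i). i \<in> idx s (N s)})"

lemma eventually_row_filter:
  "eventually P (row_filter N) \<longleftrightarrow> (\<forall>\<^sub>F s in sequentially. \<forall>i\<in>idx s (N s). P (s, i))"
proof
  assume "eventually P (row_filter N)"
  then obtain Q where Q: "eventually Q sequentially" "\<And>x. Q (fst x) \<Longrightarrow> x \<in> {(s, i). i \<in> idx s (N s)} \<longrightarrow> P x"
    unfolding row_filter_def eventually_inf_principal eventually_filtercomap by blast
  from Q(1) show "\<forall>\<^sub>F s in sequentially. \<forall>i\<in>idx s (N s). P (s, i)"
    by eventually_elim (use Q(2) in force)
next
  assume "\<forall>\<^sub>F s in sequentially. \<forall>i\<in>idx s (N s). P (s, i)"
  then show "eventually P (row_filter N)"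
    unfolding row_filter_def eventually_inf_principal eventually_filtercomap
    by (rule exI[of _ "\<lambda>s. \<forall>i\<in>idx s (N s). P (s, i)", OF conjI]) auto
qed

lemma filterlim_fst_row_filter: "filterlim fst sequentially (row_filter N)"
  unfolding row_filter_def filterlim_def
  using filtermap_filtercomap filtermap_mono[OF inf_le1] order_trans by blast

lemma exp_minus_lipschitz:
  fixes x y :: real
  assumes "0 \<le> x" "0 \<le> y" shows "\<bar>exp (- x) - exp (- y)\<bar> \<le> \<bar>x - y\<bar>"
proof -
  have *: "exp (- u) - exp (- v) \<le> v - u" if "0 \<le> u" "u \<le> v" for u v :: real
  proof -
    have "exp (- u) - exp (- v) = exp (- u) * (1 - exp (u - v))" by (simp add: algebra_simps flip: exp_add)
    also have "\<dots> \<le> 1 * (v - u)"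
    proof (intro mult_mono)
      show "1 - exp (u - v) \<le> v - u" using exp_ge_add_one_self[of "u - v"] by linarith
    qed (use that in auto)
    finally show ?thesis by simp
  qed
  show ?thesis
    using *[of x y] *[of y x] assms by (cases "x \<le> y") (auto simp: abs_if)
qed

text \<open>A deterministic setting for one time series. \<open>Dl\<close> is the limiting squared
  distance of the underlying states, and \<open>c\<close> is the shift that the noise adds to it.
  Distances are close only on average over a row, which leaves single entries, such as those on the
  diagonal, uncontrolled.\<close>

locale markov_data =
  fixes m :: nat and N :: "nat \<Rightarrow> nat" and \<epsilon> :: real and x :: "nat \<Rightarrow> 'b::real_normed_vector"
    and Dl :: "nat \<Rightarrow> nat \<Rightarrow> real" and c B g :: real
  assumes \<epsilon>: "\<epsilon> > 0" and c: "c \<ge> 0" and g: "g > 0"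
    and N_large: "\<forall>\<^sub>F s in sequentially. 1 \<le> s \<and> s \<le> N s"
    and Dl: "0 \<le> Dl i j" "Dl i j \<le> B"
    and dist_close: "((\<lambda>(s, i). (1 / real (N s - s + 1)) * (\<Sum>j\<in>idx s (N s).
        \<bar>(avg_norm s (\<lambda>k. delay_vec x i k - delay_vec x j k))\<^sup>2 - (Dl i j + c)\<bar>)) \<longlongrightarrow> 0) (row_filter N)"
    and mass_close: "((\<lambda>(s, i). (1 / real (N s - s + 1)) * (\<Sum>j\<in>idx s (N s). exp (- Dl i j / \<epsilon>))) \<longlongrightarrow> g)
        (row_filter N)"
begin

definition A :: "nat \<Rightarrow> (nat \<Rightarrow> 'c::real_vector) \<Rightarrow> 'c" where
  "A s h = (1 / real (N s - s + 1)) *\<^sub>R (\<Sum>j\<in>idx s (N s). h j)"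

abbreviation "\<F> \<equiv> row_filter N"

lemma A_mono: "(\<And>j. j \<in> idx s (N s) \<Longrightarrow> h j \<le> h' j) \<Longrightarrow> A s h \<le> A s h'" for h h' :: "nat \<Rightarrow> real"
  unfolding A_def by (intro scaleR_left_mono sum_mono) auto

lemma A_nonneg: "(\<And>j. j \<in> idx s (N s) \<Longrightarrow> 0 \<le> h j) \<Longrightarrow> 0 \<le> A s h" for h :: "nat \<Rightarrow> real"
  unfolding A_def by (intro scaleR_nonneg_nonneg sum_nonneg) auto

lemma A_add: "A s (\<lambda>j. h j + h' j) = A s h + A s h'"
  by (simp add: A_def sum.distrib scaleR_add_right)

lemma A_diff: "A s (\<lambda>j. h j - h' j) = A s h - A s h'"
  by (simp add: A_def sum_subtractf scaleR_diff_right)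

lemma A_cmult: "A s (\<lambda>j. r * h j) = r * A s h" for h :: "nat \<Rightarrow> real"
  by (simp add: A_def sum_distrib_left)

lemma norm_A_le: "norm (A s h) \<le> A s (\<lambda>j. norm (h j))" for h :: "nat \<Rightarrow> 'c::real_normed_vector"
  unfolding A_def by (simp add: divide_right_mono norm_sum)

lemma A_const: "1 \<le> s \<Longrightarrow> s \<le> N s \<Longrightarrow> A s (\<lambda>_. r) = r" for r :: real
proof -
  assume s: "1 \<le> s" "s \<le> N s"
  define n where "n = N s - s + 1"
  have "card (idx s (N s)) = n" "n \<noteq> 0" using s by (auto simp: idx_def n_def)
  then show ?thesis unfolding A_def n_def[symmetric] by simp
qed

lemma tendsto_A:
  fixes X :: "nat \<times> nat \<Rightarrow> real"
  assumes X: "(X \<longlongrightarrow> L) \<F>" shows "((\<lambda>s. A s (\<lambda>i. X (s, i))) \<longlongrightarrow> L) sequentially"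
proof (rule tendstoI)
  fix \<delta> :: real assume \<delta>: "\<delta> > 0"
  have "\<forall>\<^sub>F y in \<F>. dist (X y) L < \<delta> / 2" by (rule tendstoD[OF X]) (use \<delta> in simp)
  then have "\<forall>\<^sub>F s in sequentially. \<forall>i\<in>idx s (N s). dist (X (s, i)) L < \<delta> / 2"
    by (simp only: eventually_row_filter)
  then show "\<forall>\<^sub>F s in sequentially. dist (A s (\<lambda>i. X (s, i))) L < \<delta>"
    using N_large
  proof eventually_elim
    case (elim s)
    have "\<bar>A s (\<lambda>i. X (s, i)) - L\<bar> = \<bar>A s (\<lambda>i. X (s, i) - L)\<bar>"
      using elim(2) by (simp add: A_diff A_const)
    also have "\<dots> \<le> A s (\<lambda>i. \<bar>X (s, i) - L\<bar>)" using norm_A_le[of s "\<lambda>i. X (s, i) - L"] by simp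
    also have "\<dots> \<le> A s (\<lambda>_. \<delta> / 2)"
      using elim(1) by (intro A_mono) (auto simp: dist_real_def intro: less_imp_le)
    also have "\<dots> = \<delta> / 2" using elim(2) by (simp only: A_const)
    finally show ?case using \<delta> unfolding dist_real_def by simp
  qed
qed

lemma tendsto_A_rows: "(X \<longlongrightarrow> L) \<F> \<Longrightarrow> ((\<lambda>(s, i). A s (\<lambda>i. X (s, i))) \<longlongrightarrow> L) \<F>"
  for X :: "nat \<times> nat \<Rightarrow> real"
  using filterlim_compose[OF tendsto_A filterlim_fst_row_filter] by (simp add: case_prod_unfold)

lemma eventually_all_rows:
  "eventually P \<F> \<Longrightarrow> \<forall>\<^sub>F (s, i) in \<F>. \<forall>j\<in>idx s (N s). P (s, j)"
  by (simp add: eventually_row_filter) (auto elim: eventually_mono)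

section \<open>Density estimates and kernel entries\<close>

definition d :: "nat \<Rightarrow> nat \<Rightarrow> nat \<Rightarrow> real" where
  "d s i j = (avg_norm s (\<lambda>k. delay_vec x i k - delay_vec x j k))\<^sup>2"

definition E :: "nat \<times> nat \<Rightarrow> real" where "E = (\<lambda>(s, i). A s (\<lambda>j. \<bar>d s i j - (Dl i j + c)\<bar>))"

text \<open>The limiting value of a kernel entry. The shift \<open>c\<close> enters as the factor
  \<open>exp (- c / \<epsilon>)\<close> common to all entries.\<close>

definition w :: "nat \<Rightarrow> nat \<Rightarrow> real" where "w i j = exp (- ((Dl i j + c) / \<epsilon>))"

definition \<gamma> :: real where "\<gamma> = exp (- c / \<epsilon>) * g"

lemma E_tendsto: "(E \<longlongrightarrow> 0) \<F>"
  using dist_close by (simp add: E_def A_def d_def)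

lemma \<gamma>_pos: "\<gamma> > 0" using g by (simp add: \<gamma>_def)

lemma d_nonneg: "d s i j \<ge> 0" by (simp add: d_def)

lemma w_bounds: "0 < w i j" "w i j \<le> 1"
  using Dl(1)[of i j] c \<epsilon> by (simp_all add: w_def)

lemma w_eq: "w i j = exp (- c / \<epsilon>) * exp (- Dl i j / \<epsilon>)"
  by (simp add: w_def add_divide_distrib flip: exp_add)

lemma W_tendsto: "((\<lambda>(s, i). A s (w i)) \<longlongrightarrow> \<gamma>) \<F>"
proof -
  have "A s (w i) = exp (- c / \<epsilon>) * ((1 / real (N s - s + 1)) * (\<Sum>j\<in>idx s (N s). exp (- Dl i j / \<epsilon>)))" for s i
    by (simp add: A_def w_eq sum_distrib_left)
  then show ?thesis
    using tendsto_mult[OF tendsto_const mass_close, of "exp (- c / \<epsilon>)"]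
    by (simp add: \<gamma>_def case_prod_unfold)
qed

lemma tendsto_by_A_bound:
  fixes h h' :: "nat \<Rightarrow> nat \<Rightarrow> nat \<Rightarrow> real"
  assumes "((\<lambda>(s, i). A s (\<lambda>j. \<bar>h s i j - h' s i j\<bar>)) \<longlongrightarrow> 0) \<F>"
    and "((\<lambda>(s, i). A s (h' s i)) \<longlongrightarrow> L) \<F>"
  shows "((\<lambda>(s, i). A s (h s i)) \<longlongrightarrow> L) \<F>"
proof -
  have "((\<lambda>(s, i). A s (h s i) - A s (h' s i)) \<longlongrightarrow> 0) \<F>"
  proof (rule Lim_null_comparison[OF _ assms(1)], rule always_eventually, rule allI)
    fix y :: "nat \<times> nat"
    obtain s i where y: "y = (s, i)" by (cases y)
    show "norm (case y of (s, i) \<Rightarrow> A s (h s i) - A s (h' s i)) \<le> (case y of (s, i) \<Rightarrow> A s (\<lambda>j. \<bar>h s i j - h' s i j\<bar>))"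
      using norm_A_le[of s "\<lambda>j. h s i j - h' s i j"] by (simp add: y A_diff)
  qed
  from tendsto_add[OF this assms(2)] show ?thesis by (simp add: case_prod_unfold)
qed

definition gs :: "nat \<Rightarrow> nat \<Rightarrow> nat \<Rightarrow> real" where
  "gs s i j = gauss s \<epsilon> (delay_vec x i) (delay_vec x j)"

lemma gs_eq: "gs s i j = exp (- (d s i j / \<epsilon>))"
  by (simp add: gs_def gauss_def d_def)

lemma rho_tendsto: "((\<lambda>(s, i). A s (gs s i)) \<longlongrightarrow> \<gamma>) \<F>"
proof (rule tendsto_by_A_bound[OF _ W_tendsto])
  have "((\<lambda>y. 1 / \<epsilon> * E y) \<longlongrightarrow> 1 / \<epsilon> * 0) \<F>" by (intro tendsto_intros E_tendsto)
  then have lim: "((\<lambda>y. 1 / \<epsilon> * E y) \<longlongrightarrow> 0) \<F>" by simp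
  show "((\<lambda>(s, i). A s (\<lambda>j. \<bar>gs s i j - w i j\<bar>)) \<longlongrightarrow> 0) \<F>"
  proof (rule Lim_null_comparison[OF _ lim], rule always_eventually, rule allI)
    fix y :: "nat \<times> nat"
    obtain s i where y: "y = (s, i)" by (cases y)
    have "A s (\<lambda>j. \<bar>gs s i j - w i j\<bar>) \<le> A s (\<lambda>j. 1 / \<epsilon> * \<bar>d s i j - (Dl i j + c)\<bar>)"
    proof (rule A_mono)
      fix j
      have "\<bar>gs s i j - w i j\<bar> \<le> \<bar>d s i j / \<epsilon> - (Dl i j + c) / \<epsilon>\<bar>"
        unfolding gs_eq w_def using \<epsilon> Dl(1) c d_nonneg by (intro exp_minus_lipschitz) auto
      also have "\<dots> = 1 / \<epsilon> * \<bar>d s i j - (Dl i j + c)\<bar>"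
        using \<epsilon> by (simp add: diff_divide_distrib[symmetric])
      finally show "\<bar>gs s i j - w i j\<bar> \<le> 1 / \<epsilon> * \<bar>d s i j - (Dl i j + c)\<bar>" .
    qed
    moreover have "0 \<le> A s (\<lambda>j. \<bar>gs s i j - w i j\<bar>)" by (rule A_nonneg) simp
    ultimately show "norm (case y of (s, i) \<Rightarrow> A s (\<lambda>j. \<bar>gs s i j - w i j\<bar>)) \<le> 1 / \<epsilon> * E y"
      unfolding y E_def prod.case A_cmult real_norm_def by (simp only: abs_of_nonneg)
  qed
qed

lemma tau_eq: "tau s (N s) \<epsilon> x i = A s (gs s i) / A s (\<lambda>k. A s (gs s k))"
proof -
  have "(1 / (real (N s - s + 1))\<^sup>2) * (\<Sum>k\<in>idx s (N s). \<Sum>l\<in>idx s (N s). gs s k l) = A s (\<lambda>k. A s (gs s k))"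
    by (simp add: A_def power2_eq_square sum_distrib_left)
  then have "tau s (N s) \<epsilon> x i = 1 / real (N s - s + 1) * (\<Sum>j\<in>idx s (N s). gs s i j / A s (\<lambda>k. A s (gs s k)))"
    unfolding tau_def kappa_def gs_def[symmetric] by (simp only:)
  also have "\<dots> = A s (gs s i) / A s (\<lambda>k. A s (gs s k))"
    unfolding sum_divide_distrib[symmetric] times_divide_eq_right by (simp only: A_def real_scaleR_def)
  finally show ?thesis .
qed

text \<open>The reciprocal of a bandwidth factor, so that the exponent of \<open>K\<close> becomes a
  product with two values of \<open>q\<close>.\<close>

definition q :: "nat \<times> nat \<Rightarrow> real" where
  "q = (\<lambda>(s, i). inverse (tau s (N s) \<epsilon> x i powr (- 1 / real m)))"

lemma q_tendsto: "(q \<longlongrightarrow> 1) \<F>"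
proof -
  have "((\<lambda>(s, i). tau s (N s) \<epsilon> x i) \<longlongrightarrow> \<gamma> / \<gamma>) \<F>"
    using tendsto_divide[OF rho_tendsto tendsto_A_rows[OF rho_tendsto]] \<gamma>_pos
    by (simp add: tau_eq case_prod_unfold)
  then have "((\<lambda>(s, i). tau s (N s) \<epsilon> x i) \<longlongrightarrow> 1) \<F>" using \<gamma>_pos by simp
  from tendsto_inverse[OF tendsto_powr[OF this tendsto_const, of "- 1 / real m"]]
  show ?thesis by (simp add: q_def case_prod_unfold)
qed

definition K :: "nat \<Rightarrow> nat \<Rightarrow> nat \<Rightarrow> real" where "K s i j = Kmat m s (N s) \<epsilon> x i j"

lemma q_nonneg: "q y \<ge> 0" by (simp add: q_def case_prod_unfold)

lemma K_eq: "K s i j = exp (- (d s i j * (q (s, i) * q (s, j)) / \<epsilon>))"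
  unfolding K_def Kmat_def q_def d_def prod.case
  by (simp add: divide_inverse[of _ "\<epsilon> * _"] divide_inverse[of _ \<epsilon>] mult_ac)

lemma K_bounds: "0 < K s i j" "K s i j \<le> 1"
  using \<epsilon> d_nonneg q_nonneg by (simp_all add: K_eq)

text \<open>Write D for \<open>Dl i j + c\<close>. Up to the division by \<epsilon>, the exponents
  differ by (d - D) q_i q_j + (q_i q_j - 1) D. The first part is governed by \<open>E\<close>, the
  factor 4 bounding a product of two values of \<open>q\<close> that are at most 2; the second uses
  the bound on D and the row average of the deviations of \<open>q\<close> from 1.\<close>

lemma K_close: "((\<lambda>(s, i). A s (\<lambda>j. \<bar>K s i j - w i j\<bar>)) \<longlongrightarrow> 0) \<F>"
proof -
  have q1: "((\<lambda>y. \<bar>q y - 1\<bar>) \<longlongrightarrow> 0) \<F>"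
    using tendsto_rabs[OF tendsto_diff[OF q_tendsto tendsto_const[of 1]]] by simp
  let ?bound = "\<lambda>y. (4 * E y + (B + c) * (2 * \<bar>q y - 1\<bar> + (case y of (s, i) \<Rightarrow> A s (\<lambda>j. \<bar>q (s, j) - 1\<bar>)))) / \<epsilon>"
  have "(?bound \<longlongrightarrow> (4 * 0 + (B + c) * (2 * 0 + 0)) / \<epsilon>) \<F>"
    by (intro tendsto_intros E_tendsto q1 tendsto_A_rows) (use \<epsilon> in simp)
  then have lim: "(?bound \<longlongrightarrow> 0) \<F>" by simp
  have le2: "\<forall>\<^sub>F y in \<F>. q y \<le> 2"
    using order_tendstoD(2)[OF q_tendsto, of 2] by (auto elim: eventually_mono)
  have "\<forall>\<^sub>F y in \<F>. norm (case y of (s, i) \<Rightarrow> A s (\<lambda>j. \<bar>K s i j - w i j\<bar>)) \<le> ?bound y"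
    using le2 eventually_all_rows[OF le2] eventually_compose_filterlim[OF N_large filterlim_fst_row_filter[of N]]
  proof eventually_elim
    case (elim y)
    obtain s i where y: "y = (s, i)" by (cases y)
    have s: "1 \<le> s" "s \<le> N s" using elim by (auto simp: y)
    have pw: "\<bar>K s i j - w i j\<bar> \<le> (4 * \<bar>d s i j - (Dl i j + c)\<bar> + (B + c) * (2 * \<bar>q (s, i) - 1\<bar> + \<bar>q (s, j) - 1\<bar>)) / \<epsilon>"
      if j: "j \<in> idx s (N s)" for j
    proof -
      have qi: "0 \<le> q (s, i)" "q (s, i) \<le> 2" and qj: "0 \<le> q (s, j)" "q (s, j) \<le> 2"
        using elim j q_nonneg by (auto simp: y)
      have DB: "0 \<le> Dl i j + c" "Dl i j + c \<le> B + c" using Dl[of i j] c by auto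
      have qq: "q (s, i) * q (s, j) \<le> 2 * 2" using qi qj by (intro mult_mono) auto
      have qq1: "\<bar>q (s, i) * q (s, j) - 1\<bar> \<le> 2 * \<bar>q (s, i) - 1\<bar> + \<bar>q (s, j) - 1\<bar>"
      proof -
        have "q (s, i) * q (s, j) - 1 = (q (s, i) - 1) * q (s, j) + (q (s, j) - 1)" by (simp add: algebra_simps)
        then have "\<bar>q (s, i) * q (s, j) - 1\<bar> \<le> \<bar>q (s, i) - 1\<bar> * q (s, j) + \<bar>q (s, j) - 1\<bar>"
          using abs_triangle_ineq[of "(q (s, i) - 1) * q (s, j)" "q (s, j) - 1"] qj by (simp add: abs_mult)
        also have "\<bar>q (s, i) - 1\<bar> * q (s, j) \<le> \<bar>q (s, i) - 1\<bar> * 2" using qj by (intro mult_left_mono) auto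
        finally show ?thesis by simp
      qed
      have "\<bar>K s i j - w i j\<bar> \<le> \<bar>d s i j * (q (s, i) * q (s, j)) / \<epsilon> - (Dl i j + c) / \<epsilon>\<bar>"
        unfolding K_eq w_def using \<epsilon> DB d_nonneg q_nonneg by (intro exp_minus_lipschitz) auto
      also have "\<dots> = \<bar>(d s i j - (Dl i j + c)) * (q (s, i) * q (s, j)) + (q (s, i) * q (s, j) - 1) * (Dl i j + c)\<bar> / \<epsilon>"
      proof -
        have "d s i j * (q (s, i) * q (s, j)) / \<epsilon> - (Dl i j + c) / \<epsilon>
          = ((d s i j - (Dl i j + c)) * (q (s, i) * q (s, j)) + (q (s, i) * q (s, j) - 1) * (Dl i j + c)) / \<epsilon>"
          unfolding diff_divide_distrib[symmetric] by (simp add: algebra_simps)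
        then show ?thesis using \<epsilon> by (simp only: abs_divide)
      qed
      also have "\<dots> \<le> (\<bar>d s i j - (Dl i j + c)\<bar> * 4 + (2 * \<bar>q (s, i) - 1\<bar> + \<bar>q (s, j) - 1\<bar>) * (B + c)) / \<epsilon>"
      proof (rule divide_right_mono)
        have "\<bar>(d s i j - (Dl i j + c)) * (q (s, i) * q (s, j))\<bar> \<le> \<bar>d s i j - (Dl i j + c)\<bar> * 4"
          unfolding abs_mult using qq qi qj by (intro mult_mono) (auto simp: abs_mult[symmetric])
        moreover have "\<bar>(q (s, i) * q (s, j) - 1) * (Dl i j + c)\<bar> \<le> (2 * \<bar>q (s, i) - 1\<bar> + \<bar>q (s, j) - 1\<bar>) * (B + c)"
          unfolding abs_mult using qq1 DB by (intro mult_mono) auto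
        ultimately show "\<bar>(d s i j - (Dl i j + c)) * (q (s, i) * q (s, j)) + (q (s, i) * q (s, j) - 1) * (Dl i j + c)\<bar>
          \<le> \<bar>d s i j - (Dl i j + c)\<bar> * 4 + (2 * \<bar>q (s, i) - 1\<bar> + \<bar>q (s, j) - 1\<bar>) * (B + c)"
          by (rule order_trans[OF abs_triangle_ineq add_mono])
      qed (use \<epsilon> in simp)
      finally show ?thesis by (simp add: mult_ac)
    qed
    have "A s (\<lambda>j. \<bar>K s i j - w i j\<bar>) \<le> A s (\<lambda>j. (1 / \<epsilon>) * (4 * \<bar>d s i j - (Dl i j + c)\<bar>
        + (B + c) * (2 * \<bar>q (s, i) - 1\<bar> + \<bar>q (s, j) - 1\<bar>)))"
      by (rule A_mono) (use pw in \<open>simp add: divide_inverse mult_ac\<close>)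
    also have "\<dots> = ?bound y"
      unfolding A_cmult A_add A_const[OF s] by (simp add: y E_def)
    finally have "A s (\<lambda>j. \<bar>K s i j - w i j\<bar>) \<le> ?bound y" .
    moreover have "0 \<le> A s (\<lambda>j. \<bar>K s i j - w i j\<bar>)" by (rule A_nonneg) simp
    ultimately show ?case by (simp add: y)
  qed
  then show ?thesis by (rule Lim_null_comparison[OF _ lim])
qed

lemma kap_tendsto: "((\<lambda>(s, i). A s (K s i)) \<longlongrightarrow> \<gamma>) \<F>"
  by (rule tendsto_by_A_bound[OF K_close W_tendsto])

section \<open>Normalised entries and their action on vectors\<close>

text \<open>The matrix \<open>Hmat\<close> times the number of samples. The divisor belongs to the
  column index \<open>j\<close>, so comparing \<open>L\<close> with its limit calls for a lower
  bound on the row averages of \<open>K\<close> over all rows together.\<close>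

definition L :: "nat \<Rightarrow> nat \<Rightarrow> nat \<Rightarrow> real" where "L s i j = K s i j / A s (K s j)"

lemma kap_large: "\<forall>\<^sub>F (s, i) in \<F>. \<forall>j\<in>idx s (N s). \<gamma> / 2 \<le> A s (K s j)"
proof -
  have "\<forall>\<^sub>F y in \<F>. \<gamma> / 2 \<le> (case y of (s, i) \<Rightarrow> A s (K s i))"
    using order_tendstoD(1)[OF kap_tendsto, of "\<gamma> / 2"] \<gamma>_pos by (auto elim: eventually_mono)
  from eventually_all_rows[OF this] show ?thesis by simp
qed

lemma L_close: "((\<lambda>(s, i). A s (\<lambda>j. \<bar>L s i j - w i j / \<gamma>\<bar>)) \<longlongrightarrow> 0) \<F>"
proof -
  have inv: "((\<lambda>(s, i). \<bar>1 / A s (K s i) - 1 / \<gamma>\<bar>) \<longlongrightarrow> 0) \<F>"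
    using tendsto_rabs[OF tendsto_diff[OF tendsto_divide[OF tendsto_const kap_tendsto] tendsto_const], of 1 "1 / \<gamma>"] \<gamma>_pos
    by (simp add: case_prod_unfold)
  let ?bound = "\<lambda>y. 2 / \<gamma> * (case y of (s, i) \<Rightarrow> A s (\<lambda>j. \<bar>K s i j - w i j\<bar>))
      + (case y of (s, i) \<Rightarrow> A s (\<lambda>j. case (s, j) of (s, i) \<Rightarrow> \<bar>1 / A s (K s i) - 1 / \<gamma>\<bar>))"
  have "(?bound \<longlongrightarrow> 2 / \<gamma> * 0 + 0) \<F>" by (intro tendsto_intros K_close tendsto_A_rows inv)
  then have lim: "(?bound \<longlongrightarrow> 0) \<F>" by simp
  have "\<forall>\<^sub>F y in \<F>. norm (case y of (s, i) \<Rightarrow> A s (\<lambda>j. \<bar>L s i j - w i j / \<gamma>\<bar>)) \<le> ?bound y"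
    using kap_large
  proof eventually_elim
    case (elim y)
    obtain s i where y: "y = (s, i)" by (cases y)
    have pw: "\<bar>L s i j - w i j / \<gamma>\<bar> \<le> 2 / \<gamma> * \<bar>K s i j - w i j\<bar> + \<bar>1 / A s (K s j) - 1 / \<gamma>\<bar>"
      if j: "j \<in> idx s (N s)" for j
    proof -
      have k: "\<gamma> / 2 \<le> A s (K s j)" using elim j by (auto simp: y)
      then have k0: "A s (K s j) > 0" using \<gamma>_pos by simp
      have "L s i j - w i j / \<gamma> = (K s i j - w i j) * (1 / A s (K s j)) + w i j * (1 / A s (K s j) - 1 / \<gamma>)"
        by (simp add: L_def algebra_simps)
      then have "\<bar>L s i j - w i j / \<gamma>\<bar> \<le> \<bar>(K s i j - w i j) * (1 / A s (K s j))\<bar> + \<bar>w i j * (1 / A s (K s j) - 1 / \<gamma>)\<bar>"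
        by (simp only: abs_triangle_ineq)
      also have "\<dots> \<le> \<bar>K s i j - w i j\<bar> * (2 / \<gamma>) + 1 * \<bar>1 / A s (K s j) - 1 / \<gamma>\<bar>"
        unfolding abs_mult
      proof (intro add_mono mult_mono)
        show "\<bar>1 / A s (K s j)\<bar> \<le> 2 / \<gamma>" using k k0 \<gamma>_pos by (simp add: field_simps)
        show "\<bar>w i j\<bar> \<le> 1" using w_bounds[of i j] by simp
      qed (use \<gamma>_pos in auto)
      finally show ?thesis by (simp add: mult.commute)
    qed
    have "A s (\<lambda>j. \<bar>L s i j - w i j / \<gamma>\<bar>) \<le> A s (\<lambda>j. 2 / \<gamma> * \<bar>K s i j - w i j\<bar> + \<bar>1 / A s (K s j) - 1 / \<gamma>\<bar>)"
      by (rule A_mono[OF pw])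
    also have "\<dots> = ?bound y" by (simp only: y prod.case A_add A_cmult)
    finally have "A s (\<lambda>j. \<bar>L s i j - w i j / \<gamma>\<bar>) \<le> ?bound y" .
    moreover have "0 \<le> A s (\<lambda>j. \<bar>L s i j - w i j / \<gamma>\<bar>)" by (rule A_nonneg) simp
    ultimately show ?case by (simp add: y)
  qed
  then show ?thesis by (rule Lim_null_comparison[OF _ lim])
qed

lemma L_row_sum_tendsto: "((\<lambda>(s, i). A s (L s i)) \<longlongrightarrow> 1) \<F>"
proof (rule tendsto_by_A_bound[OF L_close])
  have "A s (\<lambda>j. w i j / \<gamma>) = (1 / \<gamma>) * A s (w i)" for s i
    unfolding A_cmult[symmetric] by (simp add: mult.commute)
  then show "((\<lambda>(s, i). A s (\<lambda>j. w i j / \<gamma>)) \<longlongrightarrow> 1) \<F>"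
    using tendsto_mult[OF tendsto_const W_tendsto, of "1 / \<gamma>"] \<gamma>_pos by (simp add: case_prod_unfold)
qed

lemma Pmat_apply_eq:
  "Pmat_apply m s (N s) \<epsilon> x \<phi> i = A s (\<lambda>j. of_real (L s i j) * \<phi> j) / of_real (A s (L s i))"
proof -
  let ?n = "real (N s - s + 1)"
  have n: "?n > 0" by simp
  have H: "Hmat m s (N s) \<epsilon> x i j = (1 / ?n) * L s i j" for i j
    using n by (simp add: Hmat_def L_def A_def K_def)
  define r where "r = 1 / ?n"
  have r: "r \<noteq> 0" using n by (simp add: r_def)
  define S where "S = (\<Sum>k\<in>idx s (N s). L s i k)"
  have "(\<Sum>k\<in>idx s (N s). r * L s i k) = r * S" by (simp add: S_def sum_distrib_left)
  then have "Pmat_apply m s (N s) \<epsilon> x \<phi> i = (\<Sum>j\<in>idx s (N s). of_real (L s i j) * \<phi> j) / of_real S"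
    using r unfolding Pmat_apply_def Pmat_def H r_def[symmetric] by (simp add: sum_divide_distrib)
  moreover have "A s (\<lambda>j. of_real (L s i j) * \<phi> j) = of_real r * (\<Sum>j\<in>idx s (N s). of_real (L s i j) * \<phi> j)"
    "A s (L s i) = r * S"
    unfolding A_def r_def[symmetric] by (simp_all add: S_def scaleR_conv_of_real)
  ultimately show ?thesis using r by simp
qed

text \<open>The entries converge only in row average, while \<open>\<phi>\<close> may be unbounded;
  so \<open>ui\<close> asks for uniform integrability along the rows. Below the level
  \<open>b\<close> convergence in average suffices. Above it the crude bound
  \<open>3 / \<gamma>\<close> on the entry errors is used: \<open>2 / \<gamma>\<close> for
  \<open>L\<close> and \<open>1 / \<gamma>\<close> for its limit.\<close>

theorem Pmat_apply_tendsto: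
  fixes \<phi> \<psi> :: "nat \<Rightarrow> complex"
  assumes close: "((\<lambda>(s, i). (1 / real (N s - s + 1)) *\<^sub>R (\<Sum>j\<in>idx s (N s). of_real (exp (- Dl i j / \<epsilon>)) * \<phi> j) - \<psi> i)
      \<longlongrightarrow> 0) \<F>"
    and ui: "\<And>\<delta>. \<delta> > 0 \<Longrightarrow> \<exists>b. \<forall>\<^sub>F s in sequentially. A s (\<lambda>j. max 0 (norm (\<phi> j) - b)) \<le> \<delta>"
    and \<psi>: "\<And>i. norm (\<psi> i) \<le> \<Psi>"
  shows "((\<lambda>(s, i). Pmat_apply m s (N s) \<epsilon> x \<phi> i - \<psi> i / of_real g) \<longlongrightarrow> 0) \<F>"
proof -
  let ?X = "\<lambda>(s, i). A s (\<lambda>j. of_real (L s i j) * \<phi> j)"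
  let ?V = "\<lambda>(s, i). A s (\<lambda>j. of_real (w i j / \<gamma>) * \<phi> j)"
  have V: "((\<lambda>y. ?V y - \<psi> (snd y) / of_real g) \<longlongrightarrow> 0) \<F>"
  proof -
    have "w i j / \<gamma> = (1 / g) * exp (- Dl i j / \<epsilon>)" for i j
      by (simp add: w_eq \<gamma>_def)
    then have "A s (\<lambda>j. of_real (w i j / \<gamma>) * \<phi> j) - \<psi> i / of_real g
        = (1 / g) *\<^sub>R ((1 / real (N s - s + 1)) *\<^sub>R (\<Sum>j\<in>idx s (N s). of_real (exp (- Dl i j / \<epsilon>)) * \<phi> j) - \<psi> i)" for s i
      unfolding A_def scaleR_diff_right
      by (simp only: scaleR_conv_of_real of_real_mult sum_distrib_left mult_ac) (simp add: field_simps)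
    then show ?thesis
      using tendsto_scaleR[OF tendsto_const close, of "1 / g"] by (simp add: case_prod_unfold)
  qed
  have XV: "((\<lambda>y. ?X y - ?V y) \<longlongrightarrow> 0) \<F>"
  proof (rule tendstoI)
    fix \<delta> :: real assume \<delta>: "\<delta> > 0"
    \<comment> \<open>With the entry bound \<open>3 / \<gamma>\<close> the excess over
      \<open>b\<close> contributes at most \<delta>/4.\<close>
    define \<eta> where "\<eta> = \<delta> * \<gamma> / 12"
    have \<eta>: "\<eta> > 0" using \<delta> \<gamma>_pos by (simp add: \<eta>_def)
    obtain b where b: "\<forall>\<^sub>F s in sequentially. A s (\<lambda>j. max 0 (norm (\<phi> j) - b)) \<le> \<eta>"
      using ui[OF \<eta>] by blast
    have bF: "\<forall>\<^sub>F y in \<F>. A (fst y) (\<lambda>j. max 0 (norm (\<phi> j) - b)) \<le> \<eta>"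
      by (rule eventually_compose_filterlim[OF b filterlim_fst_row_filter])
    have "((\<lambda>y. \<bar>b\<bar> * (case y of (s, i) \<Rightarrow> A s (\<lambda>j. \<bar>L s i j - w i j / \<gamma>\<bar>))) \<longlongrightarrow> \<bar>b\<bar> * 0) \<F>"
      by (intro tendsto_intros L_close)
    then have "\<forall>\<^sub>F y in \<F>. \<bar>b\<bar> * (case y of (s, i) \<Rightarrow> A s (\<lambda>j. \<bar>L s i j - w i j / \<gamma>\<bar>)) < \<delta> / 2"
      by (rule order_tendstoD(2)) (use \<delta> in simp)
    with bF kap_large show "\<forall>\<^sub>F y in \<F>. dist (?X y - ?V y) 0 < \<delta>"
    proof eventually_elim
      case (elim y)
      obtain s i where y: "y = (s, i)" by (cases y)
      have pw: "norm (of_real (L s i j) * \<phi> j - of_real (w i j / \<gamma>) * \<phi> j)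
          \<le> \<bar>b\<bar> * \<bar>L s i j - w i j / \<gamma>\<bar> + 3 / \<gamma> * max 0 (norm (\<phi> j) - b)" if j: "j \<in> idx s (N s)" for j
      proof -
        have k: "\<gamma> / 2 \<le> A s (K s j)" using elim j by (auto simp: y)
        then have k0: "A s (K s j) > 0" using \<gamma>_pos by simp
        have "0 \<le> L s i j" using K_bounds[of s i j] k0 by (simp add: L_def)
        moreover have "L s i j \<le> 2 / \<gamma>"
        proof -
          have "L s i j \<le> 1 / A s (K s j)" unfolding L_def using K_bounds[of s i j] k0 by (intro divide_right_mono) auto
          also have "\<dots> \<le> 2 / \<gamma>" using k k0 \<gamma>_pos by (simp add: field_simps)
          finally show ?thesis .
        qed
        moreover have "0 \<le> w i j / \<gamma>" "w i j / \<gamma> \<le> 1 / \<gamma>"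
          using w_bounds[of i j] \<gamma>_pos by (auto simp: divide_right_mono)
        moreover have "3 / \<gamma> = 2 / \<gamma> + 1 / \<gamma>" by (simp flip: add_divide_distrib)
        ultimately have le3: "\<bar>L s i j - w i j / \<gamma>\<bar> \<le> 3 / \<gamma>" unfolding abs_le_iff by linarith
        have "norm (of_real (L s i j) * \<phi> j - of_real (w i j / \<gamma>) * \<phi> j) = \<bar>L s i j - w i j / \<gamma>\<bar> * norm (\<phi> j)"
          by (simp only: left_diff_distrib[symmetric] of_real_diff[symmetric] norm_mult norm_of_real)
        also have "\<dots> \<le> \<bar>L s i j - w i j / \<gamma>\<bar> * (\<bar>b\<bar> + max 0 (norm (\<phi> j) - b))"
          by (intro mult_left_mono) auto
        also have "\<dots> \<le> \<bar>b\<bar> * \<bar>L s i j - w i j / \<gamma>\<bar> + 3 / \<gamma> * max 0 (norm (\<phi> j) - b)"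
          unfolding distrib_left using mult_right_mono[OF le3, of "max 0 (norm (\<phi> j) - b)"] by simp
        finally show ?thesis .
      qed
      have "norm (A s (\<lambda>j. of_real (L s i j) * \<phi> j - of_real (w i j / \<gamma>) * \<phi> j))
          \<le> A s (\<lambda>j. norm (of_real (L s i j) * \<phi> j - of_real (w i j / \<gamma>) * \<phi> j))"
        by (rule norm_A_le)
      also have "\<dots> \<le> A s (\<lambda>j. \<bar>b\<bar> * \<bar>L s i j - w i j / \<gamma>\<bar> + 3 / \<gamma> * max 0 (norm (\<phi> j) - b))"
        by (rule A_mono[OF pw])
      also have "\<dots> = \<bar>b\<bar> * A s (\<lambda>j. \<bar>L s i j - w i j / \<gamma>\<bar>) + 3 / \<gamma> * A s (\<lambda>j. max 0 (norm (\<phi> j) - b))"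
        by (simp only: A_add A_cmult)
      also have "\<dots> < \<delta>"
      proof -
        have "3 / \<gamma> * A s (\<lambda>j. max 0 (norm (\<phi> j) - b)) \<le> 3 / \<gamma> * \<eta>"
          using elim \<gamma>_pos by (intro mult_left_mono) (auto simp: y)
        also have "\<dots> = \<delta> / 4" using \<gamma>_pos by (simp add: \<eta>_def)
        finally show ?thesis using elim \<delta> by (simp add: y)
      qed
      finally show ?case by (simp add: y A_diff)
    qed
  qed
  have X: "((\<lambda>y. ?X y - \<psi> (snd y) / of_real g) \<longlongrightarrow> 0) \<F>"
    using tendsto_add[OF XV V] by (simp add: case_prod_unfold)
  have Y: "((\<lambda>(s, i). complex_of_real (A s (L s i))) \<longlongrightarrow> of_real 1) \<F>"
    using tendsto_of_real[OF L_row_sum_tendsto] by (simp add: case_prod_unfold)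
  have Z1: "((\<lambda>y. 1 / (case y of (s, i) \<Rightarrow> complex_of_real (A s (L s i))) - 1) \<longlongrightarrow> 0) \<F>"
    using tendsto_diff[OF tendsto_divide[OF tendsto_const Y] tendsto_const, of 1 1] by simp
  have Z2: "((\<lambda>y. \<psi> (snd y) / of_real g * (1 / (case y of (s, i) \<Rightarrow> complex_of_real (A s (L s i))) - 1)) \<longlongrightarrow> 0) \<F>"
  proof (rule Lim_null_comparison)
    show "\<forall>\<^sub>F y in \<F>. norm (\<psi> (snd y) / of_real g * (1 / (case y of (s, i) \<Rightarrow> complex_of_real (A s (L s i))) - 1))
        \<le> \<Psi> / g * norm (1 / (case y of (s, i) \<Rightarrow> complex_of_real (A s (L s i))) - 1)"
      unfolding norm_mult norm_divide using \<psi> g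
      by (intro always_eventually allI mult_right_mono) (auto simp: divide_right_mono)
    show "((\<lambda>y. \<Psi> / g * norm (1 / (case y of (s, i) \<Rightarrow> complex_of_real (A s (L s i))) - 1)) \<longlongrightarrow> 0) \<F>"
      by (intro tendsto_mult_right_zero tendsto_norm_zero Z1)
  qed
  have "((\<lambda>y. (?X y - \<psi> (snd y) / of_real g) / (case y of (s, i) \<Rightarrow> complex_of_real (A s (L s i)))
      + \<psi> (snd y) / of_real g * (1 / (case y of (s, i) \<Rightarrow> complex_of_real (A s (L s i))) - 1)) \<longlongrightarrow> 0 / of_real 1 + 0) \<F>"
    by (intro tendsto_add tendsto_divide X Y Z2) simp
  then show ?thesis
    by (simp add: case_prod_unfold Pmat_apply_eq diff_divide_distrib right_diff_distrib)
qed

end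

section \<open>Observational noise\<close>

text \<open>The exponent leaves room on both sides: the windows stay long enough for the law of large numbers
  to hold uniformly over all of them, and \<open>\<Sum>s. 1 / N s\<close> converges.\<close>

definition sample_count :: "nat \<Rightarrow> nat" where
  "sample_count s = nat \<lceil>real s powr (6/5)\<rceil>"

lemma sample_count_bounds:
  "real s powr (6/5) \<le> real (sample_count s)" "real (sample_count s) \<le> real s powr (6/5) + 1"
proof -
  have "- 1 < real s powr (6/5)" using powr_ge_zero[of "real s" "6/5"] by linarith
  then have "0 \<le> \<lceil>real s powr (6/5)\<rceil>" by simp
  then have "real (sample_count s) = of_int \<lceil>real s powr (6/5)\<rceil>" by (simp add: sample_count_def)
  then show "real s powr (6/5) \<le> real (sample_count s)" "real (sample_count s) \<le> real s powr (6/5) + 1"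
    by linarith+
qed

lemma sample_count_ratio: "filterlim (\<lambda>s. real (sample_count s) / real s) at_top sequentially"
proof (rule filterlim_at_top_mono)
  show "filterlim (\<lambda>s. real s powr (6/5) / real s) at_top sequentially" by real_asymp
  show "\<forall>\<^sub>F s in sequentially. real s powr (6/5) / real s \<le> real (sample_count s) / real s"
    by (intro always_eventually allI divide_right_mono sample_count_bounds) simp
qed

lemma sample_count_large:
  "\<forall>\<^sub>F s in sequentially. 1 \<le> s \<and> s \<le> sample_count s \<and>
    real (sample_count s) \<le> 2 * real (sample_count s - s + 1)"
proof -
  have "\<forall>\<^sub>F s in sequentially. 2 * real s \<le> real s powr (6/5)" by real_asymp
  then show ?thesis using eventually_ge_at_top[of 1]
  proof eventually_elim
    case (elim s)
    have "2 * real s \<le> real (sample_count s)" using elim sample_count_bounds(1)[of s] by linarith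
    moreover then have "s \<le> sample_count s" by linarith
    ultimately show ?case using elim by (simp add: of_nat_diff)
  qed
qed

text \<open>The exponents 6/5 and 4/5 multiply to 24/25, which is less than 1.\<close>

lemma sample_count_growth:
  "(\<lambda>s. (real (sample_count s) + 1) powr (4/5) / real s) \<longlonglongrightarrow> 0"
proof (rule Lim_null_comparison)
  show "(\<lambda>s. (real s powr (6/5) + 2) powr (4/5) / real s) \<longlonglongrightarrow> 0" by real_asymp
  show "\<forall>\<^sub>F s in sequentially. norm ((real (sample_count s) + 1) powr (4/5) / real s)
      \<le> (real s powr (6/5) + 2) powr (4/5) / real s"
  proof (intro always_eventually allI)
    fix s
    have "(real (sample_count s) + 1) powr (4/5) \<le> (real s powr (6/5) + 2) powr (4/5)"
      using sample_count_bounds(2)[of s] by (intro powr_mono2) auto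
    then show "norm ((real (sample_count s) + 1) powr (4/5) / real s)
      \<le> (real s powr (6/5) + 2) powr (4/5) / real s" by (simp add: divide_right_mono)
  qed
qed

lemma summable_inverse_sample_count: "summable (\<lambda>s. 1 / real (sample_count s - s + 1))"
proof (rule summable_comparison_test_ev)
  have "summable (\<lambda>s. real s powr (- (6/5)))" by (simp add: summable_real_powr_iff)
  from summable_mult[OF this, of 2] show "summable (\<lambda>s. 2 * real s powr (- (6/5)))" .
  show "\<forall>\<^sub>F s in sequentially. norm (1 / real (sample_count s - s + 1)) \<le> 2 * real s powr (- (6/5))"
    using sample_count_large
  proof eventually_elim
    case (elim s)
    have pos: "real s powr (6/5) > 0" using elim by simp
    have "real s powr (6/5) \<le> 2 * real (sample_count s - s + 1)"
      using elim sample_count_bounds(1)[of s] by linarith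
    then have "2 / (2 * real (sample_count s - s + 1)) \<le> 2 / real s powr (6/5)"
      using pos by (intro frac_le) auto
    moreover have "2 / (2 * t) = 1 / t" for t :: real by simp
    moreover have "2 / real s powr (6/5) = 2 * real s powr (- (6/5))"
      unfolding powr_minus divide_inverse ..
    ultimately have "1 / real (sample_count s - s + 1) \<le> 2 * real s powr (- (6/5))"
      by (simp only:)
    then show ?case by simp
  qed
qed

section \<open>Empirical autocovariances of the noise\<close>

text \<open>The squared Frobenius norm, divided by the square of \<open>s\<close>, of the
  off-diagonal part of the empirical autocovariance matrix of all windows of length \<open>s\<close>
  in the sample. The diagonal carries the variance and is treated apart.\<close>

definition autocovariance_error :: "(nat \<Rightarrow> nat) \<Rightarrow> (nat \<Rightarrow> real) \<Rightarrow> nat \<Rightarrow> real" where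
  "autocovariance_error N x s = (1 / (real s)\<^sup>2) * (\<Sum>p<s. \<Sum>q<s.
    if p = q then 0 else ((1 / real (N s - s + 1)) * (\<Sum>l<N s - s + 1. x (l + p) * x (l + q)))\<^sup>2)"

context prob_space
begin

lemma indep_product_expectation:
  fixes x :: "nat \<Rightarrow> 'a \<Rightarrow> real"
  assumes ind: "indep_vars (\<lambda>_. borel) x UNIV" and int: "\<And>i. integrable M (x i)" and ne: "i \<noteq> j"
  shows "expectation (\<lambda>\<omega>. x i \<omega> * x j \<omega>) = expectation (x i) * expectation (x j)"
proof -
  have "indep_var (Pi\<^sub>M {i} (\<lambda>_. borel)) (\<lambda>\<omega>. restrict (\<lambda>k. x k \<omega>) {i})
      (Pi\<^sub>M {j} (\<lambda>_. borel)) (\<lambda>\<omega>. restrict (\<lambda>k. x k \<omega>) {j})"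
    using ne by (intro indep_var_restrict[OF ind]) auto
  then have "indep_var borel ((\<lambda>f. f i) \<circ> (\<lambda>\<omega>. restrict (\<lambda>k. x k \<omega>) {i}))
      borel ((\<lambda>f. f j) \<circ> (\<lambda>\<omega>. restrict (\<lambda>k. x k \<omega>) {j}))"
    by (rule indep_var_compose) measurable
  then have "indep_var borel (x i) borel (x j)" by (simp add: comp_def)
  from indep_var_lebesgue_integral[OF this int int] show ?thesis .
qed

text \<open>The weights \<open>t\<close> will be real and imaginary parts of powers of an
  eigenvalue; bounded deterministic factors keep the summands orthogonal and their second moments
  bounded.\<close>

lemma weighted_indep_sum_growth:
  fixes x :: "nat \<Rightarrow> 'a \<Rightarrow> real" and t :: "nat \<Rightarrow> real"
  assumes ind: "indep_vars (\<lambda>_. borel) x UNIV" and int1: "\<And>i. integrable M (x i)"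
    and zero: "\<And>i. expectation (x i) = 0" and int2: "\<And>i. integrable M (\<lambda>\<omega>. (x i \<omega>)\<^sup>2)"
    and V: "\<And>i. expectation (\<lambda>\<omega>. (x i \<omega>)\<^sup>2) \<le> V" and t: "\<And>i. \<bar>t i\<bar> \<le> 1"
  shows "AE \<omega> in M. \<exists>C. \<forall>n. \<bar>\<Sum>i<n. t i * x i \<omega>\<bar> \<le> C * (real n + 1) powr (4/5)"
proof (rule orthogonal_sum_growth)
  have [measurable]: "x i \<in> borel_measurable M" for i using int1 by auto
  have int: "integrable M (\<lambda>\<omega>. x i \<omega> * x j \<omega>)" for i j
    by (rule Bochner_Integration.integrable_bound[of _ "\<lambda>\<omega>. (x i \<omega>)\<^sup>2 + (x j \<omega>)\<^sup>2"])
      (use abs_mult_le_squares in \<open>auto intro!: Bochner_Integration.integrable_add int2 AE_I2 intro: order_trans[OF _ abs_ge_self]\<close>)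
  have eq: "t i * x i \<omega> * (t j * x j \<omega>) = (t i * t j) * (x i \<omega> * x j \<omega>)" for i j \<omega> by simp
  show "integrable M (\<lambda>\<omega>. t i * x i \<omega> * (t j * x j \<omega>))" for i j
    unfolding eq by (intro integrable_mult_right int)
  show "expectation (\<lambda>\<omega>. t i * x i \<omega> * (t j * x j \<omega>)) = 0" if "i \<noteq> j" for i j
    unfolding eq using indep_product_expectation[OF ind int1 that] by (simp add: zero)
  show "expectation (\<lambda>\<omega>. t i * x i \<omega> * (t i * x i \<omega>)) \<le> V" for i
  proof -
    have "t i * t i \<le> 1" using t[of i] by (simp add: abs_square_le_1 flip: power2_eq_square)
    then have "(t i * t i) * expectation (\<lambda>\<omega>. (x i \<omega>)\<^sup>2) \<le> 1 * expectation (\<lambda>\<omega>. (x i \<omega>)\<^sup>2)"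
      by (intro mult_right_mono integral_nonneg_AE) auto
    then show ?thesis unfolding eq using V[of i] by (simp add: power2_eq_square)
  qed
qed

text \<open>For n windows every squared off-diagonal entry has expectation at most 4V/n, hence so
  does their mean over all entries; by \<open>sN\<close> these bounds are summable over
  \<open>s\<close>.\<close>

lemma autocovariance_error_tendsto:
  fixes x :: "nat \<Rightarrow> 'a \<Rightarrow> real"
  assumes ind: "indep_vars (\<lambda>_. borel) x UNIV"
    and int1: "\<And>i. integrable M (x i)" and zero: "\<And>i. expectation (x i) = 0"
    and int3: "\<And>i. integrable M (\<lambda>\<omega>. \<bar>x i \<omega>\<bar> ^ 3)"
    and int4: "\<And>i. integrable M (\<lambda>\<omega>. x i \<omega> ^ 4)" and V: "\<And>i. expectation (\<lambda>\<omega>. x i \<omega> ^ 4) \<le> V"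
    and sN: "summable (\<lambda>s. 1 / real (N s - s + 1))"
  shows "AE \<omega> in M. autocovariance_error N (\<lambda>i. x i \<omega>) \<longlonglongrightarrow> 0"
proof -
  note lag = lagged_product_sum_bound[OF ind int1 zero int3 int4 V]
  have V0: "V \<ge> 0"
  proof -
    have "0 \<le> expectation (\<lambda>\<omega>. x 0 \<omega> ^ 4)" by (rule integral_nonneg_AE) auto
    from order_trans[OF this V] show ?thesis .
  qed
  define g where "g s \<omega> = autocovariance_error N (\<lambda>i. x i \<omega>) s" for s \<omega>
  define n where "n s = N s - s + 1" for s
  have n: "real (n s) > 0" for s by (simp add: n_def)
  have gdef: "g s \<omega> = (1 / (real s)\<^sup>2) * (\<Sum>p<s. \<Sum>q<s.
    if p = q then 0 else (1 / real (n s))\<^sup>2 * (\<Sum>l<n s. x (l + p) \<omega> * x (l + q) \<omega>)\<^sup>2)" for s \<omega>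
    unfolding g_def autocovariance_error_def n_def[symmetric] power_mult_distrib ..
  have ip: "integrable M (\<lambda>\<omega>. if p = q then 0 else (1 / real (n s))\<^sup>2 * (\<Sum>l<n s. x (l + p) \<omega> * x (l + q) \<omega>)\<^sup>2)" for p q s
    using lag(1) by (cases "p = q") auto
  have ep: "expectation (\<lambda>\<omega>. if p = q then 0 else (1 / real (n s))\<^sup>2 * (\<Sum>l<n s. x (l + p) \<omega> * x (l + q) \<omega>)\<^sup>2)
      \<le> 4 * V / real (n s)" for p q s
  proof (cases "p = q")
    case False
    then have "(1 / real (n s))\<^sup>2 * expectation (\<lambda>\<omega>. (\<Sum>l<n s. x (l + p) \<omega> * x (l + q) \<omega>)\<^sup>2)
        \<le> (1 / real (n s))\<^sup>2 * (4 * V * real (n s))"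
      by (intro mult_left_mono lag(2)) auto
    also have "\<dots> = 4 * V / real (n s)" using n[of s] by (simp add: power2_eq_square)
    finally show ?thesis using False by simp
  qed (use V0 n in simp)
  have gint: "integrable M (g s)" for s
    unfolding gdef by (intro integrable_mult_right Bochner_Integration.integrable_sum ip)
  have gnn: "g s \<omega> \<ge> 0" for s \<omega>
    unfolding gdef by (intro mult_nonneg_nonneg sum_nonneg) auto
  have gle: "expectation (g s) \<le> 4 * V * (1 / real (n s))" for s
  proof -
    have "expectation (g s) = (1 / (real s)\<^sup>2) * (\<Sum>p<s. \<Sum>q<s.
        expectation (\<lambda>\<omega>. if p = q then 0 else (1 / real (n s))\<^sup>2 * (\<Sum>l<n s. x (l + p) \<omega> * x (l + q) \<omega>)\<^sup>2))"
      unfolding gdef using ip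
      by (subst integral_mult_right_zero)
        (simp add: Bochner_Integration.integral_sum Bochner_Integration.integrable_sum)
    also have "\<dots> \<le> (1 / (real s)\<^sup>2) * (\<Sum>p<s. \<Sum>q<s. 4 * V / real (n s))"
      by (intro mult_left_mono sum_mono ep) auto
    also have "\<dots> \<le> 4 * V * (1 / real (n s))"
      using V0 n[of s] by (cases "s = 0") (simp_all add: power2_eq_square)
    finally show ?thesis .
  qed
  have "summable (\<lambda>s. expectation (g s))"
  proof (rule summable_comparison_test'[where N = 0])
    show "summable (\<lambda>s. 4 * V * (1 / real (n s)))" unfolding n_def by (rule summable_mult[OF sN])
    show "norm (expectation (g s)) \<le> 4 * V * (1 / real (n s))" for s
      using gle[of s] gnn by (simp only: real_norm_def abs_of_nonneg integral_nonneg_AE AE_I2)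
  qed
  from AE_summable[OF gint gnn this] show ?thesis
    by eventually_elim (auto simp: g_def dest: summable_LIMSEQ_zero)
qed

end

text \<open>There are countably many characters and coordinates, so one null set serves them all,
  and it does not involve the starting state. Fourth moments enter through the variance of the
  squared norms and through the lagged products.\<close>

theorem iid_noise_AE:
  fixes \<xi> :: "nat \<Rightarrow> 'w \<Rightarrow> real ^ 'd" and z :: "'q::countable \<Rightarrow> complex"
  assumes W: "prob_space W" and noise: "iid_noise W \<xi> R" and z: "\<And>q. norm (z q) = 1"
    and sN: "summable (\<lambda>s. 1 / real (N s - s + 1))"
  shows "AE \<omega> in W. (\<exists>C. \<forall>n. \<bar>\<Sum>l<n. (norm (\<xi> l \<omega>))\<^sup>2 - R\<^sup>2\<bar> \<le> C * (real n + 1) powr (4/5)) \<and>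
    (\<forall>q c. \<exists>C. \<forall>n. norm (\<Sum>l<n. z q ^ l * complex_of_real (\<xi> l \<omega> $ c)) \<le> C * (real n + 1) powr (4/5)) \<and>
    (\<forall>c. autocovariance_error N (\<lambda>l. \<xi> l \<omega> $ c) \<longlonglongrightarrow> 0)"
proof -
  interpret prob_space W by (rule W)
  have ind: "indep_vars (\<lambda>_. borel) \<xi> UNIV" and same: "\<And>i. distr W borel (\<xi> i) = distr W borel (\<xi> 0)"
    and int: "\<And>i. integrable W (\<xi> i)" and mean: "\<And>i. expectation (\<xi> i) = 0"
    and int2: "\<And>i. integrable W (\<lambda>\<omega>. (norm (\<xi> i \<omega>))\<^sup>2)"
    and var: "\<And>i. expectation (\<lambda>\<omega>. (norm (\<xi> i \<omega>))\<^sup>2) = R\<^sup>2"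
    and int3: "\<And>i. integrable W (\<lambda>\<omega>. norm (\<xi> i \<omega>) ^ 3)"
    and int4: "\<And>i. integrable W (\<lambda>\<omega>. norm (\<xi> i \<omega>) ^ 4)"
    using noise unfolding iid_noise_def by auto
  have [measurable]: "\<xi> i \<in> borel_measurable W" for i using int by auto
  define V where "V = expectation (\<lambda>\<omega>. norm (\<xi> 0 \<omega>) ^ 4)"
  have V: "expectation (\<lambda>\<omega>. norm (\<xi> i \<omega>) ^ 4) = V" for i
  proof -
    have "expectation (\<lambda>\<omega>. norm (\<xi> i \<omega>) ^ 4) = (\<integral>y. norm y ^ 4 \<partial>distr W borel (\<xi> i))"
      by (rule integral_distr[symmetric]) auto
    also have "\<dots> = (\<integral>y. norm y ^ 4 \<partial>distr W borel (\<xi> 0))" by (simp only: same[of i])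
    also have "\<dots> = V" unfolding V_def by (rule integral_distr) auto
    finally show ?thesis .
  qed
  have W1: "AE \<omega> in W. \<exists>C. \<forall>n. \<bar>\<Sum>l<n. 1 * ((norm (\<xi> l \<omega>))\<^sup>2 - R\<^sup>2)\<bar> \<le> C * (real n + 1) powr (4/5)"
  proof (rule weighted_indep_sum_growth)
    show "indep_vars (\<lambda>_. borel) (\<lambda>l \<omega>. (norm (\<xi> l \<omega>))\<^sup>2 - R\<^sup>2) UNIV"
      by (rule indep_vars_compose2[OF ind, of "\<lambda>_ y. (norm y)\<^sup>2 - R\<^sup>2"]) simp
    have sq: "((norm (\<xi> i \<omega>))\<^sup>2 - R\<^sup>2)\<^sup>2 = norm (\<xi> i \<omega>) ^ 4 - 2 * R\<^sup>2 * (norm (\<xi> i \<omega>))\<^sup>2 + R ^ 4" for i \<omega>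
      by (simp add: power2_eq_square power4_eq_xxxx algebra_simps)
    show "integrable W (\<lambda>\<omega>. ((norm (\<xi> i \<omega>))\<^sup>2 - R\<^sup>2)\<^sup>2)" for i
      unfolding sq using int2 int4 by auto
    show "expectation (\<lambda>\<omega>. ((norm (\<xi> i \<omega>))\<^sup>2 - R\<^sup>2)\<^sup>2) \<le> V - 2 * R\<^sup>2 * R\<^sup>2 + R ^ 4" for i
      unfolding sq using int2[of i] int4[of i] by (simp add: V var prob_space)
  qed (use int2 var in \<open>auto simp: prob_space\<close>)
  have coord: "\<bar>\<xi> i \<omega> $ c\<bar> ^ k \<le> norm (\<xi> i \<omega>) ^ k" for i \<omega> c k
    by (intro power_mono component_le_norm_cart) simp
  have x_ind: "indep_vars (\<lambda>_. borel) (\<lambda>l \<omega>. \<xi> l \<omega> $ c) UNIV" for c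
    by (rule indep_vars_compose2[OF ind, of "\<lambda>_ y. y $ c"]) simp
  have x_int: "integrable W (\<lambda>\<omega>. \<xi> i \<omega> $ c)" and x_zero: "expectation (\<lambda>\<omega>. \<xi> i \<omega> $ c) = 0" for i c
    using integrable_bounded_linear[OF bounded_linear_vec_nth int[of i]]
      integral_bounded_linear[OF bounded_linear_vec_nth[of c] int[of i]] mean[of i] by auto
  have [measurable]: "(\<lambda>\<omega>. \<xi> i \<omega> $ c) \<in> borel_measurable W" for i c using x_int by auto
  have x_int2: "integrable W (\<lambda>\<omega>. (\<xi> i \<omega> $ c)\<^sup>2)" for i c
    by (rule Bochner_Integration.integrable_bound[OF int2[of i]]) (use coord[of i _ c 2] in \<open>auto simp: power2_abs\<close>)
  have x_int3: "integrable W (\<lambda>\<omega>. \<bar>\<xi> i \<omega> $ c\<bar> ^ 3)" for i c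
    by (rule Bochner_Integration.integrable_bound[OF int3[of i]]) (use coord[of i _ c 3] in auto)
  have x_int4: "integrable W (\<lambda>\<omega>. (\<xi> i \<omega> $ c) ^ 4)" for i c
    by (rule Bochner_Integration.integrable_bound[OF int4[of i]]) (use coord[of i _ c 4] in auto)
  have x_var: "expectation (\<lambda>\<omega>. (\<xi> i \<omega> $ c)\<^sup>2) \<le> R\<^sup>2" for i c
    unfolding var[of i, symmetric] by (intro integral_mono x_int2 int2) (use coord[of i _ c 2] in simp)
  have x_four: "expectation (\<lambda>\<omega>. (\<xi> i \<omega> $ c) ^ 4) \<le> V" for i c
    unfolding V[of i, symmetric] by (intro integral_mono x_int4 int4) (use coord[of i _ c 4] in simp)
  have W2: "AE \<omega> in W. \<exists>C. \<forall>n. norm (\<Sum>l<n. z q ^ l * complex_of_real (\<xi> l \<omega> $ c)) \<le> C * (real n + 1) powr (4/5)" for q c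
  proof -
    have zl: "\<bar>Re (z q ^ l)\<bar> \<le> 1" "\<bar>Im (z q ^ l)\<bar> \<le> 1" for l
      using abs_Re_le_cmod[of "z q ^ l"] abs_Im_le_cmod[of "z q ^ l"] z[of q] by (simp_all add: norm_power)
    have "AE \<omega> in W. \<exists>C. \<forall>n. \<bar>\<Sum>l<n. Re (z q ^ l) * (\<xi> l \<omega> $ c)\<bar> \<le> C * (real n + 1) powr (4/5)"
      "AE \<omega> in W. \<exists>C. \<forall>n. \<bar>\<Sum>l<n. Im (z q ^ l) * (\<xi> l \<omega> $ c)\<bar> \<le> C * (real n + 1) powr (4/5)"
      by (rule weighted_indep_sum_growth[OF x_ind x_int x_zero x_int2 x_var]; rule zl)+
    then show ?thesis
    proof eventually_elim
      case (elim \<omega>)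
      then obtain C D where C: "\<And>n. \<bar>\<Sum>l<n. Re (z q ^ l) * (\<xi> l \<omega> $ c)\<bar> \<le> C * (real n + 1) powr (4/5)"
        and D: "\<And>n. \<bar>\<Sum>l<n. Im (z q ^ l) * (\<xi> l \<omega> $ c)\<bar> \<le> D * (real n + 1) powr (4/5)" by blast
      show ?case
      proof (intro exI allI)
        fix n
        let ?S = "\<Sum>l<n. z q ^ l * complex_of_real (\<xi> l \<omega> $ c)"
        have "norm ?S \<le> \<bar>Re ?S\<bar> + \<bar>Im ?S\<bar>" by (rule cmod_le)
        also have "\<dots> \<le> (C + D) * (real n + 1) powr (4/5)"
          using C[of n] D[of n] by (simp add: distrib_right)
        finally show "norm ?S \<le> (C + D) * (real n + 1) powr (4/5)" .
      qed
    qed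
  qed
  have W3: "AE \<omega> in W. autocovariance_error N (\<lambda>l. \<xi> l \<omega> $ c) \<longlonglongrightarrow> 0" for c
    by (rule autocovariance_error_tendsto[OF x_ind x_int x_zero x_int3 x_int4 x_four sN])
  have "AE \<omega> in W. \<forall>q c. \<exists>C. \<forall>n. norm (\<Sum>l<n. z q ^ l * complex_of_real (\<xi> l \<omega> $ c)) \<le> C * (real n + 1) powr (4/5)"
    unfolding AE_all_countable using W2 by blast
  moreover have "AE \<omega> in W. \<forall>c. autocovariance_error N (\<lambda>l. \<xi> l \<omega> $ c) \<longlonglongrightarrow> 0"
    unfolding AE_all_countable using W3 by blast
  ultimately show ?thesis using W1 by eventually_elim simp
qed

section \<open>Windows of a single noise path\<close>

text \<open>A window sum is the difference of two initial sums of length at most \<open>N s\<close>,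
  so the growth bound makes it o(s) for all windows at once.\<close>

lemma window_average_small:
  fixes y :: "nat \<Rightarrow> 'b::real_normed_vector"
  assumes bound: "\<And>n. norm (\<Sum>l<n. y l) \<le> C * (real n + 1) powr (4/5)"
    and N: "\<forall>\<^sub>F s in sequentially. 1 \<le> s \<and> s \<le> N s \<and> real (N s) \<le> 2 * real (N s - s + 1)"
    and growth: "(\<lambda>s. (real (N s) + 1) powr (4/5) / real s) \<longlonglongrightarrow> 0" and \<delta>: "\<delta> > 0"
  shows "\<forall>\<^sub>F s in sequentially. \<forall>i\<in>idx s (N s). norm ((1 / real s) *\<^sub>R (\<Sum>k<s. y (i - k))) \<le> \<delta>"
proof -
  have "(\<lambda>s. 2 * \<bar>C\<bar> * ((real (N s) + 1) powr (4/5) / real s)) \<longlonglongrightarrow> 2 * \<bar>C\<bar> * 0"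
    by (intro tendsto_intros growth)
  then have "\<forall>\<^sub>F s in sequentially. 2 * \<bar>C\<bar> * ((real (N s) + 1) powr (4/5) / real s) < \<delta>"
    by (rule order_tendstoD(2)) (use \<delta> in simp)
  then show ?thesis using N
  proof eventually_elim
    case (elim s)
    show ?case
    proof
      fix i assume i: "i \<in> idx s (N s)"
      then have ib: "s \<le> i + 1" "i < N s" by (auto simp: idx_def)
      have S: "norm (\<Sum>l<n. y l) \<le> \<bar>C\<bar> * (real (N s) + 1) powr (4/5)" if "n \<le> N s" for n
      proof -
        have "C * (real n + 1) powr (4/5) \<le> \<bar>C\<bar> * (real (N s) + 1) powr (4/5)"
          using that by (intro mult_mono powr_mono2) auto
        with bound[of n] show ?thesis by linarith
      qed
      have "(\<Sum>k<s. y (i - k)) = (\<Sum>l\<in>{i + 1 - s..<i + 1}. y l)"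
        by (rule sum.reindex_bij_witness[of _ "\<lambda>l. i - l" "\<lambda>k. i - k"]) (use ib in auto)
      also have "\<dots> = (\<Sum>l<i + 1. y l) - (\<Sum>l<i + 1 - s. y l)"
        using sum.atLeastLessThan_concat[of 0 "i + 1 - s" "i + 1" y]
        by (simp add: atLeast0LessThan algebra_simps)
      finally have "norm (\<Sum>k<s. y (i - k)) \<le> norm (\<Sum>l<i + 1. y l) + norm (\<Sum>l<i + 1 - s. y l)"
        by (simp only: norm_triangle_ineq4)
      moreover have "i + 1 \<le> N s" "i + 1 - s \<le> N s" using ib by auto
      ultimately have "norm (\<Sum>k<s. y (i - k)) \<le> 2 * (\<bar>C\<bar> * (real (N s) + 1) powr (4/5))"
        using S[of "i + 1"] S[of "i + 1 - s"] by linarith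
      then have "norm (\<Sum>k<s. y (i - k)) / real s \<le> 2 * (\<bar>C\<bar> * (real (N s) + 1) powr (4/5)) / real s"
        by (rule divide_right_mono) simp
      then show "norm ((1 / real s) *\<^sub>R (\<Sum>k<s. y (i - k))) \<le> \<delta>" using elim by simp
    qed
  qed
qed

text \<open>Up to a factor, the left side is the quadratic form of the empirical autocovariance
  matrix at \<open>\<alpha>\<close>. Its diagonal is bounded through \<open>D\<close>, its
  off-diagonal part by Cauchy-Schwarz with the Frobenius norm. As \<open>\<alpha>\<close> is
  arbitrary it may be a window of the same noise \<open>x\<close>, without any independence between
  the two.\<close>

lemma mean_square_correlation_le:
  fixes \<alpha> x :: "nat \<Rightarrow> real"
  assumes s: "s \<ge> 1" and diag: "\<And>p. p < s \<Longrightarrow> (1 / real (N s - s + 1)) * (\<Sum>l<N s - s + 1. (x (l + p))\<^sup>2) \<le> D"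
  shows "(1 / real (N s - s + 1)) * (\<Sum>l<N s - s + 1. ((1 / real s) * (\<Sum>p<s. \<alpha> p * x (l + p)))\<^sup>2)
    \<le> ((1 / real s) * (\<Sum>p<s. (\<alpha> p)\<^sup>2)) * (sqrt (autocovariance_error N x s) + D / real s)"
proof -
  define n where "n = N s - s + 1"
  define C where "C p q = (1 / real n) * (\<Sum>l<n. x (l + p) * x (l + q))" for p q
  define C' where "C' p q = (if p = q then 0 else C p q)" for p q
  let ?A = "\<Sum>p<s. (\<alpha> p)\<^sup>2"
  have A0: "?A \<ge> 0" by (rule sum_nonneg) simp
  have err: "(\<Sum>p<s. \<Sum>q<s. (C' p q)\<^sup>2) = (real s)\<^sup>2 * autocovariance_error N x s"
    using s unfolding autocovariance_error_def n_def[symmetric] C_def[symmetric]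
    by (auto simp: C'_def intro!: sum.cong)
  have "(\<Sum>l<n. (\<Sum>p<s. \<alpha> p * x (l + p))\<^sup>2) = (\<Sum>l<n. \<Sum>p<s. \<Sum>q<s. \<alpha> p * \<alpha> q * (x (l + p) * x (l + q)))"
    by (simp add: power2_eq_square sum_product mult_ac)
  also have "\<dots> = (\<Sum>p<s. \<Sum>q<s. \<Sum>l<n. \<alpha> p * \<alpha> q * (x (l + p) * x (l + q)))"
    by (subst sum.swap) (simp only: sum.swap[of _ "{..<s}" "{..<n}"])
  finally have "(1 / real n) * (\<Sum>l<n. (\<Sum>p<s. \<alpha> p * x (l + p))\<^sup>2) = (\<Sum>p<s. \<Sum>q<s. \<alpha> p * \<alpha> q * C p q)"
    unfolding C_def by (simp add: sum_distrib_left mult_ac)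
  also have "\<dots> = (\<Sum>p<s. (\<alpha> p)\<^sup>2 * C p p) + (\<Sum>p<s. \<Sum>q<s. \<alpha> p * \<alpha> q * C' p q)"
  proof -
    have "\<alpha> p * \<alpha> q * C p q = (if q = p then (\<alpha> p)\<^sup>2 * C p p else 0) + \<alpha> p * \<alpha> q * C' p q" for p q
      by (simp add: C'_def power2_eq_square)
    then show ?thesis by (simp add: sum.distrib)
  qed
  also have "\<dots> \<le> ?A * D + ?A * (real s * sqrt (autocovariance_error N x s))"
  proof (rule add_mono)
    have "(\<Sum>p<s. (\<alpha> p)\<^sup>2 * C p p) \<le> (\<Sum>p<s. (\<alpha> p)\<^sup>2 * D)"
      using diag unfolding n_def[symmetric] C_def
      by (intro sum_mono mult_left_mono) (auto simp: power2_eq_square)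
    then show "(\<Sum>p<s. (\<alpha> p)\<^sup>2 * C p p) \<le> ?A * D" by (simp add: sum_distrib_right)
    have "(\<Sum>p<s. \<Sum>q<s. \<alpha> p * \<alpha> q * C' p q) = (\<Sum>y\<in>{..<s}\<times>{..<s}. (\<alpha> (fst y) * \<alpha> (snd y)) * C' (fst y) (snd y))"
      by (simp add: sum.cartesian_product case_prod_unfold)
    also have "\<dots> \<le> (\<Sum>y\<in>{..<s}\<times>{..<s}. \<bar>\<alpha> (fst y) * \<alpha> (snd y)\<bar> * \<bar>C' (fst y) (snd y)\<bar>)"
      by (intro sum_mono) (simp flip: abs_mult)
    also have "\<dots> \<le> L2_set (\<lambda>y. \<alpha> (fst y) * \<alpha> (snd y)) ({..<s}\<times>{..<s}) * L2_set (\<lambda>y. C' (fst y) (snd y)) ({..<s}\<times>{..<s})"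
      by (rule L2_set_mult_ineq)
    also have "L2_set (\<lambda>y. \<alpha> (fst y) * \<alpha> (snd y)) ({..<s}\<times>{..<s}) = ?A"
    proof -
      have "(\<Sum>y\<in>{..<s}\<times>{..<s}. (\<alpha> (fst y) * \<alpha> (snd y))\<^sup>2) = (\<Sum>p<s. \<Sum>q<s. (\<alpha> p)\<^sup>2 * (\<alpha> q)\<^sup>2)"
        by (simp add: sum.cartesian_product case_prod_unfold power_mult_distrib)
      also have "\<dots> = ?A\<^sup>2" by (simp add: power2_eq_square[of ?A] sum_product)
      finally show ?thesis using A0 by (simp add: L2_set_def)
    qed
    also have "L2_set (\<lambda>y. C' (fst y) (snd y)) ({..<s}\<times>{..<s}) = real s * sqrt (autocovariance_error N x s)"
    proof -
      have "(\<Sum>y\<in>{..<s}\<times>{..<s}. (C' (fst y) (snd y))\<^sup>2) = (real s)\<^sup>2 * autocovariance_error N x s"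
        unfolding err[symmetric] by (simp add: sum.cartesian_product case_prod_unfold)
      then show ?thesis by (simp add: L2_set_def real_sqrt_mult)
    qed
    finally show "(\<Sum>p<s. \<Sum>q<s. \<alpha> p * \<alpha> q * C' p q) \<le> ?A * (real s * sqrt (autocovariance_error N x s))" .
  qed
  finally have main: "(1 / real n) * (\<Sum>l<n. (\<Sum>p<s. \<alpha> p * x (l + p))\<^sup>2)
      \<le> ?A * D + ?A * (real s * sqrt (autocovariance_error N x s))" .
  have "(1 / real n) * (\<Sum>l<n. ((1 / real s) * (\<Sum>p<s. \<alpha> p * x (l + p)))\<^sup>2)
      = (1 / (real s)\<^sup>2) * ((1 / real n) * (\<Sum>l<n. (\<Sum>p<s. \<alpha> p * x (l + p))\<^sup>2))"
    unfolding power_mult_distrib sum_distrib_left[symmetric] by (simp add: power_divide)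
  also have "\<dots> \<le> (1 / (real s)\<^sup>2) * (?A * D + ?A * (real s * sqrt (autocovariance_error N x s)))"
    by (intro mult_left_mono main) simp
  also have "\<dots> = ((1 / real s) * ?A) * (sqrt (autocovariance_error N x s) + D / real s)"
    using s by (simp add: field_simps power2_eq_square)
  finally show ?thesis unfolding n_def .
qed

text \<open>A single realisation with the properties that hold almost surely, so that what follows
  is deterministic. \<open>lam\<close> is an abstract family of twists, later the eigenvalues of the
  characters.\<close>

locale noise_path =
  fixes N :: "nat \<Rightarrow> nat" and lam :: "'q \<Rightarrow> complex" and w :: "nat \<Rightarrow> real ^ 'd" and R :: real
  assumes N: "\<forall>\<^sub>F s in sequentially. 1 \<le> s \<and> s \<le> N s \<and> real (N s) \<le> 2 * real (N s - s + 1)"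
    and growth: "(\<lambda>s. (real (N s) + 1) powr (4/5) / real s) \<longlonglongrightarrow> 0"
    and variance_growth: "\<exists>C. \<forall>n. \<bar>\<Sum>l<n. (norm (w l))\<^sup>2 - R\<^sup>2\<bar> \<le> C * (real n + 1) powr (4/5)"
    and twisted_growth: "\<exists>C. \<forall>n. norm (\<Sum>l<n. lam q ^ l * complex_of_real (w l $ c)) \<le> C * (real n + 1) powr (4/5)"
    and autocovariance: "autocovariance_error N (\<lambda>l. w l $ c) \<longlonglongrightarrow> 0"
begin

lemma variance_window:
  assumes "\<delta> > 0"
  shows "\<forall>\<^sub>F s in sequentially. \<forall>i\<in>idx s (N s). \<bar>(1 / real s) * (\<Sum>k<s. (norm (w (i - k)))\<^sup>2) - R\<^sup>2\<bar> \<le> \<delta>"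
proof -
  obtain C where C: "\<And>n. norm (\<Sum>l<n. (norm (w l))\<^sup>2 - R\<^sup>2) \<le> C * (real n + 1) powr (4/5)"
    using variance_growth by auto
  from window_average_small[OF C N growth assms] N show ?thesis
  proof eventually_elim
    case (elim s)
    have "(1 / real s) *\<^sub>R (\<Sum>k<s. (norm (w (i - k)))\<^sup>2 - R\<^sup>2) = (1 / real s) * (\<Sum>k<s. (norm (w (i - k)))\<^sup>2) - R\<^sup>2" for i
      using elim(2) by (simp add: sum_subtractf right_diff_distrib)
    then show ?case using elim(1) by simp
  qed
qed

lemma coordinate_square_le: "(v $ c)\<^sup>2 \<le> (norm v)\<^sup>2" for v :: "real ^ 'd"
  using power_mono[OF component_le_norm_cart abs_ge_zero, of v c 2] unfolding power2_abs .

lemma coordinate_energy: "(\<Sum>k<s. (w (i - k) $ c)\<^sup>2) \<le> (\<Sum>k<s. (norm (w (i - k)))\<^sup>2)"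
  by (intro sum_mono coordinate_square_le)

lemma energy_window:
  "\<forall>\<^sub>F s in sequentially. \<forall>i\<in>idx s (N s). \<forall>c. (1 / real s) * (\<Sum>k<s. (w (i - k) $ c)\<^sup>2) \<le> R\<^sup>2 + 1"
  using variance_window[OF zero_less_one]
proof eventually_elim
  case (elim s)
  show ?case
  proof (intro ballI allI)
    fix i c assume "i \<in> idx s (N s)"
    then have "(1 / real s) * (\<Sum>k<s. (norm (w (i - k)))\<^sup>2) \<le> R\<^sup>2 + 1"
      using elim by (auto simp: abs_le_iff)
    moreover have "(1 / real s) * (\<Sum>k<s. (w (i - k) $ c)\<^sup>2) \<le> (1 / real s) * (\<Sum>k<s. (norm (w (i - k)))\<^sup>2)"
      by (intro mult_left_mono coordinate_energy) simp
    ultimately show "(1 / real s) * (\<Sum>k<s. (w (i - k) $ c)\<^sup>2) \<le> R\<^sup>2 + 1" by linarith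
  qed
qed

text \<open>Supplies the diagonal bound \<open>D\<close>: each shifted block lies within the first
  \<open>N s\<close> terms, whose mean energy is eventually at most \<open>R\<^sup>2 + 1\<close>,
  and \<open>N s\<close> is at most twice the block length.\<close>

lemma energy_total:
  "\<forall>\<^sub>F s in sequentially. \<forall>p<s. \<forall>c. (1 / real (N s - s + 1)) * (\<Sum>l<N s - s + 1. (w (l + p) $ c)\<^sup>2) \<le> 2 * R\<^sup>2 + 2"
proof -
  obtain C where C: "\<And>n. \<bar>\<Sum>l<n. (norm (w l))\<^sup>2 - R\<^sup>2\<bar> \<le> C * (real n + 1) powr (4/5)"
    using variance_growth by auto
  have "\<forall>\<^sub>F s in sequentially. (real (N s) + 1) powr (4/5) / real s < 1 / (\<bar>C\<bar> + 1)"
    by (rule order_tendstoD(2)[OF growth]) simp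
  then show ?thesis using N
  proof eventually_elim
    case (elim s)
    define n where "n = N s - s + 1"
    have n: "real n > 0" "real (N s) \<le> 2 * real n" using elim by (auto simp: n_def)
    have Ns: "real s \<le> real (N s)" using elim by simp
    have "C * (real (N s) + 1) powr (4/5) \<le> (\<bar>C\<bar> + 1) * (real (N s) + 1) powr (4/5)"
      by (intro mult_right_mono) auto
    also have "\<dots> \<le> real s" using elim by (simp add: field_simps)
    also have "\<dots> \<le> real (N s)" by (rule Ns)
    finally have "(\<Sum>l<N s. (norm (w l))\<^sup>2 - R\<^sup>2) \<le> real (N s)" using C[of "N s"] by linarith
    then have "(\<Sum>l<N s. (norm (w l))\<^sup>2) \<le> real (N s) * (R\<^sup>2 + 1)"
      by (simp add: sum_subtractf algebra_simps)
    also have "\<dots> \<le> 2 * real n * (R\<^sup>2 + 1)" using n by (intro mult_right_mono) auto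
    finally have tot: "(\<Sum>l<N s. (norm (w l))\<^sup>2) \<le> 2 * real n * (R\<^sup>2 + 1)" .
    show ?case
    proof (intro allI impI)
      fix p c assume p: "p < s"
      have "(\<Sum>l<n. (w (l + p) $ c)\<^sup>2) = (\<Sum>l\<in>{p..<n + p}. (w l $ c)\<^sup>2)"
        by (rule sum.reindex_bij_witness[of _ "\<lambda>l. l - p" "\<lambda>l. l + p"]) auto
      also have "\<dots> \<le> (\<Sum>l\<in>{p..<n + p}. (norm (w l))\<^sup>2)"
        by (intro sum_mono coordinate_square_le)
      also have "\<dots> \<le> (\<Sum>l<N s. (norm (w l))\<^sup>2)"
        by (rule sum_mono2) (use p elim in \<open>auto simp: n_def\<close>)
      finally have "(\<Sum>l<n. (w (l + p) $ c)\<^sup>2) / real n \<le> 2 * real n * (R\<^sup>2 + 1) / real n"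
        using tot n by (intro divide_right_mono) auto
      then show "(1 / real (N s - s + 1)) * (\<Sum>l<N s - s + 1. (w (l + p) $ c)\<^sup>2) \<le> 2 * R\<^sup>2 + 2"
        unfolding n_def[symmetric] using n by simp
    qed
  qed
qed

lemma product_small:
  assumes \<delta>: "\<delta> > 0"
  shows "\<forall>\<^sub>F s in sequentially. \<forall>i\<in>idx s (N s).
    (1 / real (N s - s + 1)) * (\<Sum>j\<in>idx s (N s). \<bar>(1 / real s) * (\<Sum>k<s. w (i - k) $ c * w (j - k) $ c)\<bar>) \<le> \<delta>"
proof -
  have "(\<lambda>s. (R\<^sup>2 + 1) * (sqrt (autocovariance_error N (\<lambda>l. w l $ c) s) + (2 * R\<^sup>2 + 2) * (1 / real s)))
      \<longlonglongrightarrow> (R\<^sup>2 + 1) * (sqrt 0 + (2 * R\<^sup>2 + 2) * 0)"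
    by (intro tendsto_intros autocovariance lim_1_over_n)
  then have "\<forall>\<^sub>F s in sequentially. (R\<^sup>2 + 1) * (sqrt (autocovariance_error N (\<lambda>l. w l $ c) s) + (2 * R\<^sup>2 + 2) * (1 / real s)) < \<delta>\<^sup>2"
    by (rule order_tendstoD(2)) (use \<delta> in simp)
  then show ?thesis using energy_total energy_window N
  proof eventually_elim
    case (elim s)
    define n where "n = N s - s + 1"
    have s: "1 \<le> s" "s \<le> N s" and n: "real n > 0" using elim by (auto simp: n_def)
    show ?case
    proof
      fix i assume i: "i \<in> idx s (N s)"
      then have ib: "s \<le> i + 1" by (auto simp: idx_def)
      \<comment> \<open>Writing \<open>j = s - 1 + l\<close> and reversing the order of summation
        puts the product into the form of \<open>mean_square_correlation_le\<close>, with the window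
        of \<open>i\<close> as coefficients.\<close>
      define h where "h l = (1 / real s) * (\<Sum>p<s. w (i - (s - Suc p)) $ c * w (l + p) $ c)" for l
      have corr: "(1 / real s) * (\<Sum>k<s. w (i - k) $ c * w (s - 1 + l - k) $ c) = h l" for l
      proof -
        have "(\<Sum>k<s. w (i - k) $ c * w (s - 1 + l - k) $ c) = (\<Sum>p<s. w (i - (s - Suc p)) $ c * w (s - 1 + l - (s - Suc p)) $ c)"
          by (rule sum.nat_diff_reindex[symmetric])
        also have "\<dots> = (\<Sum>p<s. w (i - (s - Suc p)) $ c * w (l + p) $ c)"
        proof (rule sum.cong)
          fix p assume "p \<in> {..<s}"
          then have "s - 1 + l - (s - Suc p) = l + p" by auto
          then show "w (i - (s - Suc p)) $ c * w (s - 1 + l - (s - Suc p)) $ c = w (i - (s - Suc p)) $ c * w (l + p) $ c"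
            by (simp only:)
        qed simp
        finally show ?thesis by (simp add: h_def)
      qed
      have "(\<Sum>j\<in>idx s (N s). \<bar>(1 / real s) * (\<Sum>k<s. w (i - k) $ c * w (j - k) $ c)\<bar>) = (\<Sum>l<n. \<bar>h l\<bar>)"
        unfolding corr[symmetric]
        by (rule sum.reindex_bij_witness[of _ "\<lambda>l. s - 1 + l" "\<lambda>j. j - (s - 1)"])
          (use s in \<open>auto simp: idx_def n_def\<close>)
      moreover have "(1 / real n) * (\<Sum>l<n. \<bar>h l\<bar>) \<le> \<delta>"
      \<comment> \<open>By Cauchy-Schwarz the mean absolute value is at most the root mean
        square.\<close>
      proof (rule power2_le_imp_le)
        have "(\<Sum>l<n. \<bar>h l\<bar>)\<^sup>2 \<le> (\<Sum>l<n. \<bar>h l\<bar>\<^sup>2) * real n"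
          using sum_squared_le_sum_of_squares[where I = "{..<n}" and f = "\<lambda>l. \<bar>h l\<bar>"] by simp
        then have "(1 / real n)\<^sup>2 * (\<Sum>l<n. \<bar>h l\<bar>)\<^sup>2 \<le> (1 / real n)\<^sup>2 * ((\<Sum>l<n. \<bar>h l\<bar>\<^sup>2) * real n)"
          by (rule mult_left_mono) simp
        also have "\<dots> = (1 / real n) * (\<Sum>l<n. (h l)\<^sup>2)" using n by (simp add: power2_eq_square)
        also have "\<dots> \<le> ((1 / real s) * (\<Sum>p<s. (w (i - (s - Suc p)) $ c)\<^sup>2))
            * (sqrt (autocovariance_error N (\<lambda>l. w l $ c) s) + (2 * R\<^sup>2 + 2) / real s)"
          unfolding h_def n_def
          by (rule mean_square_correlation_le) (use s elim in auto)
        also have "(\<Sum>p<s. (w (i - (s - Suc p)) $ c)\<^sup>2) = (\<Sum>k<s. (w (i - k) $ c)\<^sup>2)"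
          by (rule sum.nat_diff_reindex)
        also have "((1 / real s) * (\<Sum>k<s. (w (i - k) $ c)\<^sup>2)) * (sqrt (autocovariance_error N (\<lambda>l. w l $ c) s) + (2 * R\<^sup>2 + 2) / real s)
            \<le> (R\<^sup>2 + 1) * (sqrt (autocovariance_error N (\<lambda>l. w l $ c) s) + (2 * R\<^sup>2 + 2) / real s)"
        proof (rule mult_right_mono)
          have "autocovariance_error N (\<lambda>l. w l $ c) s \<ge> 0"
            unfolding autocovariance_error_def by (intro mult_nonneg_nonneg sum_nonneg) auto
          then show "0 \<le> sqrt (autocovariance_error N (\<lambda>l. w l $ c) s) + (2 * R\<^sup>2 + 2) / real s" by simp
        qed (use elim i in auto)
        finally show "((1 / real n) * (\<Sum>l<n. \<bar>h l\<bar>))\<^sup>2 \<le> \<delta>\<^sup>2"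
          using elim(1) unfolding power_mult_distrib by simp
      qed (use \<delta> in simp)
      ultimately show "(1 / real (N s - s + 1)) * (\<Sum>j\<in>idx s (N s). \<bar>(1 / real s) * (\<Sum>k<s. w (i - k) $ c * w (j - k) $ c)\<bar>) \<le> \<delta>"
        unfolding n_def by simp
    qed
  qed
qed

end

section \<open>Distances between noisy delay vectors\<close>

locale observed_noise_path = observed_system \<mu> \<Phi> T \<Omega> \<zeta> F + noise_path N lam w R
  for \<mu> :: "'a::{t2_space, second_countable_topology} measure" and \<Phi> T
    and \<Omega> :: "'m::finite \<Rightarrow> real" and \<zeta> and F :: "'a \<Rightarrow> real ^ 'd" and N
    and w :: "nat \<Rightarrow> real ^ 'd" and R
begin

text \<open>After the expansion of \<open>F\<close> in characters the point \<open>a\<close> enters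
  the main part only through values of modulus 1, so all points are treated at once, in particular
  both states of a pair. Up to a phase depending on \<open>i\<close>, a twisted window of the noise
  is a window of the fixed sequence \<open>lam q ^ l * w l $ c\<close>.\<close>

lemma cross_term_small:
  assumes \<delta>: "\<delta> > 0"
  shows "\<forall>\<^sub>F s in sequentially. \<forall>i\<in>idx s (N s). \<forall>a.
    \<bar>(1 / real s) * (\<Sum>k<s. F (\<Phi> (- (real k * T)) a) $ c * w (i - k) $ c)\<bar> \<le> \<delta>"
proof -
  \<comment> \<open>The remainder of the expansion is at most \<eta> times the root mean square of
    the noise window, which is eventually bounded by the square root of
    \<open>R\<^sup>2 + 1\<close>; this leaves \<delta>/2.\<close>
  define \<eta> where "\<eta> = \<delta> / (2 * sqrt (R\<^sup>2 + 1))"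
  have r: "sqrt (R\<^sup>2 + 1) > 0" by (simp add: add_nonneg_pos)
  have \<eta>: "\<eta> > 0" using \<delta> r by (simp add: \<eta>_def)
  obtain K b where K: "finite K" and approx: "\<forall>\<^sub>F s in sequentially. \<forall>a w.
    norm ((1 / real s) *\<^sub>R (\<Sum>k<s. of_real (F (\<Phi> (- (real k * T)) a) $ c) * w k)
        - (\<Sum>q\<in>K. b q * e q a * ((1 / real s) *\<^sub>R (\<Sum>k<s. cnj (lam q) ^ k * w k))))
      \<le> \<eta> * sqrt ((1 / real s) * (\<Sum>k<s. (norm (w k))\<^sup>2))"
    by (rule twisted_average_approx[OF F_nth_continuous \<eta>])
  define B where "B = (\<Sum>q\<in>K. norm (b q)) + 1"
  have B: "B > 0" unfolding B_def by (intro add_nonneg_pos sum_nonneg) auto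
  have \<delta>B: "\<delta> / (2 * B) > 0" using \<delta> B by simp
  have "\<forall>\<^sub>F s in sequentially. \<forall>i\<in>idx s (N s).
      norm ((1 / real s) *\<^sub>R (\<Sum>k<s. lam q ^ (i - k) * complex_of_real (w (i - k) $ c))) \<le> \<delta> / (2 * B)" for q
  proof -
    obtain C where C: "\<And>n. norm (\<Sum>l<n. lam q ^ l * complex_of_real (w l $ c)) \<le> C * (real n + 1) powr (4/5)"
      using twisted_growth by blast
    show ?thesis by (rule window_average_small[OF C N growth \<delta>B])
  qed
  then have "\<forall>\<^sub>F s in sequentially. \<forall>q\<in>K. \<forall>i\<in>idx s (N s).
      norm ((1 / real s) *\<^sub>R (\<Sum>k<s. lam q ^ (i - k) * complex_of_real (w (i - k) $ c))) \<le> \<delta> / (2 * B)"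
    by (intro eventually_ball_finite K) simp
  then show ?thesis using approx energy_window
  proof eventually_elim
    case (elim s)
    show ?case
    proof (intro ballI allI)
      fix i a assume i: "i \<in> idx s (N s)"
      let ?w = "\<lambda>k. complex_of_real (w (i - k) $ c)"
      have ib: "k \<le> i" if "k < s" for k using i that by (auto simp: idx_def)
      have tw: "norm ((1 / real s) *\<^sub>R (\<Sum>k<s. cnj (lam q) ^ k * ?w k)) \<le> \<delta> / (2 * B)" if q: "q \<in> K" for q
      proof -
        have "cnj (lam q) ^ k = cnj (lam q) ^ i * lam q ^ (i - k)" if "k < s" for k
        proof -
          have "cnj (lam q) ^ i * lam q ^ (i - k) = cnj (lam q) ^ k * (cnj (lam q) ^ (i - k) * lam q ^ (i - k))"
            using ib[OF that] by (simp add: mult.assoc[symmetric] power_add[symmetric])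
          then show ?thesis by (simp add: power_mult_distrib[symmetric] lam_cnj)
        qed
        then have "(\<Sum>k<s. cnj (lam q) ^ k * ?w k) = cnj (lam q) ^ i * (\<Sum>k<s. lam q ^ (i - k) * ?w k)"
          by (simp add: sum_distrib_left mult.assoc)
        then have "norm ((1 / real s) *\<^sub>R (\<Sum>k<s. cnj (lam q) ^ k * ?w k)) = norm ((1 / real s) *\<^sub>R (\<Sum>k<s. lam q ^ (i - k) * ?w k))"
          by (simp only: norm_scaleR norm_mult norm_power complex_mod_cnj norm_lam power_one mult_1_left)
        also have "\<dots> \<le> \<delta> / (2 * B)" using elim(1) q i by blast
        finally show ?thesis .
      qed
      have "norm (\<Sum>q\<in>K. b q * e q a * ((1 / real s) *\<^sub>R (\<Sum>k<s. cnj (lam q) ^ k * ?w k))) \<le> (\<Sum>q\<in>K. norm (b q) * (\<delta> / (2 * B)))"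
      proof (rule sum_norm_le)
        fix q assume q: "q \<in> K"
        show "norm (b q * e q a * ((1 / real s) *\<^sub>R (\<Sum>k<s. cnj (lam q) ^ k * ?w k))) \<le> norm (b q) * (\<delta> / (2 * B))"
          unfolding norm_mult norm_e mult_1_right by (intro mult_left_mono tw q) simp
      qed
      also have "\<dots> \<le> B * (\<delta> / (2 * B))"
        unfolding sum_distrib_right[symmetric] using \<delta>B by (intro mult_right_mono) (auto simp: B_def)
      also have "\<dots> = \<delta> / 2" using B by simp
      finally have part1: "norm (\<Sum>q\<in>K. b q * e q a * ((1 / real s) *\<^sub>R (\<Sum>k<s. cnj (lam q) ^ k * ?w k))) \<le> \<delta> / 2" .
      have "\<eta> * sqrt ((1 / real s) * (\<Sum>k<s. (norm (?w k))\<^sup>2)) \<le> \<eta> * sqrt (R\<^sup>2 + 1)"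
        using elim(3) i \<eta> by (intro mult_left_mono real_sqrt_le_mono) auto
      also have "\<dots> = \<delta> / 2" using r by (simp add: \<eta>_def)
      finally have part2: "norm ((1 / real s) *\<^sub>R (\<Sum>k<s. of_real (F (\<Phi> (- (real k * T)) a) $ c) * ?w k)
        - (\<Sum>q\<in>K. b q * e q a * ((1 / real s) *\<^sub>R (\<Sum>k<s. cnj (lam q) ^ k * ?w k)))) \<le> \<delta> / 2"
        using elim(2)[rule_format, of a ?w] by linarith
      have "norm ((1 / real s) *\<^sub>R (\<Sum>k<s. of_real (F (\<Phi> (- (real k * T)) a) $ c) * ?w k)) \<le> \<delta>"
        using norm_triangle_sub[of "(1 / real s) *\<^sub>R (\<Sum>k<s. of_real (F (\<Phi> (- (real k * T)) a) $ c) * ?w k)"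
            "\<Sum>q\<in>K. b q * e q a * ((1 / real s) *\<^sub>R (\<Sum>k<s. cnj (lam q) ^ k * ?w k))"] part1 part2 by linarith
      moreover have "(1 / real s) *\<^sub>R (\<Sum>k<s. of_real (F (\<Phi> (- (real k * T)) a) $ c) * ?w k)
          = complex_of_real ((1 / real s) * (\<Sum>k<s. F (\<Phi> (- (real k * T)) a) $ c * w (i - k) $ c))"
        by (simp add: scaleR_conv_of_real)
      ultimately show "\<bar>(1 / real s) * (\<Sum>k<s. F (\<Phi> (- (real k * T)) a) $ c * w (i - k) $ c)\<bar> \<le> \<delta>"
        by (simp only: norm_of_real)
    qed
  qed
qed

text \<open>Each of the two noise windows meets the backward orbits of both states, hence four cross
  terms per coordinate. Samples at \<open>i - k\<close> are rewritten as the backward flow from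
  \<open>a i\<close>, the form in which the uniform limits are available.\<close>

lemma noisy_distance_expansion:
  fixes a0 :: 'a
  assumes s: "1 \<le> s" and i: "i \<in> idx s (N s)" and j: "j \<in> idx s (N s)"
  defines "a \<equiv> \<lambda>j. \<Phi> (real j * T) a0"
  defines "x \<equiv> \<lambda>j. F (a j) + w j"
  defines "av \<equiv> \<lambda>h. (1 / real s) * (\<Sum>k<s. h k)"
  shows "(avg_norm s (\<lambda>k. delay_vec x i k - delay_vec x j k))\<^sup>2
    = dist_n s (a i) (a j) + av (\<lambda>k. (norm (w (i - k)))\<^sup>2) + av (\<lambda>k. (norm (w (j - k)))\<^sup>2)
      + (\<Sum>c\<in>UNIV. - 2 * av (\<lambda>k. w (i - k) $ c * w (j - k) $ c)
        + 2 * (av (\<lambda>k. F (\<Phi> (- (real k * T)) (a i)) $ c * w (i - k) $ c) - av (\<lambda>k. F (\<Phi> (- (real k * T)) (a j)) $ c * w (i - k) $ c))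
        - 2 * (av (\<lambda>k. F (\<Phi> (- (real k * T)) (a i)) $ c * w (j - k) $ c) - av (\<lambda>k. F (\<Phi> (- (real k * T)) (a j)) $ c * w (j - k) $ c)))"
proof -
  have orbit_back: "\<Phi> (- (real k * T)) (a l) = a (l - k)" if "k < s" "l \<in> idx s (N s)" for k l
  proof -
    have "k \<le> l" using that by (auto simp: idx_def)
    then have "- (real k * T) + real l * T = real (l - k) * T" by (simp add: of_nat_diff algebra_simps)
    then show ?thesis by (simp add: a_def flow_add[symmetric])
  qed
  have av_add: "av (\<lambda>k. h k + h' k) = av h + av h'" and av_diff: "av (\<lambda>k. h k - h' k) = av h - av h'"
    and av_cmult: "av (\<lambda>k. r * h k) = r * av h" for h h' r
    by (simp_all add: av_def sum.distrib sum_subtractf add_divide_distrib diff_divide_distrib sum_distrib_left[symmetric])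
  have av_sum: "av (\<lambda>k. \<Sum>c\<in>UNIV. h c k) = (\<Sum>c\<in>UNIV. av (h c))" for h :: "'d \<Rightarrow> nat \<Rightarrow> real"
    unfolding av_def by (subst sum.swap) (simp add: sum_distrib_left)
  have expand: "(norm (P + u - (Q + v)))\<^sup>2 = ((norm (P - Q))\<^sup>2 + (norm u)\<^sup>2 + (norm v)\<^sup>2)
      + (\<Sum>c\<in>UNIV. (- 2) * (u $ c * v $ c) + 2 * (P $ c * u $ c - Q $ c * u $ c) - 2 * (P $ c * v $ c - Q $ c * v $ c))"
    for P Q u v :: "real ^ 'd"
    unfolding power2_norm_eq_inner inner_vec_def sum.distrib[symmetric]
    by (rule sum.cong) (simp_all add: algebra_simps)
  have "(avg_norm s (\<lambda>k. delay_vec x i k - delay_vec x j k))\<^sup>2 = av (\<lambda>k. (norm (x (i - k) - x (j - k)))\<^sup>2)"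
    unfolding avg_norm_def delay_vec_def av_def by (simp add: sum_nonneg)
  also have "\<dots> = av (\<lambda>k. (norm (F (\<Phi> (- (real k * T)) (a i)) + w (i - k) - (F (\<Phi> (- (real k * T)) (a j)) + w (j - k))))\<^sup>2)"
    unfolding av_def x_def by (intro arg_cong2[where f = "(*)"] refl sum.cong) (simp_all add: orbit_back i j)
  also have "\<dots> = dist_n s (a i) (a j) + av (\<lambda>k. (norm (w (i - k)))\<^sup>2) + av (\<lambda>k. (norm (w (j - k)))\<^sup>2)
      + (\<Sum>c\<in>UNIV. - 2 * av (\<lambda>k. w (i - k) $ c * w (j - k) $ c)
        + 2 * (av (\<lambda>k. F (\<Phi> (- (real k * T)) (a i)) $ c * w (i - k) $ c) - av (\<lambda>k. F (\<Phi> (- (real k * T)) (a j)) $ c * w (i - k) $ c))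
        - 2 * (av (\<lambda>k. F (\<Phi> (- (real k * T)) (a i)) $ c * w (j - k) $ c) - av (\<lambda>k. F (\<Phi> (- (real k * T)) (a j)) $ c * w (j - k) $ c)))"
    unfolding expand av_add av_sum av_diff av_cmult dist_n_eq by (simp add: av_def)
  finally show ?thesis .
qed

theorem noisy_distance_close:
  fixes a0 :: 'a
  defines "a \<equiv> \<lambda>j. \<Phi> (real j * T) a0"
  defines "x \<equiv> \<lambda>j. F (a j) + w j"
  shows "((\<lambda>(s, i). (1 / real (N s - s + 1)) * (\<Sum>j\<in>idx s (N s).
        \<bar>(avg_norm s (\<lambda>k. delay_vec x i k - delay_vec x j k))\<^sup>2 - (dist_lim (a i) (a j) + 2 * R\<^sup>2)\<bar>)) \<longlongrightarrow> 0) (row_filter N)"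
proof (rule tendstoI)
  fix \<delta> :: real assume \<delta>: "\<delta> > 0"
  let ?d = "real CARD('d)"
  \<comment> \<open>Three errors \<eta> come from the noise-free distance and the two window
    variances. Each coordinate adds eight for the four cross terms, each counted twice, and two for
    the noise product after averaging over the row.\<close>
  define \<eta> where "\<eta> = \<delta> / (2 * (3 + 10 * ?d))"
  have pos: "3 + 10 * ?d > 0" by (simp add: add_pos_nonneg)
  have \<eta>: "\<eta> > 0" using \<delta> pos by (simp add: \<eta>_def)
  have "\<forall>\<^sub>F s in sequentially. \<forall>y\<in>UNIV. dist (case y of (a, b) \<Rightarrow> dist_n s a b) (case y of (a, b) \<Rightarrow> dist_lim a b) < \<eta>"
    by (rule uniform_limitD[OF dist_uniform_limit \<eta>])
  moreover have "\<forall>\<^sub>F s in sequentially. \<forall>c. \<forall>i\<in>idx s (N s). \<forall>a.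
    \<bar>(1 / real s) * (\<Sum>k<s. F (\<Phi> (- (real k * T)) a) $ c * w (i - k) $ c)\<bar> \<le> \<eta>"
    by (rule eventually_all_finite) (rule cross_term_small[OF \<eta>])
  moreover have "\<forall>\<^sub>F s in sequentially. \<forall>c. \<forall>i\<in>idx s (N s).
    (1 / real (N s - s + 1)) * (\<Sum>j\<in>idx s (N s). \<bar>(1 / real s) * (\<Sum>k<s. w (i - k) $ c * w (j - k) $ c)\<bar>) \<le> \<eta>"
    by (rule eventually_all_finite) (rule product_small[OF \<eta>])
  ultimately have "\<forall>\<^sub>F s in sequentially. \<forall>i\<in>idx s (N s).
    (1 / real (N s - s + 1)) * (\<Sum>j\<in>idx s (N s).
        \<bar>(avg_norm s (\<lambda>k. delay_vec x i k - delay_vec x j k))\<^sup>2 - (dist_lim (a i) (a j) + 2 * R\<^sup>2)\<bar>) < \<delta>"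
    using variance_window[OF \<eta>] N
  proof eventually_elim
    case (elim s)
    have s: "1 \<le> s" "s \<le> N s" using elim by auto
    define n where "n = N s - s + 1"
    have n: "real n > 0" by (simp add: n_def)
    have card: "card (idx s (N s)) = n" using s by (auto simp: idx_def n_def)
    show ?case
    proof
      fix i assume i: "i \<in> idx s (N s)"
      let ?p = "\<lambda>c j. (1 / real s) * (\<Sum>k<s. w (i - k) $ c * w (j - k) $ c)"
      have pw: "\<bar>(avg_norm s (\<lambda>k. delay_vec x i k - delay_vec x j k))\<^sup>2 - (dist_lim (a i) (a j) + 2 * R\<^sup>2)\<bar>
          \<le> (3 + 8 * ?d) * \<eta> + 2 * (\<Sum>c\<in>UNIV. \<bar>?p c j\<bar>)" if j: "j \<in> idx s (N s)" for j
      proof -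
        let ?c1 = "\<lambda>c. (1 / real s) * (\<Sum>k<s. F (\<Phi> (- (real k * T)) (a i)) $ c * w (i - k) $ c)"
        let ?c2 = "\<lambda>c. (1 / real s) * (\<Sum>k<s. F (\<Phi> (- (real k * T)) (a j)) $ c * w (i - k) $ c)"
        let ?c3 = "\<lambda>c. (1 / real s) * (\<Sum>k<s. F (\<Phi> (- (real k * T)) (a i)) $ c * w (j - k) $ c)"
        let ?c4 = "\<lambda>c. (1 / real s) * (\<Sum>k<s. F (\<Phi> (- (real k * T)) (a j)) $ c * w (j - k) $ c)"
        let ?S = "\<Sum>c\<in>UNIV. - 2 * ?p c j + 2 * (?c1 c - ?c2 c) - 2 * (?c3 c - ?c4 c)"
        have eq: "(avg_norm s (\<lambda>k. delay_vec x i k - delay_vec x j k))\<^sup>2 = dist_n s (a i) (a j)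
            + (1 / real s) * (\<Sum>k<s. (norm (w (i - k)))\<^sup>2) + (1 / real s) * (\<Sum>k<s. (norm (w (j - k)))\<^sup>2) + ?S"
          unfolding x_def a_def by (rule noisy_distance_expansion[OF s(1) i j])
        have "\<bar>?S\<bar> \<le> (\<Sum>c\<in>UNIV. 2 * \<bar>?p c j\<bar> + 8 * \<eta>)"
        proof (rule order_trans[OF sum_abs], rule sum_mono)
          fix c
          have c: "\<bar>?c1 c\<bar> \<le> \<eta>" "\<bar>?c2 c\<bar> \<le> \<eta>" "\<bar>?c3 c\<bar> \<le> \<eta>" "\<bar>?c4 c\<bar> \<le> \<eta>"
            using elim(2) i j by blast+
          have "\<bar>- 2 * p + 2 * (x1 - x2) - 2 * (x3 - x4)\<bar> \<le> 2 * \<bar>p\<bar> + 8 * \<eta>"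
            if "\<bar>x1\<bar> \<le> \<eta>" "\<bar>x2\<bar> \<le> \<eta>" "\<bar>x3\<bar> \<le> \<eta>" "\<bar>x4\<bar> \<le> \<eta>" for p x1 x2 x3 x4 :: real
            using that by (smt (verit))
          from this[OF c] show "\<bar>- 2 * ?p c j + 2 * (?c1 c - ?c2 c) - 2 * (?c3 c - ?c4 c)\<bar> \<le> 2 * \<bar>?p c j\<bar> + 8 * \<eta>" .
        qed
        also have "\<dots> = 2 * (\<Sum>c\<in>UNIV. \<bar>?p c j\<bar>) + 8 * ?d * \<eta>"
          by (simp only: sum.distrib sum_distrib_left[symmetric] sum_constant)
        finally have S: "\<bar>?S\<bar> \<le> 2 * (\<Sum>c\<in>UNIV. \<bar>?p c j\<bar>) + 8 * ?d * \<eta>" .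
        have d1: "\<bar>dist_n s (a i) (a j) - dist_lim (a i) (a j)\<bar> \<le> \<eta>"
          using bspec[OF elim(1) UNIV_I, of "(a i, a j)"] by (simp add: dist_real_def)
        have d2: "\<bar>(1 / real s) * (\<Sum>k<s. (norm (w (i - k)))\<^sup>2) - R\<^sup>2\<bar> \<le> \<eta>"
          "\<bar>(1 / real s) * (\<Sum>k<s. (norm (w (j - k)))\<^sup>2) - R\<^sup>2\<bar> \<le> \<eta>"
          using elim(4) i j by blast+
        have "\<bar>t + u + v + S - (t' + 2 * r)\<bar> \<le> \<eta> + \<eta> + \<eta> + B"
          if "\<bar>t - t'\<bar> \<le> \<eta>" "\<bar>u - r\<bar> \<le> \<eta>" "\<bar>v - r\<bar> \<le> \<eta>" "\<bar>S\<bar> \<le> B" for t u v S t' r B :: real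
          using that by linarith
        from this[OF d1 d2 S] show ?thesis unfolding eq by (simp add: algebra_simps)
      qed
      have "(1 / real n) * (\<Sum>j\<in>idx s (N s). \<bar>(avg_norm s (\<lambda>k. delay_vec x i k - delay_vec x j k))\<^sup>2 - (dist_lim (a i) (a j) + 2 * R\<^sup>2)\<bar>)
          \<le> (1 / real n) * (\<Sum>j\<in>idx s (N s). (3 + 8 * ?d) * \<eta> + 2 * (\<Sum>c\<in>UNIV. \<bar>?p c j\<bar>))"
        by (intro mult_left_mono sum_mono pw) simp_all
      also have "\<dots> = (3 + 8 * ?d) * \<eta> + 2 * (\<Sum>c\<in>UNIV. (1 / real n) * (\<Sum>j\<in>idx s (N s). \<bar>?p c j\<bar>))"
      proof -
        have "(\<Sum>j\<in>idx s (N s). \<Sum>c\<in>UNIV. \<bar>?p c j\<bar>) = (\<Sum>c\<in>UNIV. \<Sum>j\<in>idx s (N s). \<bar>?p c j\<bar>)" by (rule sum.swap)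
        then show ?thesis
          unfolding sum.distrib sum_distrib_left[symmetric] distrib_left sum_constant card using n by simp
      qed
      also have "\<dots> \<le> (3 + 8 * ?d) * \<eta> + 2 * (\<Sum>c\<in>(UNIV :: 'd set). \<eta>)"
        by (intro add_left_mono mult_left_mono sum_mono) (use elim(3) i in \<open>auto simp: n_def\<close>)
      also have "\<dots> = (3 + 10 * ?d) * \<eta>" by (simp add: algebra_simps)
      also have "\<dots> = \<delta> / 2"
      proof -
        have "t * (\<delta> / (2 * t)) = \<delta> / 2" if "t > 0" for t :: real using that by simp
        from this[OF pos] show ?thesis unfolding \<eta>_def .
      qed
      finally show "(1 / real (N s - s + 1)) * (\<Sum>j\<in>idx s (N s).
        \<bar>(avg_norm s (\<lambda>k. delay_vec x i k - delay_vec x j k))\<^sup>2 - (dist_lim (a i) (a j) + 2 * R\<^sup>2)\<bar>) < \<delta>"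
        using \<delta> unfolding n_def by linarith
    qed
  qed
  then show "\<forall>\<^sub>F y in row_filter N. dist (case y of (s, i) \<Rightarrow> (1 / real (N s - s + 1)) * (\<Sum>j\<in>idx s (N s).
        \<bar>(avg_norm s (\<lambda>k. delay_vec x i k - delay_vec x j k))\<^sup>2 - (dist_lim (a i) (a j) + 2 * R\<^sup>2)\<bar>)) 0 < \<delta>"
    by (simp add: eventually_row_filter sum_nonneg)
qed

end

section \<open>Convergence of the Markov matrix\<close>

lemma (in kronecker_system) orbit_funpow: "(\<Phi> T ^^ j) a = \<Phi> (real j * T) a"
  by (induction j) (simp_all add: flow_0 flow_add distrib_right)

lemma (in kronecker_system) L2_integrable:
  assumes "f \<in> L2 \<mu>" shows "integrable \<mu> f"
proof (rule Bochner_Integration.integrable_bound[of _ "\<lambda>a. 1 + (norm (f a))\<^sup>2"])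
  show "integrable \<mu> (\<lambda>a. 1 + (norm (f a))\<^sup>2)" "f \<in> borel_measurable \<mu>"
    using assms by (auto simp: L2_def)
  have "t \<le> 1 + t\<^sup>2" for t :: real
  proof -
    have "2 * t \<le> t\<^sup>2 + 1" using zero_le_power2[of "t - 1"] unfolding power2_diff by simp
    moreover have "0 \<le> t\<^sup>2" by simp
    ultimately show ?thesis by linarith
  qed
  then show "AE a in \<mu>. norm (f a) \<le> norm (1 + (norm (f a))\<^sup>2)" by (auto simp: abs_of_nonneg)
qed

text \<open>Mean squared errors 16^(-k) give mean errors 4^(-k), the input of the maximal
  inequality. One continuous \<open>p\<close> serves both the integral and the orbit, for every
  length \<open>n\<close>, and the exceptional starting states are fixed before \<delta>.\<close>

lemma (in kronecker_system) L2_orbit_approx: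
  assumes f: "f \<in> L2 \<mu>"
  shows "AE a in \<mu>. \<forall>\<delta>>0. \<exists>p. continuous_on UNIV p \<and> (\<integral>b. norm (f b - p b) \<partial>\<mu>) \<le> \<delta> \<and>
    (\<forall>n. (\<Sum>j<n. norm (f (\<Phi> (real j * T) a) - p (\<Phi> (real j * T) a))) \<le> \<delta> * real n)"
proof -
  have "\<exists>p. continuous_on UNIV p \<and> (\<integral>a. (norm (f a - p a))\<^sup>2 \<partial>\<mu>) < (1/16) ^ k" for k :: nat
  proof -
    obtain K c where "(\<integral>a. (norm (f a - (\<Sum>k\<in>K. c k * e k a)))\<^sup>2 \<partial>\<mu>) < (1/16) ^ k"
      by (rule L2_approx[OF f, of "(1/16) ^ k"]) auto
    then show ?thesis using continuous_trig[of c K] by blast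
  qed
  then obtain p where p: "\<And>k. continuous_on UNIV (p k)" "\<And>k. (\<integral>a. (norm (f a - p k a))\<^sup>2 \<partial>\<mu>) < (1/16) ^ k"
    by metis
  define h where "h k a = norm (f a - p k a)" for k a
  have fi: "integrable \<mu> f" by (rule L2_integrable[OF f])
  have [measurable]: "f \<in> borel_measurable \<mu>" "p k \<in> borel_measurable \<mu>" for k
    using f p(1) by (auto simp: L2_def intro: measurable_continuous)
  have hi: "integrable \<mu> (h k)" for k
    unfolding h_def using fi integrable_continuous[OF p(1)] by (intro integrable_norm Bochner_Integration.integrable_diff)
  have h2: "integrable \<mu> (\<lambda>a. (h k a)\<^sup>2)" for k
  proof (rule Bochner_Integration.integrable_bound[of _ "\<lambda>a. 2 * (norm (f a))\<^sup>2 + 2 * (norm (p k a))\<^sup>2"])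
    show "integrable \<mu> (\<lambda>a. 2 * (norm (f a))\<^sup>2 + 2 * (norm (p k a))\<^sup>2)"
      using f by (intro Bochner_Integration.integrable_add integrable_mult_right)
        (auto simp: L2_def intro!: integrable_continuous continuous_intros p)
    show "(\<lambda>a. (h k a)\<^sup>2) \<in> borel_measurable \<mu>" unfolding h_def by measurable
    have "(norm (u - v))\<^sup>2 \<le> 2 * (norm u)\<^sup>2 + 2 * (norm v)\<^sup>2" for u v :: complex
    proof -
      have "(norm (u - v))\<^sup>2 \<le> (norm u + norm v)\<^sup>2" by (intro power_mono norm_triangle_ineq4) simp
      also have "\<dots> \<le> 2 * (norm u)\<^sup>2 + 2 * (norm v)\<^sup>2"
        using zero_le_power2[of "norm u - norm v"] unfolding power2_diff power2_sum by linarith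
      finally show ?thesis .
    qed
    then show "AE a in \<mu>. norm ((h k a)\<^sup>2) \<le> norm (2 * (norm (f a))\<^sup>2 + 2 * (norm (p k a))\<^sup>2)"
      unfolding h_def by (intro AE_I2) (simp add: abs_of_nonneg)
  qed
  have h1: "(\<integral>a. h k a \<partial>\<mu>) \<le> (1/4) ^ k" for k
  proof (rule power2_le_imp_le)
    have "(\<integral>a. h k a \<partial>\<mu>)\<^sup>2 \<le> (\<integral>a. (h k a)\<^sup>2 \<partial>\<mu>)"
      using variance_eq[OF hi h2, of k] variance_positive[of "h k"] by simp
    also have "\<dots> \<le> (1/16) ^ k" using p(2)[of k] by (simp add: h_def)
    also have "(1/16 :: real) ^ k = ((1/4) ^ k)\<^sup>2"
      by (simp add: power2_eq_square power_mult_distrib[symmetric])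
    finally show "(\<integral>a. h k a \<partial>\<mu>)\<^sup>2 \<le> ((1/4) ^ k)\<^sup>2" .
  qed simp
  have "AE a in \<mu>. \<forall>\<^sub>F k in sequentially. \<forall>n. (\<Sum>j<n. h k ((\<Phi> T ^^ j) a)) \<le> (1/2) ^ k * real n"
    by (rule AE_eventually_averages_small[OF flow_measurable flow_distr hi _ h1]) (simp add: h_def)
  then show ?thesis
  proof eventually_elim
    case (elim a)
    show ?case
    proof (intro allI impI)
      fix \<delta> :: real assume "\<delta> > 0"
      then have "\<forall>\<^sub>F k in sequentially. (1/2 :: real) ^ k < \<delta>"
        by (intro order_tendstoD(2)[OF LIMSEQ_power_zero]) auto
      from eventually_conj[OF this elim] obtain k where k: "(1/2 :: real) ^ k < \<delta>"
        "\<And>n. (\<Sum>j<n. h k ((\<Phi> T ^^ j) a)) \<le> (1/2) ^ k * real n"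
        by (auto simp: eventually_sequentially)
      have "(1/4 :: real) ^ k \<le> (1/2) ^ k" by (rule power_mono) auto
      then have "(\<integral>b. norm (f b - p k b) \<partial>\<mu>) \<le> \<delta>" using h1[of k] k(1) by (simp add: h_def)
      moreover have "(\<Sum>j<n. norm (f (\<Phi> (real j * T) a) - p k (\<Phi> (real j * T) a))) \<le> \<delta> * real n" for n
      proof -
        have "(1/2) ^ k * real n \<le> \<delta> * real n" using k(1) by (intro mult_right_mono) auto
        then show ?thesis using k(2)[of n] by (simp add: h_def orbit_funpow)
      qed
      ultimately show "\<exists>p. continuous_on UNIV p \<and> (\<integral>b. norm (f b - p b) \<partial>\<mu>) \<le> \<delta> \<and>
        (\<forall>n. (\<Sum>j<n. norm (f (\<Phi> (real j * T) a) - p (\<Phi> (real j * T) a))) \<le> \<delta> * real n)"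
        using p(1) by blast
    qed
  qed
qed

context observed_system
begin

text \<open>The rows begin at index \<open>s - 1\<close>, so the orbit segment starts at a point
  that moves with \<open>s\<close>; uniform ergodicity absorbs this.\<close>

lemma average_over_rows:
  assumes "1 \<le> s" "s \<le> N s"
  shows "(1 / real (N s - s + 1)) *\<^sub>R (\<Sum>j\<in>idx s (N s). u (\<Phi> (real j * T) a0))
    = avg (N s - s + 1) u (\<Phi> (real (s - 1) * T) a0)"
proof -
  have "(\<Sum>j\<in>idx s (N s). u (\<Phi> (real j * T) a0)) = (\<Sum>l<N s - s + 1. u (\<Phi> (real (l + (s - 1)) * T) a0))"
    by (rule sum.reindex_bij_witness[of _ "\<lambda>l. l + (s - 1)" "\<lambda>j. j - (s - 1)"])
      (use assms in \<open>auto simp: idx_def\<close>)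
  also have "\<dots> = (\<Sum>l<N s - s + 1. u (\<Phi> (real l * T) (\<Phi> (real (s - 1) * T) a0)))"
    by (simp add: flow_add[symmetric] distrib_right)
  finally show ?thesis by (simp add: avg_def)
qed

lemma sum_over_rows_le:
  fixes h :: "nat \<Rightarrow> real"
  assumes s: "1 \<le> s" "s \<le> N s" "real (N s) \<le> 2 * real (N s - s + 1)"
    and h: "\<And>j. h j \<ge> 0" and le: "\<And>n. (\<Sum>j<n. h j) \<le> \<delta> * real n" and \<delta>: "\<delta> > 0"
  shows "(1 / real (N s - s + 1)) * (\<Sum>j\<in>idx s (N s). h j) \<le> 2 * \<delta>"
proof -
  define n where "n = N s - s + 1"
  have n: "real n > 0" by (simp add: n_def)
  have "(\<Sum>j\<in>idx s (N s). h j) \<le> (\<Sum>j<N s. h j)"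
    by (rule sum_mono2) (use h in \<open>auto simp: idx_def\<close>)
  also have "\<dots> \<le> \<delta> * real (N s)" by (rule le)
  also have "\<dots> \<le> \<delta> * (2 * real n)" using s \<delta> by (intro mult_left_mono) (auto simp: n_def)
  finally have "(\<Sum>j\<in>idx s (N s). h j) / real n \<le> \<delta> * (2 * real n) / real n"
    using n by (intro divide_right_mono) auto
  then show ?thesis unfolding n_def[symmetric] using n by simp
qed

text \<open>For a continuous \<open>p\<close> in place of \<open>f\<close>, uniform ergodicity of
  families applies. The limit kernel is at most 1, so the replacement costs no more than the mean
  error, once in the integral and once along the orbit.\<close>

lemma kernel_average_close:
  fixes f :: "'a \<Rightarrow> complex"
  assumes f: "integrable \<mu> f" and \<epsilon>: "\<epsilon> > 0"
    and N: "\<forall>\<^sub>F s in sequentially. 1 \<le> s \<and> s \<le> N s \<and> real (N s) \<le> 2 * real (N s - s + 1)"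
    and n_lim: "filterlim (\<lambda>s. N s - s + 1) at_top sequentially"
    and approx: "\<And>\<delta>. \<delta> > 0 \<Longrightarrow> \<exists>p. continuous_on UNIV p \<and> (\<integral>b. norm (f b - p b) \<partial>\<mu>) \<le> \<delta> \<and>
      (\<forall>n. (\<Sum>j<n. norm (f (\<Phi> (real j * T) a0) - p (\<Phi> (real j * T) a0))) \<le> \<delta> * real n)"
  shows "((\<lambda>(s, i). (1 / real (N s - s + 1)) *\<^sub>R (\<Sum>j\<in>idx s (N s).
        of_real (limit_kernel \<epsilon> (\<Phi> (real i * T) a0) (\<Phi> (real j * T) a0)) * f (\<Phi> (real j * T) a0))
      - (\<integral>b. of_real (limit_kernel \<epsilon> (\<Phi> (real i * T) a0) b) * f b \<partial>\<mu>)) \<longlongrightarrow> 0) (row_filter N)"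
proof (rule tendstoI)
  fix \<delta> :: real assume \<delta>: "\<delta> > 0"
  \<comment> \<open>Four errors \<eta> are spent: two along the orbit, because the rows are only
    known to make up at least half of the samples, one for the ergodic average and one for the
    integral.\<close>
  define \<eta> where "\<eta> = \<delta> / 5"
  have \<eta>: "\<eta> > 0" using \<delta> by (simp add: \<eta>_def)
  define a where "a j = \<Phi> (real j * T) a0" for j
  obtain p where p: "continuous_on UNIV p" "(\<integral>b. norm (f b - p b) \<partial>\<mu>) \<le> \<eta>"
    "\<And>n. (\<Sum>j<n. norm (f (a j) - p (a j))) \<le> \<eta> * real n"
    using approx[OF \<eta>] unfolding a_def by blast
  define v where "v y = complex_of_real (limit_kernel \<epsilon> (fst y) (snd y)) * p (snd y)" for y
  have v: "continuous_on UNIV v"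
    unfolding v_def
    using kernel_continuous[of \<epsilon>]
    by (intro continuous_on_mult continuous_on_of_real continuous_on_compose2[OF p(1)] continuous_on_snd continuous_on_id)
      (auto simp: case_prod_unfold)
  have k1: "norm (complex_of_real (limit_kernel \<epsilon> b c)) \<le> 1" for b c
    using kernel_le_1[OF \<epsilon>, of b c] kernel_pos[of \<epsilon> b c] by simp
  have kf: "integrable \<mu> (\<lambda>b. of_real (limit_kernel \<epsilon> c b) * f b)" for c
  proof (rule Bochner_Integration.integrable_bound[OF f])
    have "limit_kernel \<epsilon> c \<in> borel_measurable \<mu>" using kernel_integrable[of \<epsilon> c] by auto
    then show "(\<lambda>b. of_real (limit_kernel \<epsilon> c b) * f b) \<in> borel_measurable \<mu>" using f by auto
    show "AE b in \<mu>. norm (of_real (limit_kernel \<epsilon> c b) * f b) \<le> norm (f b)"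
      unfolding norm_mult using k1 by (intro AE_I2 mult_left_le_one_le) auto
  qed
  have int_close: "norm ((\<integral>b. v (c, b) \<partial>\<mu>) - (\<integral>b. of_real (limit_kernel \<epsilon> c b) * f b \<partial>\<mu>)) \<le> \<eta>" for c
  proof -
    have vi: "integrable \<mu> (\<lambda>b. v (c, b))" by (intro integrable_continuous continuous_on_section v)
    have fp: "integrable \<mu> (\<lambda>b. norm (f b - p b))"
      using f integrable_continuous[OF p(1)] by (intro integrable_norm Bochner_Integration.integrable_diff)
    have "norm (\<integral>b. v (c, b) - of_real (limit_kernel \<epsilon> c b) * f b \<partial>\<mu>)
        \<le> (\<integral>b. norm (v (c, b) - of_real (limit_kernel \<epsilon> c b) * f b) \<partial>\<mu>)" by (rule integral_norm_bound)
    also have "\<dots> \<le> (\<integral>b. norm (f b - p b) \<partial>\<mu>)"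
    proof (rule integral_mono)
      show "integrable \<mu> (\<lambda>b. norm (v (c, b) - of_real (limit_kernel \<epsilon> c b) * f b))"
        using vi kf by (intro integrable_norm Bochner_Integration.integrable_diff)
      fix b
      have "v (c, b) - of_real (limit_kernel \<epsilon> c b) * f b = of_real (limit_kernel \<epsilon> c b) * (p b - f b)"
        by (simp add: v_def right_diff_distrib)
      then show "norm (v (c, b) - of_real (limit_kernel \<epsilon> c b) * f b) \<le> norm (f b - p b)"
        using k1[of c b] by (simp only: norm_mult norm_minus_commute[of "f b"]) (rule mult_left_le_one_le, auto)
    qed (rule fp)
    finally show ?thesis using p(2) vi kf by simp
  qed
  have "\<forall>\<^sub>F n in sequentially. \<forall>c b. norm (avg n (\<lambda>b. v (c, b)) b - (\<integral>b. v (c, b) \<partial>\<mu>)) \<le> \<eta>"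
    by (rule uniformly_ergodic_family[OF v \<eta>])
  then have "\<forall>\<^sub>F s in sequentially. \<forall>c b. norm (avg (N s - s + 1) (\<lambda>b. v (c, b)) b - (\<integral>b. v (c, b) \<partial>\<mu>)) \<le> \<eta>"
    using n_lim by (rule eventually_compose_filterlim)
  then have "\<forall>\<^sub>F s in sequentially. \<forall>i\<in>idx s (N s).
      norm ((1 / real (N s - s + 1)) *\<^sub>R (\<Sum>j\<in>idx s (N s). of_real (limit_kernel \<epsilon> (a i) (a j)) * f (a j))
      - (\<integral>b. of_real (limit_kernel \<epsilon> (a i) b) * f b \<partial>\<mu>)) < \<delta>"
    using N
  proof eventually_elim
    case (elim s)
    have s: "1 \<le> s" "s \<le> N s" "real (N s) \<le> 2 * real (N s - s + 1)" using elim by auto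
    define r where "r = 1 / real (N s - s + 1)"
    have r: "r \<ge> 0" by (simp add: r_def)
    show ?case
    proof
      fix i assume "i \<in> idx s (N s)"
      let ?X = "r *\<^sub>R (\<Sum>j\<in>idx s (N s). of_real (limit_kernel \<epsilon> (a i) (a j)) * f (a j))"
      let ?Y = "r *\<^sub>R (\<Sum>j\<in>idx s (N s). v (a i, a j))"
      let ?I = "\<integral>b. v (a i, b) \<partial>\<mu>" and ?J = "\<integral>b. of_real (limit_kernel \<epsilon> (a i) b) * f b \<partial>\<mu>"
      have "?X - ?Y = r *\<^sub>R (\<Sum>j\<in>idx s (N s). of_real (limit_kernel \<epsilon> (a i) (a j)) * (f (a j) - p (a j)))"
        by (simp add: v_def right_diff_distrib sum_subtractf scaleR_diff_right)
      then have "norm (?X - ?Y) = r * norm (\<Sum>j\<in>idx s (N s). of_real (limit_kernel \<epsilon> (a i) (a j)) * (f (a j) - p (a j)))"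
        using r by simp
      also have "\<dots> \<le> r * (\<Sum>j\<in>idx s (N s). norm (f (a j) - p (a j)))"
      proof (intro mult_left_mono sum_norm_le r)
        fix j
        show "norm (of_real (limit_kernel \<epsilon> (a i) (a j)) * (f (a j) - p (a j))) \<le> norm (f (a j) - p (a j))"
          unfolding norm_mult using k1 by (intro mult_left_le_one_le) auto
      qed
      also have "\<dots> \<le> 2 * \<eta>"
        unfolding r_def
        by (rule sum_over_rows_le[where h = "\<lambda>j. norm (f (a j) - p (a j))"]) (use s p(3) \<eta> in auto)
      finally have 1: "norm (?X - ?Y) \<le> 2 * \<eta>" .
      have "?Y = avg (N s - s + 1) (\<lambda>b. v (a i, b)) (\<Phi> (real (s - 1) * T) a0)"
        using average_over_rows[of s N "\<lambda>b. v (a i, b)" a0, OF s(1,2)]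
        by (simp only: r_def a_def)
      then have 2: "norm (?Y - ?I) \<le> \<eta>" using elim(1) by simp
      have 3: "norm (?I - ?J) \<le> \<eta>" by (rule int_close)
      have "norm (?X - ?J) \<le> norm (?X - ?Y) + norm (?Y - ?I) + norm (?I - ?J)"
        using dist_triangle[of ?X ?J ?Y] dist_triangle[of ?Y ?J ?I] unfolding dist_norm by linarith
      also have "\<dots> < \<delta>" using 1 2 3 \<eta> by (simp add: \<eta>_def)
      finally show "norm ((1 / real (N s - s + 1)) *\<^sub>R (\<Sum>j\<in>idx s (N s). of_real (limit_kernel \<epsilon> (a i) (a j)) * f (a j))
        - ?J) < \<delta>" by (simp only: r_def)
    qed
  qed
  then show "\<forall>\<^sub>F y in row_filter N. dist (case y of (s, i) \<Rightarrow> (1 / real (N s - s + 1)) *\<^sub>R (\<Sum>j\<in>idx s (N s).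
        of_real (limit_kernel \<epsilon> (\<Phi> (real i * T) a0) (\<Phi> (real j * T) a0)) * f (\<Phi> (real j * T) a0))
      - (\<integral>b. of_real (limit_kernel \<epsilon> (\<Phi> (real i * T) a0) b) * f b \<partial>\<mu>)) 0 < \<delta>"
    by (simp add: eventually_row_filter a_def)
qed

end

lemma sample_count_minus: "filterlim (\<lambda>s. sample_count s - s + 1) at_top sequentially"
  unfolding filterlim_at_top
proof
  fix k :: nat
  show "\<forall>\<^sub>F s in sequentially. k \<le> sample_count s - s + 1"
    using sample_count_large eventually_ge_at_top[of "2 * k"]
  proof eventually_elim
    case (elim s)
    have "2 * real k \<le> real s" using elim(2) by linarith
    also have "\<dots> \<le> 2 * real (sample_count s - s + 1)" using elim(1) by linarith
    finally show ?case by (simp only: mult_le_cancel_left_pos zero_less_numeral of_nat_le_iff)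
  qed
qed

context observed_noise_path
begin

theorem Pmat_apply_close:
  fixes f :: "'a \<Rightarrow> complex"
  assumes f: "integrable \<mu> f" and \<epsilon>: "\<epsilon> > 0"
    and n_lim: "filterlim (\<lambda>s. N s - s + 1) at_top sequentially"
    and approx: "\<And>\<delta>. \<delta> > 0 \<Longrightarrow> \<exists>p. continuous_on UNIV p \<and> (\<integral>b. norm (f b - p b) \<partial>\<mu>) \<le> \<delta> \<and>
      (\<forall>n. (\<Sum>j<n. norm (f (\<Phi> (real j * T) a0) - p (\<Phi> (real j * T) a0))) \<le> \<delta> * real n)"
  shows "((\<lambda>(s, i). Pmat_apply m s (N s) \<epsilon> (\<lambda>j. F (\<Phi> (real j * T) a0) + w j) (\<lambda>j. f (\<Phi> (real j * T) a0)) i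
      - P_op m \<mu> \<Phi> T F \<epsilon> f (\<Phi> (real i * T) a0)) \<longlongrightarrow> 0) (row_filter N)"
proof -
  define a where "a j = \<Phi> (real j * T) a0" for j
  obtain B where B: "B > 0" "\<And>a b. dist_lim a b \<le> B" using dist_bounded by blast
  \<comment> \<open>The instance \<open>f = 1\<close> is the convergence of row masses that
    \<open>markov_data\<close> asks for.\<close>
  have mass_c: "((\<lambda>(s, i). (1 / real (N s - s + 1)) *\<^sub>R (\<Sum>j\<in>idx s (N s).
        of_real (limit_kernel \<epsilon> (a i) (a j)) * 1) - (\<integral>b. of_real (limit_kernel \<epsilon> (a i) b) * (1::complex) \<partial>\<mu>)) \<longlongrightarrow> 0) (row_filter N)"
    unfolding a_def
  proof (rule kernel_average_close[OF _ \<epsilon> N n_lim])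
    fix \<delta> :: real assume "\<delta> > 0"
    then show "\<exists>p. continuous_on UNIV p \<and> (\<integral>b. norm ((1::complex) - p b) \<partial>\<mu>) \<le> \<delta> \<and> (\<forall>n. (\<Sum>j<n. norm ((1::complex) - p (\<Phi> (real j * T) a0))) \<le> \<delta> * real n)"
      by (intro exI[of _ "\<lambda>_. 1"]) simp
  qed simp
  have mass: "((\<lambda>(s, i). (1 / real (N s - s + 1)) * (\<Sum>j\<in>idx s (N s). exp (- dist_lim (a i) (a j) / \<epsilon>))) \<longlongrightarrow> mass \<epsilon>) (row_filter N)"
  proof -
    have "((\<lambda>(s, i). (1 / real (N s - s + 1)) * (\<Sum>j\<in>idx s (N s). limit_kernel \<epsilon> (a i) (a j)) - mass \<epsilon>) \<longlongrightarrow> 0) (row_filter N)"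
      using tendsto_Re[OF mass_c] by (simp add: case_prod_unfold integral_kernel)
    from tendsto_add[OF this tendsto_const[of "mass \<epsilon>"]] show ?thesis
      by (simp add: case_prod_unfold limit_kernel_def)
  qed
  have N': "\<forall>\<^sub>F s in sequentially. 1 \<le> s \<and> s \<le> N s" using N by (auto elim: eventually_mono)
  interpret md: markov_data m N \<epsilon> "\<lambda>j. F (a j) + w j" "\<lambda>i j. dist_lim (a i) (a j)" "2 * R\<^sup>2" B "mass \<epsilon>"
    by unfold_locales
      (use \<epsilon> mass_pos N' dist_lim_nonneg B mass noisy_distance_close[of a0] in \<open>simp_all add: a_def\<close>)
  define \<psi> where "\<psi> i = (\<integral>b. of_real (limit_kernel \<epsilon> (a i) b) * f b \<partial>\<mu>)" for i
  have "((\<lambda>(s, i). Pmat_apply m s (N s) \<epsilon> (\<lambda>j. F (a j) + w j) (\<lambda>j. f (a j)) i - \<psi> i / of_real (mass \<epsilon>)) \<longlongrightarrow> 0) (row_filter N)"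
  proof (rule md.Pmat_apply_tendsto)
    show "((\<lambda>(s, i). (1 / real (N s - s + 1)) *\<^sub>R (\<Sum>j\<in>idx s (N s). of_real (exp (- dist_lim (a i) (a j) / \<epsilon>)) * f (a j)) - \<psi> i)
        \<longlongrightarrow> 0) (row_filter N)"
      unfolding \<psi>_def a_def limit_kernel_def[symmetric]
      by (rule kernel_average_close[OF f \<epsilon> N n_lim]) (rule approx)
    show "norm (\<psi> i) \<le> (\<integral>b. norm (f b) \<partial>\<mu>)" for i
    proof -
      have "norm (\<psi> i) \<le> (\<integral>b. norm (of_real (limit_kernel \<epsilon> (a i) b) * f b) \<partial>\<mu>)"
        unfolding \<psi>_def by (rule integral_norm_bound)
      also have "\<dots> \<le> (\<integral>b. norm (f b) \<partial>\<mu>)"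
      proof (rule integral_mono_AE')
        show "AE b in \<mu>. norm (of_real (limit_kernel \<epsilon> (a i) b) * f b) \<le> norm (f b)"
          unfolding norm_mult using kernel_le_1[OF \<epsilon>] kernel_pos
          by (intro AE_I2 mult_left_le_one_le) (auto simp: less_imp_le)
      qed (use f in auto)
      finally show ?thesis .
    qed
    \<comment> \<open>Uniform integrability: with \<open>b\<close> a bound for \<open>p\<close>, the
      excess of \<open>norm (f (a j))\<close> over \<open>b\<close> is at most the approximation
      error.\<close>
    show "\<exists>b. \<forall>\<^sub>F s in sequentially. md.A s (\<lambda>j. max 0 (norm (f (a j)) - b)) \<le> \<delta>" if \<delta>: "\<delta> > 0" for \<delta>
    proof -
      obtain p where p: "continuous_on UNIV p" "\<And>n. (\<Sum>j<n. norm (f (a j) - p (a j))) \<le> \<delta> / 2 * real n"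
        using approx[of "\<delta> / 2"] \<delta> unfolding a_def by (meson half_gt_zero)
      obtain b where b: "\<And>c. norm (p c) \<le> b" using continuous_bounded[OF p(1)] by blast
      have "\<forall>\<^sub>F s in sequentially. md.A s (\<lambda>j. max 0 (norm (f (a j)) - b)) \<le> \<delta>"
        using N
      proof eventually_elim
        case (elim s)
        have "md.A s (\<lambda>j. max 0 (norm (f (a j)) - b)) \<le> md.A s (\<lambda>j. norm (f (a j) - p (a j)))"
        proof (rule md.A_mono)
          fix j
          show "max 0 (norm (f (a j)) - b) \<le> norm (f (a j) - p (a j))"
            using norm_triangle_ineq2[of "f (a j)" "p (a j)"] b[of "a j"] by simp
        qed
        also have "\<dots> \<le> 2 * (\<delta> / 2)"
          unfolding md.A_def real_scaleR_def
          by (rule sum_over_rows_le[where h = "\<lambda>j. norm (f (a j) - p (a j))"]) (use elim \<delta> p(2) in auto)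
        finally show ?case by simp
      qed
      then show ?thesis by blast
    qed
  qed
  then show ?thesis by (simp only: P_op_eq[OF \<epsilon>] \<psi>_def a_def)
qed

end

section \<open>From convergence along rows to the limit superior\<close>

lemma limsup_Max_rows_le_0:
  fixes X :: "nat \<times> nat \<Rightarrow> 'c::real_normed_vector"
  assumes X: "(X \<longlongrightarrow> 0) (row_filter N)" and N: "\<forall>\<^sub>F s in sequentially. 1 \<le> s \<and> s \<le> N s"
  shows "limsup (\<lambda>s. ereal (Max ((\<lambda>i. norm (X (s, i))) ` idx s (N s)))) \<le> 0"
proof (rule ereal_le_epsilon2)
  fix \<delta> :: real assume "\<delta> > 0"
  then have "\<forall>\<^sub>F s in sequentially. \<forall>i\<in>idx s (N s). norm (X (s, i)) < \<delta>"
    using tendstoD[OF X] by (simp add: eventually_row_filter)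
  then have "\<forall>\<^sub>F s in sequentially. ereal (Max ((\<lambda>i. norm (X (s, i))) ` idx s (N s))) \<le> ereal \<delta>"
    using N
  proof eventually_elim
    case (elim s)
    have "idx s (N s) \<noteq> {}" "finite (idx s (N s))" using elim(2) by (auto simp: idx_def)
    then show ?case using elim(1) by (auto simp: less_imp_le)
  qed
  then show "limsup (\<lambda>s. ereal (Max ((\<lambda>i. norm (X (s, i))) ` idx s (N s)))) \<le> 0 + ereal \<delta>"
    by (simp add: Limsup_bounded)
qed

lemma smooth_fun_continuous:
  fixes \<A> :: "('a::topological_space, 'm::finite) chart set" and g :: "'a \<Rightarrow> 'b::real_normed_vector"
  assumes atlas: "smooth_atlas \<A>" and g: "smooth_fun \<A> g"
  shows "continuous_on UNIV g"
proof -
  have "continuous_on (\<Union>c\<in>\<A>. fst c) g"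
  proof (rule continuous_on_open_UN)
    fix c assume c: "c \<in> \<A>"
    obtain U \<phi> where c_eq: "c = (U, \<phi>)" by (cases c)
    have "is_chart (U, \<phi>)" using atlas c c_eq by (auto simp: smooth_atlas_def)
    then have U: "open U" and hom: "homeomorphism U (\<phi> ` U) \<phi> (inv_into U \<phi>)" by (auto simp: is_chart_def)
    show "open (fst c)" by (simp add: c_eq U)
    have "smooth_on (\<phi> ` U) (g \<circ> inv_into U \<phi>)" using g c c_eq by (auto simp: smooth_fun_def)
    then have "C_on 0 (\<phi> ` U) (g \<circ> inv_into U \<phi>)" unfolding smooth_on_def by blast
    then have "continuous_on U ((g \<circ> inv_into U \<phi>) \<circ> \<phi>)"
      using hom by (intro continuous_on_compose[where g = "g \<circ> inv_into U \<phi>"]) (simp_all add: homeomorphism_def)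
    then have "continuous_on U g"
      by (rule continuous_on_eq) (use hom in \<open>simp add: homeomorphism_def\<close>)
    then show "continuous_on (fst c) g" by (simp add: c_eq)
  qed
  moreover have "(\<Union>c\<in>\<A>. fst c) = UNIV" using atlas by (simp add: smooth_atlas_def case_prod_unfold)
  ultimately show ?thesis by simp
qed

theorem theorem22:
  fixes \<A> :: "('a::{t2_space, second_countable_topology}, 'm::finite) chart set"
    and \<Phi> :: "real \<Rightarrow> 'a \<Rightarrow> 'a"
    and \<mu> :: "'a measure"
    and T :: real
    and F :: "'a \<Rightarrow> real ^ 'd"
    and W :: "'w measure"
    and \<xi> :: "nat \<Rightarrow> 'w \<Rightarrow> real ^ 'd"
    and R :: real
    and f :: "'a \<Rightarrow> complex"
  assumes "closed_connected_orientable_manifold \<A>"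
    and "smooth_flow \<A> \<Phi>"
    and "prob_space \<mu>" and "sets \<mu> = sets borel"
    and "invariant_under_flow \<mu> \<Phi>"
    and "smooth_positive_density \<A> \<mu>"
    and "T > 0" and "ergodic_map \<mu> (\<Phi> T)"
    and "smooth_pure_point_spectrum \<A> \<mu> \<Phi>"
    and "smooth_embedding \<A> F"
    and "prob_space W" and "iid_noise W \<xi> R"
    and "f \<in> L2 \<mu>"
  shows "\<exists>N::nat \<Rightarrow> nat.
    filterlim (\<lambda>s. real (N s) / real s) at_top sequentially \<and>
    (AE a0 in \<mu>. AE \<omega> in W. \<exists>C. \<exists>\<epsilon>0>0. \<forall>\<epsilon>. 0 < \<epsilon> \<and> \<epsilon> < \<epsilon>0 \<longrightarrow>
      limsup (\<lambda>s. ereal (Max ((\<lambda>i.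
          norm (Pmat_apply CARD('m) s (N s) \<epsilon> (noisy_obs \<Phi> T F \<xi> a0 \<omega>)
                  (\<lambda>j. f (\<Phi> (real j * T) a0)) i
                - P_op CARD('m) \<mu> \<Phi> T F \<epsilon> f (\<Phi> (real i * T) a0)))
        ` idx s (N s))))
      \<le> ereal (C * \<epsilon>\<^sup>2))"
proof -
  have atlas: "smooth_atlas \<A>" and comp: "compact (UNIV :: 'a set)"
    using assms(1) by (auto simp: closed_connected_orientable_manifold_def)
  obtain \<Omega> :: "'m \<Rightarrow> real" and \<zeta> :: "'m \<Rightarrow> 'a \<Rightarrow> complex" where
    smooth: "\<And>i. smooth_fun \<A> (\<zeta> i)" and norm1: "\<And>i a. norm (\<zeta> i a) = 1"
    and eigen: "\<And>i t a. \<zeta> i (\<Phi> t a) = exp (\<i> * of_real (\<Omega> i * t)) * \<zeta> i a"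
    and onb: "orthonormal_basis_L2 \<mu> (\<lambda>(k::'m \<Rightarrow> int) a. \<Prod>i\<in>UNIV. \<zeta> i a powi k i)"
    using assms(9) unfolding smooth_pure_point_spectrum_def by blast
  obtain G where "homeomorphism UNIV (range F) F G" using assms(10) unfolding smooth_embedding_def by blast
  then have F: "continuous_on UNIV F" "inj F"
    unfolding homeomorphism_def by (auto intro: inj_on_inverseI)
  have flow: "\<And>a. \<Phi> 0 a = a" "\<And>t u a. \<Phi> (t + u) a = \<Phi> t (\<Phi> u a)" "continuous_on UNIV (\<lambda>(t, a). \<Phi> t a)"
    using assms(2) unfolding smooth_flow_def by auto
  interpret kronecker_system \<mu> \<Phi> T \<Omega> \<zeta>
    by (rule kronecker_system.intro[OF comp assms(3,4) flow assms(5,8) smooth_fun_continuous[OF atlas smooth] norm1 eigen onb])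
  interpret observed_system \<mu> \<Phi> T \<Omega> \<zeta> F
    by unfold_locales (rule unique_fibre_AE[OF atlas smooth assms(6) F], rule F(1))
  have count: "\<forall>\<^sub>F s in sequentially. 1 \<le> s \<and> s \<le> sample_count s"
    using sample_count_large by (auto elim: eventually_mono)
  \<comment> \<open>The noise event does not mention \<open>a0\<close>, so it can be fixed before
    the starting state is chosen.\<close>
  have noise: "AE \<omega> in W. observed_noise_path \<mu> \<Phi> T \<Omega> \<zeta> F sample_count (\<lambda>l. \<xi> l \<omega>) R"
    using iid_noise_AE[where z = lam, OF assms(11,12) norm_lam summable_inverse_sample_count]
  proof eventually_elim
    case (elim \<omega>)
    show ?case
      by unfold_locales (use elim sample_count_large sample_count_growth in auto)
  qed
  show ?thesis
  proof (intro exI[of _ sample_count] conjI sample_count_ratio)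
    show "AE a0 in \<mu>. AE \<omega> in W. \<exists>C. \<exists>\<epsilon>0>0. \<forall>\<epsilon>. 0 < \<epsilon> \<and> \<epsilon> < \<epsilon>0 \<longrightarrow>
      limsup (\<lambda>s. ereal (Max ((\<lambda>i.
          norm (Pmat_apply CARD('m) s (sample_count s) \<epsilon> (noisy_obs \<Phi> T F \<xi> a0 \<omega>)
                  (\<lambda>j. f (\<Phi> (real j * T) a0)) i
                - P_op CARD('m) \<mu> \<Phi> T F \<epsilon> f (\<Phi> (real i * T) a0)))
        ` idx s (sample_count s))))
      \<le> ereal (C * \<epsilon>\<^sup>2)"
      using L2_orbit_approx[OF assms(13)]
    proof eventually_elim
      case (elim a0)
      note approx = elim
      show ?case using noise
      proof eventually_elim
        case (elim \<omega>)
        then interpret observed_noise_path \<mu> \<Phi> T \<Omega> \<zeta> F sample_count "\<lambda>l. \<xi> l \<omega>" R .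
        have "limsup (\<lambda>s. ereal (Max ((\<lambda>i.
          norm (Pmat_apply CARD('m) s (sample_count s) \<epsilon> (noisy_obs \<Phi> T F \<xi> a0 \<omega>)
                  (\<lambda>j. f (\<Phi> (real j * T) a0)) i
                - P_op CARD('m) \<mu> \<Phi> T F \<epsilon> f (\<Phi> (real i * T) a0)))
          ` idx s (sample_count s)))) \<le> ereal (0 * \<epsilon>\<^sup>2)" if \<epsilon>: "\<epsilon> > 0" for \<epsilon>
        proof -
          have "((\<lambda>(s, i). Pmat_apply CARD('m) s (sample_count s) \<epsilon> (noisy_obs \<Phi> T F \<xi> a0 \<omega>)
                (\<lambda>j. f (\<Phi> (real j * T) a0)) i - P_op CARD('m) \<mu> \<Phi> T F \<epsilon> f (\<Phi> (real i * T) a0)) \<longlongrightarrow> 0)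
              (row_filter sample_count)"
            unfolding noisy_obs_def[abs_def]
            by (rule Pmat_apply_close[OF L2_integrable[OF assms(13)] \<epsilon> sample_count_minus]) (use approx in blast)
          from limsup_Max_rows_le_0[OF this count] show ?thesis by (simp add: zero_ereal_def[symmetric])
        qed
        \<comment> \<open>The limit superior is at most 0 for every positive \<epsilon>, so the
          threshold 1 is an arbitrary choice.\<close>
        then show ?case by (intro exI[of _ 0] exI[of _ 1]) auto
      qed
    qed
  qed
qed

end
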